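(* Let $N=2m$ with $m\ge1$, let $B$ be a non-degenerate skew-symmetric $N\times N$ complex matrix, and let $V$ be an irreducible integrable $\tau_B$-module with finite dimensional weight spaces with respect to $\widetilde{\mathfrak h}$, such that all $K_i$, $1\le i\le N$, act trivially on $V$ and $\mathfrak g\otimes\mathcal A$ acts non-trivially on $V$. Let $V^+=\{v\in V:\tau_B^+.v=0\}$. Then: (1) the weight spaces of $V^+$ are uniformly bounded, i.e. their dimensions are bounded by a fixed natural number; (2) $\widetilde{\mathcal Z}$ acts trivially on $V^+$.
   Context: All is over $\mathbb{C}$; $(\mathbf u|\mathbf v)=\sum u_iv_i$. $\mathcal A=\mathbb{C}[t_1^{\pm1},\dots,t_N^{\pm1}]$. $\mathfrak g$ is a finite dimensional simple Lie algebra with Cartan subalgebra $\mathfrak h$, root system $\Delta$ with positive roots $\Delta^+$, and nondegenerate invariant symmetric form $\langle\cdot,\cdot\rangle$; $X(\mathbf r)=X\otimes t^{\mathbf r}$. $\mathcal Z=\Omega_{\mathcal A}/d_{\mathcal A}$, where $\Omega_{\mathcal A}$ has basis $t^{\mathbf r}K_i$ ($\mathbf r\in\mathbb{Z}^N$, $1\le i\le N$) and $d_{\mathcal A}=\mathrm{span}\{\sum_i r_it^{\mathbf r}K_i\}$; $K(\mathbf u,\mathbf r)$ is the class of $\sum_iu_it^{\mathbf r}K_i$. $D(\mathbf u,\mathbf r)=\sum_iu_it^{\mathbf r}d_i\in\mathrm{Der}\,\mathcal A$, $d_i=t_i\frac{d}{dt_i}$. The full toroidal Lie algebra is $\mathfrak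 g\otimes\mathcal A\oplus\mathcal Z\oplus\mathrm{Der}\,\mathcal A$ with $[X(\mathbf r),Y(\mathbf s)]=[X,Y](\mathbf r+\mathbf s)+\langle X,Y\rangle K(\mathbf r,\mathbf r+\mathbf s)$; $[\mathcal Z,\mathfrak g\otimes\mathcal A]=[\mathcal Z,\mathcal Z]=0$; $[D(\mathbf u,\mathbf r),X(\mathbf s)]=(\mathbf u|\mathbf s)X(\mathbf r+\mathbf s)$; $[D(\mathbf u,\mathbf r),K(\mathbf v,\mathbf s)]=(\mathbf u|\mathbf s)K(\mathbf v,\mathbf r+\mathbf s)+(\mathbf u|\mathbf v)K(\mathbf r,\mathbf r+\mathbf s)$; $[D(\mathbf u,\mathbf r),D(\mathbf v,\mathbf s)]=D((\mathbf u|\mathbf s)\mathbf v-(\mathbf v|\mathbf r)\mathbf u,\mathbf r+\mathbf s)-(\mathbf u|\mathbf s)(\mathbf v|\mathbf r)K(\mathbf r,\mathbf r+\mathbf s)$. $\widetilde{H_B}=\mathrm{span}\{D(B\mathbf r,\mathbf r):\mathbf r\in\mathbb{Z}^N\setminus\{\mathbf 0\}\}\oplus\mathcal D$, $\mathcal D=\mathrm{span}\{d_1,\dots,d_N\}$; $\mathcal K_B=\mathrm{span}\{K(\mathbf u,\mathbf r):(B\mathbf u|\mathbf r)=0,\ \mathbf r\ne\mathbf 0\}$; $\widetilde{\mathcal Z}=\mathcal Z/\mathcal K_B$; $\tau_B=\mathfrak g\otimes\mathcal A\oplus\widetilde{\mathcal Z}\oplus\widetilde{H_B}$ (quotient of $\mathfrak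 g\otimes\mathcal A\oplus\mathcal Z\oplus\widetilde{H_B}$ by the ideal $\mathcal K_B$). $\widetilde{\mathfrak h}=\mathfrak h\oplus\mathrm{span}\{K_1,\dots,K_N\}\oplus\mathcal D$. $\tau_B^+=\mathrm{span}\{X_\alpha(\mathbf r):\alpha\in\Delta^+,X_\alpha\in\mathfrak g_\alpha,\mathbf r\in\mathbb{Z}^N\}$. A $\tau_B$-module is integrable if it is the direct sum of its $\widetilde{\mathfrak h}$-weight spaces and $X_\alpha(\mathbf m)$ acts locally nilpotently for all $\alpha\in\Delta$, $X_\alpha\in\mathfrak g_\alpha$, $\mathbf m\in\mathbb{Z}^N$. Weight spaces of $V^+$ are with respect to $\widetilde{\mathfrak h}$. *)

theory Defs
  imports "HOL-Analysis.Analysis" "HOL-Library.Poly_Mapping" "HOL-Library.Set_Algebras"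
begin

section \<open>Finite dimensional simple Lie algebras over the complex numbers\<close>

locale lie_algebra = vector_space sc
  for sc :: "complex \<Rightarrow> 'g::ab_group_add \<Rightarrow> 'g" +
  fixes bracket :: "'g \<Rightarrow> 'g \<Rightarrow> 'g"
  assumes bracket_add_left: "bracket (x + y) z = bracket x z + bracket y z"
    and bracket_add_right: "bracket x (y + z) = bracket x y + bracket x z"
    and bracket_scale_left: "bracket (sc c x) y = sc c (bracket x y)"
    and bracket_scale_right: "bracket x (sc c y) = sc c (bracket x y)"
    and bracket_self: "bracket x x = 0"
    and jacobi: "bracket x (bracket y z) + bracket y (bracket z x) + bracket z (bracket x y) = 0"

definition fin_dim :: "(complex \<Rightarrow> 'a::ab_group_add \<Rightarrow> 'a) \<Rightarrow> 'a set \<Rightarrow> bool" where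
  "fin_dim sc W \<longleftrightarrow> (\<exists>S. finite S \<and> W \<subseteq> module.span sc S)"

definition lie_ideal ::
    "(complex \<Rightarrow> 'g::ab_group_add \<Rightarrow> 'g) \<Rightarrow> ('g \<Rightarrow> 'g \<Rightarrow> 'g) \<Rightarrow> 'g set \<Rightarrow> bool" where
  "lie_ideal sc bracket I \<longleftrightarrow>
     module.subspace sc I \<and> (\<forall>x. \<forall>y\<in>I. bracket x y \<in> I)"

definition simple_lie_algebra ::
    "(complex \<Rightarrow> 'g::ab_group_add \<Rightarrow> 'g) \<Rightarrow> ('g \<Rightarrow> 'g \<Rightarrow> 'g) \<Rightarrow> bool" where
  "simple_lie_algebra sc bracket \<longleftrightarrow>
     lie_algebra sc bracket \<and> fin_dim sc UNIV \<and>
     (\<exists>x y. bracket x y \<noteq> 0) \<and>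
     (\<forall>I. lie_ideal sc bracket I \<longrightarrow> I = {0} \<or> I = UNIV)"

definition nondegenerate_invariant_symmetric_form ::
    "(complex \<Rightarrow> 'g::ab_group_add \<Rightarrow> 'g) \<Rightarrow> ('g \<Rightarrow> 'g \<Rightarrow> 'g) \<Rightarrow> ('g \<Rightarrow> 'g \<Rightarrow> complex) \<Rightarrow> bool" where
  "nondegenerate_invariant_symmetric_form sc bracket form \<longleftrightarrow>
     (\<forall>x y z. form (x + y) z = form x z + form y z) \<and>
     (\<forall>c x y. form (sc c x) y = c * form x y) \<and>
     (\<forall>x y. form x y = form y x) \<and>
     (\<forall>x y z. form (bracket x y) z = form x (bracket y z)) \<and>
     (\<forall>x. (\<forall>y. form x y = 0) \<longrightarrow> x = 0)"

text \<open>The usual definition of a Cartan subalgebra of a complex semisimple Lie algebra: a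
  self-centralizing commutative subspace whose elements are ad-diagonalizable.\<close>

definition cartan_subalgebra ::
    "(complex \<Rightarrow> 'g::ab_group_add \<Rightarrow> 'g) \<Rightarrow> ('g \<Rightarrow> 'g \<Rightarrow> 'g) \<Rightarrow> 'g set \<Rightarrow> bool" where
  "cartan_subalgebra sc bracket H \<longleftrightarrow>
     module.subspace sc H \<and>
     (\<forall>x\<in>H. \<forall>y\<in>H. bracket x y = 0) \<and>
     (\<forall>x. (\<forall>h\<in>H. bracket h x = 0) \<longrightarrow> x \<in> H) \<and>
     (\<forall>h\<in>H. module.span sc {x. \<exists>c. bracket h x = sc c x} = UNIV)"

text \<open>The dual space of a subspace \<open>S\<close>. A functional on \<open>S\<close> is represented by its extension by
  zero outside \<open>S\<close>, so that equality of functions is equality of functionals. The operations are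
  parameters because the definition is also used for a space of cosets.\<close>

definition dual_space ::
    "('a \<Rightarrow> 'a \<Rightarrow> 'a) \<Rightarrow> (complex \<Rightarrow> 'a \<Rightarrow> 'a) \<Rightarrow> 'a set \<Rightarrow> ('a \<Rightarrow> complex) set" where
  "dual_space add sc S =
     {f. (\<forall>x\<in>S. \<forall>y\<in>S. f (add x y) = f x + f y) \<and>
         (\<forall>c. \<forall>x\<in>S. f (sc c x) = c * f x) \<and>
         (\<forall>x. x \<notin> S \<longrightarrow> f x = 0)}"

definition root_space ::
    "(complex \<Rightarrow> 'g::ab_group_add \<Rightarrow> 'g) \<Rightarrow> ('g \<Rightarrow> 'g \<Rightarrow> 'g) \<Rightarrow> 'g set \<Rightarrow> ('g \<Rightarrow> complex) \<Rightarrow> 'g set" where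
  "root_space sc bracket H \<alpha> = {x. \<forall>h\<in>H. bracket h x = sc (\<alpha> h) x}"

definition roots ::
    "(complex \<Rightarrow> 'g::ab_group_add \<Rightarrow> 'g) \<Rightarrow> ('g \<Rightarrow> 'g \<Rightarrow> 'g) \<Rightarrow> 'g set \<Rightarrow> ('g \<Rightarrow> complex) set" where
  "roots sc bracket H =
     {\<alpha> \<in> dual_space (+) sc H. \<alpha> \<noteq> (\<lambda>_. 0) \<and> root_space sc bracket H \<alpha> \<noteq> {0}}"

definition nat_combination :: "('g \<Rightarrow> complex) set \<Rightarrow> ('g \<Rightarrow> complex) \<Rightarrow> bool" where
  "nat_combination S \<alpha> \<longleftrightarrow> (\<exists>k :: ('g \<Rightarrow> complex) \<Rightarrow> nat. \<alpha> = (\<lambda>x. \<Sum>\<beta>\<in>S. of_nat (k \<beta>) * \<beta> x))"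

definition root_base ::
    "(complex \<Rightarrow> 'g::ab_group_add \<Rightarrow> 'g) \<Rightarrow> ('g \<Rightarrow> 'g \<Rightarrow> 'g) \<Rightarrow> 'g set \<Rightarrow> ('g \<Rightarrow> complex) set \<Rightarrow> bool" where
  "root_base sc bracket H S \<longleftrightarrow>
     finite S \<and> S \<subseteq> roots sc bracket H \<and>
     (\<forall>c :: ('g \<Rightarrow> complex) \<Rightarrow> complex.
        (\<forall>x. (\<Sum>\<beta>\<in>S. c \<beta> * \<beta> x) = 0) \<longrightarrow> (\<forall>\<beta>\<in>S. c \<beta> = 0)) \<and>
     (\<forall>\<alpha>\<in>roots sc bracket H. nat_combination S \<alpha> \<or> nat_combination S (\<lambda>x. - \<alpha> x))"

definition positive_system ::
    "(complex \<Rightarrow> 'g::ab_group_add \<Rightarrow> 'g) \<Rightarrow> ('g \<Rightarrow> 'g \<Rightarrow> 'g) \<Rightarrow> 'g set \<Rightarrow> ('g \<Rightarrow> complex) set \<Rightarrow> bool" where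
  "positive_system sc bracket H P \<longleftrightarrow>
     (\<exists>S. root_base sc bracket H S \<and> P = {\<alpha> \<in> roots sc bracket H. nat_combination S \<alpha>})"


section \<open>Finitely supported families\<close>

definition pm_scale ::
    "(complex \<Rightarrow> 'b::zero \<Rightarrow> 'b) \<Rightarrow> complex \<Rightarrow> ('a \<Rightarrow>\<^sub>0 'b) \<Rightarrow> ('a \<Rightarrow>\<^sub>0 'b)" where
  "pm_scale sc c p = Poly_Mapping.map (sc c) p"

text \<open>The value of a biadditive operation on \<open>\<Sum>\<^sub>r t\<^sup>r x\<^sub>r\<close> and \<open>\<Sum>\<^sub>s t\<^sup>s y\<^sub>s\<close>, where
  \<open>\<beta> r x s y\<close> is its value on \<open>t\<^sup>r x\<close> and \<open>t\<^sup>s y\<close>.\<close>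

definition pm_bi ::
    "('a \<Rightarrow> 'b \<Rightarrow> 'c \<Rightarrow> 'd \<Rightarrow> 'e) \<Rightarrow> ('a \<Rightarrow>\<^sub>0 'b::zero) \<Rightarrow> ('c \<Rightarrow>\<^sub>0 'd::zero) \<Rightarrow> 'e::comm_monoid_add" where
  "pm_bi \<beta> p q = (\<Sum>r\<in>Poly_Mapping.keys p. \<Sum>s\<in>Poly_Mapping.keys q.
      \<beta> r (Poly_Mapping.lookup p r) s (Poly_Mapping.lookup q s))"

lemma lookup_pm_scale:
  assumes "sc c 0 = 0"
  shows "Poly_Mapping.lookup (pm_scale sc c p) a = sc c (Poly_Mapping.lookup p a)"
  using assms by (auto simp: pm_scale_def Poly_Mapping.map.rep_eq when_def)

lemma vector_space_pm_scale:
  fixes sc :: "complex \<Rightarrow> 'b::ab_group_add \<Rightarrow> 'b"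
  assumes "vector_space sc"
  shows "vector_space (pm_scale sc :: complex \<Rightarrow> ('a \<Rightarrow>\<^sub>0 'b) \<Rightarrow> _)"
proof -
  interpret vector_space sc by fact
  show ?thesis
    by unfold_locales
      (auto intro!: poly_mapping_eqI
        simp: lookup_pm_scale lookup_add scale_left_distrib scale_right_distrib)
qed

lemma pm_bi_single:
  assumes "\<And>s d. \<beta> r 0 s d = 0" "\<And>b. \<beta> r b s 0 = 0"
  shows "pm_bi \<beta> (Poly_Mapping.single r b) (Poly_Mapping.single s d) = \<beta> r b s d"
  using assms by (cases "b = 0"; cases "d = 0") (auto simp: pm_bi_def)

lemma pm_bi_zero [simp]: "pm_bi \<beta> 0 q = 0" "pm_bi \<beta> p 0 = 0"
  by (auto simp: pm_bi_def)

lemma pm_bi_add_right: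
  assumes "\<And>r b s. \<beta> r b s 0 = 0" "\<And>r b s d e. \<beta> r b s (d + e) = \<beta> r b s d + \<beta> r b s e"
  shows "pm_bi \<beta> p (q + q') = pm_bi \<beta> p q + pm_bi \<beta> p q'"
proof -
  let ?S = "Poly_Mapping.keys q \<union> Poly_Mapping.keys q'"
  have *: "pm_bi \<beta> p u = (\<Sum>r\<in>Poly_Mapping.keys p. \<Sum>s\<in>?S.
      \<beta> r (Poly_Mapping.lookup p r) s (Poly_Mapping.lookup u s))"
    if "Poly_Mapping.keys u \<subseteq> ?S" for u
    unfolding pm_bi_def
    by (rule sum.cong[OF refl], rule sum.mono_neutral_left)
      (use that assms in \<open>auto simp: in_keys_iff\<close>)
  show ?thesis
    by (subst (1 2 3) *) (simp_all add: Poly_Mapping.keys_add lookup_add assms(2) sum.distrib)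
qed


section \<open>The full toroidal Lie algebra\<close>

text \<open>\<open>(u|v) = \<Sum> u\<^sub>i v\<^sub>i\<close>; this is complex bilinear, unlike \<open>(\<bullet>)\<close> on \<open>complex ^ 'n\<close>.\<close>

definition cdot :: "complex ^ 'n::finite \<Rightarrow> complex ^ 'n \<Rightarrow> complex" where
  "cdot u v = (\<Sum>i\<in>UNIV. u $ i * v $ i)"

definition cvec :: "int ^ 'n::finite \<Rightarrow> complex ^ 'n" where
  "cvec r = (\<chi> i. of_int (r $ i))"

text \<open>\<open>\<Omega>\<^sub>A\<close> is the type \<open>int ^ 'n \<Rightarrow>\<^sub>0 complex ^ 'n\<close>: \<open>single r u\<close> is \<open>\<Sum> u\<^sub>i t\<^sup>r K\<^sub>i\<close>. The same type
  serves for \<open>Der A\<close>, where \<open>single r u\<close> is \<open>D(u, r) = \<Sum> u\<^sub>i t\<^sup>r d\<^sub>i\<close>. Likewise \<open>\<gg> \<otimes> A\<close> is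
  \<open>int ^ 'n \<Rightarrow>\<^sub>0 'g\<close>, where \<open>single r X\<close> is \<open>X(r) = X \<otimes> t\<^sup>r\<close>.\<close>

definition exact_forms :: "(int ^ 'n::finite \<Rightarrow>\<^sub>0 complex ^ 'n) set" where
  "exact_forms = module.span (pm_scale (*s)) (range (\<lambda>r. Poly_Mapping.single r (cvec r)))"

interpretation omega: vector_space
  "pm_scale (*s) :: complex \<Rightarrow> (int ^ 'n::finite \<Rightarrow>\<^sub>0 complex ^ 'n) \<Rightarrow> _"
  by (rule vector_space_pm_scale) (rule vec.vector_space_axioms)

lemma subspace_exact_forms: "omega.subspace exact_forms"
  by (simp add: exact_forms_def)

quotient_type 'n center = "int ^ 'n::finite \<Rightarrow>\<^sub>0 complex ^ 'n" /
  "\<lambda>x y :: int ^ 'n \<Rightarrow>\<^sub>0 complex ^ 'n. x - y \<in> exact_forms"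
proof (rule equivpI)
  show "reflp (\<lambda>x y :: int ^ 'n \<Rightarrow>\<^sub>0 complex ^ 'n. x - y \<in> exact_forms)"
    by (auto intro!: reflpI omega.subspace_0 subspace_exact_forms)
  show "symp (\<lambda>x y :: int ^ 'n \<Rightarrow>\<^sub>0 complex ^ 'n. x - y \<in> exact_forms)"
  proof (rule sympI)
    fix x y :: "int ^ 'n \<Rightarrow>\<^sub>0 complex ^ 'n"
    assume "x - y \<in> exact_forms"
    from omega.subspace_neg[OF subspace_exact_forms this] show "y - x \<in> exact_forms" by simp
  qed
  show "transp (\<lambda>x y :: int ^ 'n \<Rightarrow>\<^sub>0 complex ^ 'n. x - y \<in> exact_forms)"
  proof (rule transpI)
    fix x y z :: "int ^ 'n \<Rightarrow>\<^sub>0 complex ^ 'n"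
    assume "x - y \<in> exact_forms" "y - z \<in> exact_forms"
    from omega.subspace_add[OF subspace_exact_forms this] show "x - z \<in> exact_forms" by simp
  qed
qed

lemma center_cases:
  fixes z :: "'n::finite center"
  obtains x where "z = abs_center x"
  using center.abs_induct[of "\<lambda>z. \<exists>x. z = abs_center x" z] by blast

instantiation center :: (finite) ab_group_add
begin

lift_definition zero_center :: "'a center" is 0 .

lift_definition plus_center :: "'a center \<Rightarrow> 'a center \<Rightarrow> 'a center" is "(+)"
proof -
  fix a b c d :: "int ^ 'a \<Rightarrow>\<^sub>0 complex ^ 'a"
  assume "a - b \<in> exact_forms" "c - d \<in> exact_forms"
  from omega.subspace_add[OF subspace_exact_forms this]
  show "a + c - (b + d) \<in> exact_forms" by (simp only: add_diff_add)
qed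

lift_definition uminus_center :: "'a center \<Rightarrow> 'a center" is uminus
proof -
  fix a b :: "int ^ 'a \<Rightarrow>\<^sub>0 complex ^ 'a"
  assume "a - b \<in> exact_forms"
  from omega.subspace_neg[OF subspace_exact_forms this]
  show "- a - - b \<in> exact_forms" by (simp only: minus_diff_minus)
qed

lift_definition minus_center :: "'a center \<Rightarrow> 'a center \<Rightarrow> 'a center" is "(-)"
proof -
  fix a b c d :: "int ^ 'a \<Rightarrow>\<^sub>0 complex ^ 'a"
  assume "a - b \<in> exact_forms" "c - d \<in> exact_forms"
  from omega.subspace_diff[OF subspace_exact_forms this]
  show "a - c - (b - d) \<in> exact_forms" by (simp add: algebra_simps)
qed

instance
proof
  fix a b c :: "'a center"
  obtain x where [simp]: "a = abs_center x" by (rule center_cases)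
  obtain y where [simp]: "b = abs_center y" by (rule center_cases)
  obtain z where [simp]: "c = abs_center z" by (rule center_cases)
  note abs = zero_center.abs_eq plus_center.abs_eq uminus_center.abs_eq minus_center.abs_eq
  show "a + b + c = a + (b + c)" "a + b = b + a" "0 + a = a" "- a + a = 0" "a - b = a + - b"
    by (simp_all add: abs ac_simps)
qed

end

lift_definition center_scale :: "complex \<Rightarrow> 'n::finite center \<Rightarrow> 'n center" is "pm_scale (*s)"
proof -
  fix c and a b :: "int ^ 'n \<Rightarrow>\<^sub>0 complex ^ 'n"
  assume "a - b \<in> exact_forms"
  from omega.subspace_scale[OF subspace_exact_forms this]
  show "pm_scale (*s) c a - pm_scale (*s) c b \<in> exact_forms"
    by (simp only: omega.scale_right_diff_distrib)
qed

lift_definition center_K :: "complex ^ 'n::finite \<Rightarrow> int ^ 'n \<Rightarrow> 'n center"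
  is "\<lambda>u r. Poly_Mapping.single r u" .

lemma vector_space_center_scale: "vector_space (center_scale :: complex \<Rightarrow> 'n::finite center \<Rightarrow> _)"
proof
  fix c d :: complex and z w :: "'n center"
  obtain x where [simp]: "z = abs_center x" by (rule center_cases)
  obtain y where [simp]: "w = abs_center y" by (rule center_cases)
  show "center_scale c (z + w) = center_scale c z + center_scale c w"
    by (simp add: center_scale.abs_eq plus_center.abs_eq omega.scale_right_distrib)
  show "center_scale (c + d) z = center_scale c z + center_scale d z"
    by (simp add: center_scale.abs_eq plus_center.abs_eq omega.scale_left_distrib)
  show "center_scale c (center_scale d z) = center_scale (c * d) z"
    by (simp add: center_scale.abs_eq)
  show "center_scale 1 z = z"
    by (simp add: center_scale.abs_eq)
qed

lemma cdot_linear [simp]: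
  "cdot u (v + w) = cdot u v + cdot u w" "cdot (u + v) w = cdot u w + cdot v w"
  "cdot u (c *s v) = c * cdot u v" "cdot (c *s u) v = c * cdot u v"
  "cdot u 0 = 0" "cdot 0 u = 0"
  by (simp_all add: cdot_def sum.distrib algebra_simps sum_distrib_left)

lemma cvec_add: "cvec (r + s) = cvec r + cvec s"
  by (simp add: cvec_def vec_eq_iff)

text \<open>The action of \<open>Der A\<close> on \<open>\<Omega>\<^sub>A\<close>, which preserves the exact forms.\<close>

definition der_on_forms ::
    "(int ^ 'n::finite \<Rightarrow>\<^sub>0 complex ^ 'n) \<Rightarrow> (int ^ 'n \<Rightarrow>\<^sub>0 complex ^ 'n) \<Rightarrow> (int ^ 'n \<Rightarrow>\<^sub>0 complex ^ 'n)" where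
  "der_on_forms = pm_bi (\<lambda>r u s v.
     Poly_Mapping.single (r + s) (cdot u (cvec s) *s v) +
     Poly_Mapping.single (r + s) (cdot u v *s cvec r))"

lemma der_on_forms_add: "der_on_forms p (x + y) = der_on_forms p x + der_on_forms p y"
  unfolding der_on_forms_def
  by (rule pm_bi_add_right) (simp_all add: single_add vec.scale_right_distrib vec.scale_left_distrib)

lemma der_on_forms_single:
  "der_on_forms p (Poly_Mapping.single s v) = (\<Sum>r\<in>Poly_Mapping.keys p.
     Poly_Mapping.single (r + s) (cdot (Poly_Mapping.lookup p r) (cvec s) *s v) +
     Poly_Mapping.single (r + s) (cdot (Poly_Mapping.lookup p r) v *s cvec r))"
  by (cases "v = 0") (simp_all add: der_on_forms_def pm_bi_def)

lemma der_on_forms_exact: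
  fixes p x :: "int ^ 'n::finite \<Rightarrow>\<^sub>0 complex ^ 'n"
  assumes "x \<in> exact_forms"
  shows "der_on_forms p x \<in> exact_forms"
proof -
  have gen: "pm_scale (*s) c (Poly_Mapping.single r (cvec r)) \<in> exact_forms" for c and r :: "int ^ 'n"
    unfolding exact_forms_def by (intro omega.span_scale omega.span_base) auto
  have sc: "pm_scale (*s) c (Poly_Mapping.single r v) = Poly_Mapping.single r (c *s v)"
    for c and r :: "int ^ 'n" and v :: "complex ^ 'n"
    by (rule poly_mapping_eqI) (simp add: lookup_pm_scale lookup_single when_def)
  have *: "der_on_forms p (pm_scale (*s) c (Poly_Mapping.single s (cvec s))) \<in> exact_forms" for c and s :: "int ^ 'n"
  proof -
    have "Poly_Mapping.single (r + s) (cdot u (cvec s) *s (c *s cvec s)) +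
       Poly_Mapping.single (r + s) (cdot u (c *s cvec s) *s cvec r) \<in> exact_forms" for r u
      using gen[of "c * cdot u (cvec s)" "r + s"]
      by (simp add: sc cvec_add vec.scale_right_distrib single_add algebra_simps)
    then show ?thesis
      unfolding sc der_on_forms_single by (intro omega.subspace_sum subspace_exact_forms)
  qed
  from assms show ?thesis
    unfolding exact_forms_def
  proof (induction rule: omega.span_induct_alt)
    case base
    then show ?case by (simp add: der_on_forms_def omega.span_zero)
  next
    case (step c x y)
    then show ?case
      using * by (auto simp: der_on_forms_add exact_forms_def intro!: omega.span_add)
  qed
qed

lift_definition der_on_center ::
    "(int ^ 'n::finite \<Rightarrow>\<^sub>0 complex ^ 'n) \<Rightarrow> 'n center \<Rightarrow> 'n center" is der_on_forms
proof -
  fix p a b :: "int ^ 'n \<Rightarrow>\<^sub>0 complex ^ 'n"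
  assume "a - b \<in> exact_forms"
  then have "der_on_forms p (a - b) \<in> exact_forms" by (rule der_on_forms_exact)
  moreover have "der_on_forms p a = der_on_forms p (a - b) + der_on_forms p b"
    by (simp flip: der_on_forms_add)
  ultimately show "der_on_forms p a - der_on_forms p b \<in> exact_forms" by simp
qed

type_synonym ('g, 'n) toroidal =
  "(int ^ 'n \<Rightarrow>\<^sub>0 'g) \<times> 'n center \<times> (int ^ 'n \<Rightarrow>\<^sub>0 complex ^ 'n)"

definition tor_scale ::
    "(complex \<Rightarrow> 'g::ab_group_add \<Rightarrow> 'g) \<Rightarrow> complex \<Rightarrow> ('g, 'n::finite) toroidal \<Rightarrow> ('g, 'n) toroidal" where
  "tor_scale sc c = (\<lambda>(f, z, p). (pm_scale sc c f, center_scale c z, pm_scale (*s) c p))"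

definition tor_bracket ::
    "(complex \<Rightarrow> 'g::ab_group_add \<Rightarrow> 'g) \<Rightarrow> ('g \<Rightarrow> 'g \<Rightarrow> 'g) \<Rightarrow> ('g \<Rightarrow> 'g \<Rightarrow> complex) \<Rightarrow>
     ('g, 'n::finite) toroidal \<Rightarrow> ('g, 'n) toroidal \<Rightarrow> ('g, 'n) toroidal" where
  "tor_bracket sc bracket form = (\<lambda>(f, z, p) (g, w, q).
    (pm_bi (\<lambda>r X s Y. Poly_Mapping.single (r + s) (bracket X Y)) f g
       + pm_bi (\<lambda>r u s Y. Poly_Mapping.single (r + s) (sc (cdot u (cvec s)) Y)) p g
       - pm_bi (\<lambda>r u s X. Poly_Mapping.single (r + s) (sc (cdot u (cvec s)) X)) q f,
     pm_bi (\<lambda>r X s Y. center_scale (form X Y) (center_K (cvec r) (r + s))) f g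
       + der_on_center p w - der_on_center q z
       - pm_bi (\<lambda>r u s v. center_scale (cdot u (cvec s) * cdot v (cvec r))
                            (center_K (cvec r) (r + s))) p q,
     pm_bi (\<lambda>r u s v. Poly_Mapping.single (r + s)
                         (cdot u (cvec s) *s v - cdot v (cvec r) *s u)) p q))"

definition tor_X :: "'g::ab_group_add \<Rightarrow> int ^ 'n::finite \<Rightarrow> ('g, 'n) toroidal" where
  "tor_X X r = (Poly_Mapping.single r X, 0, 0)"

definition tor_K :: "complex ^ 'n::finite \<Rightarrow> int ^ 'n \<Rightarrow> ('g::ab_group_add, 'n) toroidal" where
  "tor_K u r = (0, center_K u r, 0)"

definition tor_D :: "complex ^ 'n::finite \<Rightarrow> int ^ 'n \<Rightarrow> ('g::ab_group_add, 'n) toroidal" where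
  "tor_D u r = (0, 0, Poly_Mapping.single r u)"

lemma center_K_zero [simp]: "center_K 0 r = 0"
  by (simp add: center_K.abs_eq zero_center.abs_eq)

lemma center_scale_zero [simp]:
  fixes z :: "'n::finite center"
  shows "center_scale 0 z = 0" "center_scale c (0 :: 'n center) = 0"
proof -
  interpret vector_space "center_scale :: complex \<Rightarrow> 'n center \<Rightarrow> _"
    by (rule vector_space_center_scale)
  show "center_scale 0 z = 0" "center_scale c (0 :: 'n center) = 0" by simp_all
qed

lemma center_scale_K: "center_scale c (center_K u r) = center_K (c *s u) r"
proof -
  have "pm_scale (*s) c (Poly_Mapping.single r u) = Poly_Mapping.single r (c *s u)"
    by (rule poly_mapping_eqI) (simp add: lookup_pm_scale lookup_single when_def)
  then show ?thesis
    by (simp add: center_K.abs_eq center_scale.abs_eq)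
qed

lemma der_on_center_add: "der_on_center p (z + w) = der_on_center p z + der_on_center p w"
  by (induction z rule: center.abs_induct, induction w rule: center.abs_induct)
    (simp add: der_on_center.abs_eq plus_center.abs_eq der_on_forms_add)

lemma der_on_center_zero [simp]: "der_on_center 0 z = 0" "der_on_center p 0 = 0"
proof -
  show "der_on_center 0 z = 0"
    by (induction z rule: center.abs_induct)
      (simp add: der_on_center.abs_eq zero_center.abs_eq der_on_forms_def)
  show "der_on_center p 0 = 0"
    using der_on_center_add[of p 0 0] by simp
qed

lemma der_on_center_K:
  "der_on_center (Poly_Mapping.single r u) (center_K v s) =
     center_scale (cdot u (cvec s)) (center_K v (r + s)) +
     center_scale (cdot u v) (center_K (cvec r) (r + s))"
proof -
  have "der_on_forms (Poly_Mapping.single r u) (Poly_Mapping.single s v) =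
     Poly_Mapping.single (r + s) (cdot u (cvec s) *s v) +
     Poly_Mapping.single (r + s) (cdot u v *s cvec r)"
    unfolding der_on_forms_def by (subst pm_bi_single) simp_all
  then show ?thesis
    unfolding center_scale_K
    by (simp only: center_K.abs_eq der_on_center.abs_eq plus_center.abs_eq)
qed

text \<open>The defining relations of the full toroidal Lie algebra.\<close>

lemma tor_bracket_generators:
  fixes sc :: "complex \<Rightarrow> 'g::ab_group_add \<Rightarrow> 'g" and r s :: "int ^ 'n::finite"
  assumes "lie_algebra sc bracket" "nondegenerate_invariant_symmetric_form sc bracket form"
  defines "br \<equiv> tor_bracket sc bracket form"
  shows "br (tor_X X r) (tor_X Y s) =
           tor_X (bracket X Y) (r + s) + tor_scale sc (form X Y) (tor_K (cvec r) (r + s))"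
    and "br (tor_K u r) (tor_X X s) = 0"
    and "br (tor_K u r) (tor_K v s) = 0"
    and "br (tor_D u r) (tor_X X s) = tor_scale sc (cdot u (cvec s)) (tor_X X (r + s))"
    and "br (tor_D u r) (tor_K v s) =
           tor_scale sc (cdot u (cvec s)) (tor_K v (r + s)) +
           tor_scale sc (cdot u v) (tor_K (cvec r) (r + s))"
    and "br (tor_D u r) (tor_D v s) =
           tor_D (cdot u (cvec s) *s v - cdot v (cvec r) *s u) (r + s) -
           tor_scale sc (cdot u (cvec s) * cdot v (cvec r)) (tor_K (cvec r) (r + s))"
proof -
  interpret lie_algebra sc bracket by fact
  have br0: "bracket 0 x = 0" "bracket x 0 = 0" for x
    using bracket_scale_left[of 0 0 x] bracket_scale_right[of x 0 0] by simp_all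
  have form_left: "\<forall>x y z. form (x + y) z = form x z + form y z"
    using assms(2) unfolding nondegenerate_invariant_symmetric_form_def by (elim conjE)
  have form_sym: "\<forall>x y. form x y = form y x"
    using assms(2) unfolding nondegenerate_invariant_symmetric_form_def by (elim conjE)
  have form0_left: "form 0 x = 0" for x
    using form_left[rule_format, of 0 0 x] by simp
  have form0: "form 0 x = 0" "form x 0 = 0" for x
    using form0_left form_sym[rule_format, of x 0] by simp_all
  have pm0: "pm_scale sc c (0 :: int ^ 'n \<Rightarrow>\<^sub>0 _) = 0" "pm_scale (*s) c (0 :: int ^ 'n \<Rightarrow>\<^sub>0 complex ^ 'n) = 0" for c
    by (auto intro!: poly_mapping_eqI simp: lookup_pm_scale)
  have pms: "pm_scale sc c (Poly_Mapping.single r x) = Poly_Mapping.single r (sc c x)"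
    for c x and r :: "int ^ 'n"
    by (rule poly_mapping_eqI) (simp add: lookup_pm_scale lookup_single when_def)
  note d = br_def tor_bracket_def tor_X_def tor_K_def tor_D_def tor_scale_def zero_prod_def
  show "br (tor_X X r) (tor_X Y s) =
           tor_X (bracket X Y) (r + s) + tor_scale sc (form X Y) (tor_K (cvec r) (r + s))"
    "br (tor_K u r) (tor_X X s) = 0"
    "br (tor_K u r) (tor_K v s) = 0"
    "br (tor_D u r) (tor_X X s) = tor_scale sc (cdot u (cvec s)) (tor_X X (r + s))"
    "br (tor_D u r) (tor_K v s) =
           tor_scale sc (cdot u (cvec s)) (tor_K v (r + s)) +
           tor_scale sc (cdot u v) (tor_K (cvec r) (r + s))"
    "br (tor_D u r) (tor_D v s) =
           tor_D (cdot u (cvec s) *s v - cdot v (cvec r) *s u) (r + s) -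
           tor_scale sc (cdot u (cvec s) * cdot v (cvec r)) (tor_K (cvec r) (r + s))"
    unfolding d by (simp_all add: pm_bi_single br0 form0 pm0 pms der_on_center_K)
qed


section \<open>The algebra \<open>\<tau>\<^sub>B\<close>\<close>

definition der_span_d :: "(int ^ 'n::finite \<Rightarrow>\<^sub>0 complex ^ 'n) set" where
  "der_span_d = module.span (pm_scale (*s)) (range (\<lambda>i. Poly_Mapping.single 0 (axis i 1)))"

definition center_span_K :: "'n::finite center set" where
  "center_span_K = module.span center_scale (range (\<lambda>i. center_K (axis i 1) 0))"

definition H_tilde :: "complex ^ 'n ^ 'n \<Rightarrow> (int ^ 'n::finite \<Rightarrow>\<^sub>0 complex ^ 'n) set" where
  "H_tilde B =
     module.span (pm_scale (*s)) {Poly_Mapping.single r (B *v cvec r) |r. r \<noteq> 0} + der_span_d"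

definition K_sub :: "complex ^ 'n ^ 'n \<Rightarrow> 'n::finite center set" where
  "K_sub B = module.span center_scale {center_K u r |u r. cdot (B *v u) (cvec r) = 0 \<and> r \<noteq> 0}"

record 'l lie_structure =
  lie_carrier :: "'l set"
  lie_add :: "'l \<Rightarrow> 'l \<Rightarrow> 'l"
  lie_scale :: "complex \<Rightarrow> 'l \<Rightarrow> 'l"
  lie_bracket :: "'l \<Rightarrow> 'l \<Rightarrow> 'l"

text \<open>The quotient of a Lie subalgebra \<open>S\<close> by an ideal \<open>J\<close> of \<open>S\<close>; its elements are the cosets
  \<open>x +o J\<close> for \<open>x \<in> S\<close>.\<close>

definition lie_quotient ::
    "(complex \<Rightarrow> 'a::ab_group_add \<Rightarrow> 'a) \<Rightarrow> ('a \<Rightarrow> 'a \<Rightarrow> 'a) \<Rightarrow> 'a set \<Rightarrow> 'a set \<Rightarrow> 'a set lie_structure" where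
  "lie_quotient sc bracket S J =
     \<lparr> lie_carrier = (\<lambda>x. x +o J) ` S,
       lie_add = (\<lambda>C D. \<Union>x\<in>C. \<Union>y\<in>D. (x + y) +o J),
       lie_scale = (\<lambda>c C. \<Union>x\<in>C. sc c x +o J),
       lie_bracket = (\<lambda>C D. \<Union>x\<in>C. \<Union>y\<in>D. bracket x y +o J) \<rparr>"

definition tau_class ::
    "complex ^ 'n ^ 'n \<Rightarrow> ('g::ab_group_add, 'n::finite) toroidal \<Rightarrow> ('g, 'n) toroidal set" where
  "tau_class B x = x +o ({0} \<times> K_sub B \<times> {0})"

definition tau ::
    "(complex \<Rightarrow> 'g::ab_group_add \<Rightarrow> 'g) \<Rightarrow> ('g \<Rightarrow> 'g \<Rightarrow> 'g) \<Rightarrow> ('g \<Rightarrow> 'g \<Rightarrow> complex) \<Rightarrow>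
     complex ^ 'n ^ 'n \<Rightarrow> ('g, 'n::finite) toroidal set lie_structure" where
  "tau sc bracket form B =
     lie_quotient (tor_scale sc) (tor_bracket sc bracket form)
       (UNIV \<times> UNIV \<times> H_tilde B) ({0} \<times> K_sub B \<times> {0})"

definition tau_loop ::
    "complex ^ 'n ^ 'n \<Rightarrow> ('g::ab_group_add, 'n::finite) toroidal set set" where
  "tau_loop B = tau_class B ` (UNIV \<times> {0} \<times> {0})"

definition tau_center ::
    "complex ^ 'n ^ 'n \<Rightarrow> ('g::ab_group_add, 'n::finite) toroidal set set" where
  "tau_center B = tau_class B ` ({0} \<times> UNIV \<times> {0})"

definition h_tilde ::
    "complex ^ 'n ^ 'n \<Rightarrow> 'g::ab_group_add set \<Rightarrow> ('g, 'n::finite) toroidal set set" where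
  "h_tilde B H = tau_class B ` (Poly_Mapping.single 0 ` H \<times> center_span_K \<times> der_span_d)"

definition tau_plus ::
    "(complex \<Rightarrow> 'g::ab_group_add \<Rightarrow> 'g) \<Rightarrow> ('g \<Rightarrow> 'g \<Rightarrow> 'g) \<Rightarrow> complex ^ 'n ^ 'n \<Rightarrow> 'g set \<Rightarrow>
     ('g \<Rightarrow> complex) set \<Rightarrow> ('g, 'n::finite) toroidal set set" where
  "tau_plus sc bracket B H P = tau_class B `
     module.span (tor_scale sc) {tor_X X r |\<alpha> X r. \<alpha> \<in> P \<and> X \<in> root_space sc bracket H \<alpha>}"


section \<open>Modules\<close>

definition lie_module ::
    "'l lie_structure \<Rightarrow> (complex \<Rightarrow> 'v::ab_group_add \<Rightarrow> 'v) \<Rightarrow> ('l \<Rightarrow> 'v \<Rightarrow> 'v) \<Rightarrow> bool" where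
  "lie_module L sc act \<longleftrightarrow>
     vector_space sc \<and>
     (\<forall>x\<in>lie_carrier L. Vector_Spaces.linear sc sc (act x)) \<and>
     (\<forall>x\<in>lie_carrier L. \<forall>y\<in>lie_carrier L. \<forall>v. act (lie_add L x y) v = act x v + act y v) \<and>
     (\<forall>c. \<forall>x\<in>lie_carrier L. \<forall>v. act (lie_scale L c x) v = sc c (act x v)) \<and>
     (\<forall>x\<in>lie_carrier L. \<forall>y\<in>lie_carrier L. \<forall>v.
        act (lie_bracket L x y) v = act x (act y v) - act y (act x v))"

definition irreducible_module ::
    "'l lie_structure \<Rightarrow> (complex \<Rightarrow> 'v::ab_group_add \<Rightarrow> 'v) \<Rightarrow> ('l \<Rightarrow> 'v \<Rightarrow> 'v) \<Rightarrow> bool" where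
  "irreducible_module L sc act \<longleftrightarrow>
     lie_module L sc act \<and> (\<exists>v::'v. v \<noteq> 0) \<and>
     (\<forall>W. module.subspace sc W \<and> (\<forall>x\<in>lie_carrier L. \<forall>w\<in>W. act x w \<in> W)
          \<longrightarrow> W = {0} \<or> W = UNIV)"

definition weight_space ::
    "(complex \<Rightarrow> 'v::ab_group_add \<Rightarrow> 'v) \<Rightarrow> ('l \<Rightarrow> 'v \<Rightarrow> 'v) \<Rightarrow> 'l set \<Rightarrow> ('l \<Rightarrow> complex) \<Rightarrow> 'v set" where
  "weight_space sc act T \<mu> = {v. \<forall>x\<in>T. act x v = sc (\<mu> x) v}"

definition is_direct_sum :: "'i set \<Rightarrow> ('i \<Rightarrow> 'v::ab_group_add set) \<Rightarrow> bool" where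
  "is_direct_sum I W \<longleftrightarrow>
     (\<forall>v. \<exists>!f. finite {i. f i \<noteq> 0} \<and> (\<forall>i\<in>I. f i \<in> W i) \<and> (\<forall>i. i \<notin> I \<longrightarrow> f i = 0) \<and>
               v = (\<Sum>i | f i \<noteq> 0. f i))"

definition tau_weights ::
    "(complex \<Rightarrow> 'g::ab_group_add \<Rightarrow> 'g) \<Rightarrow> ('g \<Rightarrow> 'g \<Rightarrow> 'g) \<Rightarrow> ('g \<Rightarrow> 'g \<Rightarrow> complex) \<Rightarrow>
     complex ^ 'n ^ 'n \<Rightarrow> 'g set \<Rightarrow> (('g, 'n::finite) toroidal set \<Rightarrow> complex) set" where
  "tau_weights sc bracket form B H =
     dual_space (lie_add (tau sc bracket form B)) (lie_scale (tau sc bracket form B)) (h_tilde B H)"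

definition integrable_module ::
    "(complex \<Rightarrow> 'g::ab_group_add \<Rightarrow> 'g) \<Rightarrow> ('g \<Rightarrow> 'g \<Rightarrow> 'g) \<Rightarrow> ('g \<Rightarrow> 'g \<Rightarrow> complex) \<Rightarrow>
     complex ^ 'n ^ 'n \<Rightarrow> 'g set \<Rightarrow> (complex \<Rightarrow> 'v::ab_group_add \<Rightarrow> 'v) \<Rightarrow>
     (('g, 'n::finite) toroidal set \<Rightarrow> 'v \<Rightarrow> 'v) \<Rightarrow> bool" where
  "integrable_module sc bracket form B H scaleV act \<longleftrightarrow>
     is_direct_sum (tau_weights sc bracket form B H) (weight_space scaleV act (h_tilde B H)) \<and>
     (\<forall>\<alpha>\<in>roots sc bracket H. \<forall>X\<in>root_space sc bracket H \<alpha>. \<forall>r v.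
        \<exists>k. (act (tau_class B (tor_X X r)) ^^ k) v = 0)"

definition V_plus ::
    "(complex \<Rightarrow> 'g::ab_group_add \<Rightarrow> 'g) \<Rightarrow> ('g \<Rightarrow> 'g \<Rightarrow> 'g) \<Rightarrow> complex ^ 'n ^ 'n \<Rightarrow> 'g set \<Rightarrow>
     ('g \<Rightarrow> complex) set \<Rightarrow> (('g, 'n::finite) toroidal set \<Rightarrow> 'v::ab_group_add \<Rightarrow> 'v) \<Rightarrow> 'v set" where
  "V_plus sc bracket B H P act = {v. \<forall>x\<in>tau_plus sc bracket B H P. act x v = 0}"

end

theory Submission
  imports Defs "HOL-Computational_Algebra.Fundamental_Theorem_Algebra"
begin

text \<open>
  For \<open>r \<noteq> 0\<close> the degree \<open>r\<close> part of the quotient of the center by \<open>K\<^sub>B\<close> is spanned by one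
  element, acting by an operator \<open>K r\<close>, and \<open>[D(B r, r), K s] = (B r|s) K (r + s)\<close>.

  By irreducibility \<open>V\<^sup>+\<close> has a single \<open>\<hh>\<close>-weight \<open>\<mu>\<close>, and as \<open>\<gg> \<otimes> A\<close> acts nontrivially there
  is an \<open>sl\<^sub>2\<close>-triple \<open>x, t, y\<close> of root vectors with \<open>\<mu> t = n > 0\<close>. Since the \<open>K\<^sub>i\<close> act by zero, every \<open>y(-m) ^ n\<close>
  is injective on \<open>V\<^sup>+\<close>. It lowers the degree by \<open>n m\<close>, so it embeds each weight space of
  \<open>V\<^sup>+\<close> into one of finitely many weight spaces, which bounds the dimensions.

  The vectors killed by a power of \<open>K r\<close> being a submodule, \<open>K r\<close> is injective or locally nilpotent.
  Not all are injective: for \<open>X, Y \<in> \<hh>\<close> the operators \<open>K (-r) X(r)\<close> and \<open>K (-s) Y(s)\<close> preserve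
  a finite dimensional weight space and their commutator is a multiple of
  \<open>K (-r) K (-s) K (r + s)\<close>, which is central. A locally nilpotent \<open>K s\<close> is even nilpotent on \<open>V\<^sup>+\<close>,
  because it commutes with the embeddings above. Commuting \<open>(K s) ^ n = 0\<close> with the \<open>D(B p, p)\<close> shows that
  products of \<open>n\<close> operators \<open>K c\<close> with \<open>c\<close> in a half space defined by \<open>s\<close> vanish. Finitely many
  half spaces cover \<open>\<int>\<^sup>N - {0}\<close>, so \<open>V\<^sup>+\<close> contains a nonzero vector killed by all \<open>K r\<close>; such
  vectors form a submodule.
\<close>

section \<open>Linear algebra\<close>

text \<open>\<open>V^+\<close> may meet infinitely many degrees, so finite dimensional weight spaces
  and local nilpotency give nothing uniform by themselves. The remedy is that the triples
  \<open>x(-r), t, y(r)\<close> satisfy the sl2 relations in every degree \<open>r\<close>, since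
  their central terms lie in degree 0 and act by zero. The string length \<open>n\<close> therefore
  depends on \<mu> alone, and degrees matter only modulo \<open>n\<close>. The triples are
  normalized by \<open>form x y = 1\<close> instead of \<open>\<alpha> t = 2\<close>, so
  \<open>n\<close> solves \<open>2 * \<mu> t = n * \<alpha> t\<close>; that
  \<open>\<alpha> t\<close> is nonzero is derived from the integrable module itself. Trading
  \<open>K s\<close> for \<open>K c\<close> requires \<open>\<omega> c s \<noteq> 0\<close>, and the
  shifted indices \<open>c + c' - s\<close> must remain in the family. Half spaces give both because
  \<open>\<omega> s s = 0\<close>. As \<omega> is complex valued, they are cut out by the real part
  of a rotated value, and four rotations for each coordinate vector suffice for the cover.\<close>

locale complex_vector_space = vector_space scale
  for scale :: "complex \<Rightarrow> 'b::ab_group_add \<Rightarrow> 'b"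
begin

text \<open>Isolating one component: applying \<open>T i - ev i \<nu>\<close> to the sum removes the component \<open>f \<nu>\<close>.\<close>

lemma eigen_components_mem:
  assumes "finite C" "subspace A"
    and hom: "\<And>i. i \<in> I \<Longrightarrow> module_hom scale scale (T i)"
    and stable: "\<And>i a. i \<in> I \<Longrightarrow> a \<in> A \<Longrightarrow> T i a \<in> A"
    and sep: "\<And>\<mu> \<nu>. \<mu> \<in> C \<Longrightarrow> \<nu> \<in> C \<Longrightarrow> \<mu> \<noteq> \<nu> \<Longrightarrow> \<exists>i\<in>I. ev i \<mu> \<noteq> ev i \<nu>"
    and "\<And>i \<mu>. i \<in> I \<Longrightarrow> \<mu> \<in> C \<Longrightarrow> T i (f \<mu>) = scale (ev i \<mu>) (f \<mu>)"
    and "sum f C \<in> A" and "\<mu> \<in> C"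
  shows "f \<mu> \<in> A"
  using \<open>finite C\<close> sep assms(6-8)
proof (induction "card C" arbitrary: C f rule: less_induct)
  case less
  show ?case
  proof (cases "C = {\<mu>}")
    case True
    then show ?thesis using less.prems by simp
  next
    case False
    then obtain \<nu> where \<nu>: "\<nu> \<in> C" "\<nu> \<noteq> \<mu>" using less.prems(5) by blast
    then obtain i where i: "i \<in> I" "ev i \<mu> \<noteq> ev i \<nu>"
      using less.prems(2)[of \<mu> \<nu>] less.prems(5) by blast
    interpret T: module_hom scale scale "T i" by (rule hom[OF i(1)])
    define g where "g = (\<lambda>\<phi>. scale (ev i \<phi> - ev i \<nu>) (f \<phi>))"
    have "T i (sum f C) - scale (ev i \<nu>) (sum f C) = sum g C"
      using less.prems(3)[OF i(1)]
      by (simp add: T.sum scale_sum_right g_def scale_left_diff_distrib flip: sum_subtractf cong: sum.cong)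
    moreover have "sum g C = sum g (C - {\<nu>})"
      using \<nu>(1) less.prems(1) by (simp add: sum.remove[of _ \<nu>] g_def)
    moreover have "T i (sum f C) - scale (ev i \<nu>) (sum f C) \<in> A"
      using stable[OF i(1) less.prems(4)] less.prems(4) \<open>subspace A\<close>
      by (simp add: subspace_diff subspace_scale)
    ultimately have "sum g (C - {\<nu>}) \<in> A" by simp
    moreover have "T j (g \<phi>) = scale (ev j \<phi>) (g \<phi>)" if "j \<in> I" "\<phi> \<in> C - {\<nu>}" for j \<phi>
      using that less.prems(3)[of j \<phi>] module_hom.scale[OF hom[OF that(1)]]
      by (simp add: g_def scale_left_commute)
    moreover have "card (C - {\<nu>}) < card C" using less.prems(1) \<nu>(1) by (rule card_Diff1_less)
    ultimately have "g \<mu> \<in> A"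
      using less.hyps[of "C - {\<nu>}" g] less.prems \<nu> by blast
    then have "scale (1 / (ev i \<mu> - ev i \<nu>)) (g \<mu>) \<in> A" using \<open>subspace A\<close> by (rule subspace_scale[rotated])
    then show ?thesis using i(2) by (simp add: g_def)
  qed
qed

lemma span_graded:
  assumes "v \<in> span (\<Union>\<mu>\<in>C. W \<mu>)" and "\<And>\<mu>. \<mu> \<in> C \<Longrightarrow> subspace (W \<mu>)"
  obtains D f where "finite D" "D \<subseteq> C" "\<And>\<mu>. \<mu> \<in> D \<Longrightarrow> f \<mu> \<in> W \<mu>" "v = sum f D"
proof -
  obtain t u where t: "finite t" "t \<subseteq> (\<Union>\<mu>\<in>C. W \<mu>)" "v = (\<Sum>a\<in>t. scale (u a) a)"
    using assms(1) by (auto simp: span_explicit)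
  obtain wt where wt: "\<And>a. a \<in> t \<Longrightarrow> wt a \<in> C \<and> a \<in> W (wt a)"
    using t(2) by (metis UN_E subsetD)
  define f where "f = (\<lambda>\<mu>. \<Sum>a\<in>{a \<in> t. wt a = \<mu>}. scale (u a) a)"
  have "f \<mu> \<in> W \<mu>" if "\<mu> \<in> wt ` t" for \<mu>
    unfolding f_def using that wt assms(2) by (intro subspace_sum subspace_scale) (auto dest: wt)
  moreover have "v = sum f (wt ` t)"
    unfolding t(3) f_def by (rule sum.image_gen[OF t(1)])
  moreover have "wt ` t \<subseteq> C" using wt by blast
  ultimately show thesis using t(1) by (intro that[of "wt ` t" f]) auto
qed

text \<open>An independent set inside \<open>A\<close> stays independent under a map injective on
  \<open>A\<close>, and its image lies in the span of the finite set \<open>S\<close>. Finiteness of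
  \<open>J\<close> is part of the conclusion, since \<open>card\<close> of an infinite set is
  0.\<close>

lemma card_le_of_inj_hom:
  assumes "module_hom scale scale T" "subspace A" "\<And>a. a \<in> A \<Longrightarrow> T a = 0 \<Longrightarrow> a = 0"
    and "\<And>a. a \<in> A \<Longrightarrow> T a \<in> span S" "finite S"
    and "independent J" "J \<subseteq> A"
  shows "finite J \<and> card J \<le> card S"
proof -
  interpret T: module_hom scale scale T by fact
  have sp: "span J \<subseteq> A" by (rule span_minimal) fact+
  have "inj_on T (span J)"
    using T.inj_on_iff_eq_0[of "span J"] sp assms(3) by (auto simp: subset_iff)
  moreover from this have "independent (T ` J)" by (rule T.independent_injective_image[OF assms(6)])
  moreover have "T ` J \<subseteq> span S" using assms(4,7) by auto
  ultimately show ?thesis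
    using independent_span_bound[OF assms(5), of "T ` J"]
    by (metis card_image finite_imageD inj_on_subset span_superset)
qed

section \<open>Polynomials in an operator, eigenvectors and the Heisenberg relation\<close>

definition op_poly :: "('b \<Rightarrow> 'b) \<Rightarrow> complex poly \<Rightarrow> 'b \<Rightarrow> 'b" where
  "op_poly A p v = (\<Sum>i\<le>degree p. scale (coeff p i) ((A ^^ i) v))"

lemma op_poly_alt:
  fixes p :: "complex poly"
  assumes "degree p \<le> n"
  shows "op_poly A p v = (\<Sum>i\<le>n. scale (coeff p i) ((A ^^ i) v))"
  using assms unfolding op_poly_def by (intro sum.mono_neutral_left) (auto simp: coeff_eq_0)

lemma hom_ident: "module_hom scale scale (\<lambda>v. v)"
  by (simp add: module_hom_iff module_axioms)

lemma hom_power: "module_hom scale scale A \<Longrightarrow> module_hom scale scale (A ^^ k)"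
proof (induction k)
  case 0
  then show ?case using hom_ident by (simp add: id_def)
next
  case (Suc k)
  then show ?case using module_hom_compose[of scale scale "A ^^ k" scale A] by (simp add: o_def)
qed

text \<open>The linear factor is applied to the vector, not to the result: dividing the polynomial
  by \<open>X - a\<close> is paid for by replacing \<open>v\<close> with \<open>A v - a v\<close>.
  This is the form that a descent on the degree needs.\<close>

lemma op_poly_linear_factor:
  assumes "module_hom scale scale A"
  shows "op_poly A ([:- a, 1:] * q) v = op_poly A q (A v - scale a v)"
proof -
  have d: "degree ([:- a, 1:] * q) \<le> Suc (degree q)"
    by (rule order_trans[OF degree_mult_le]) simp
  have "op_poly A ([:- a, 1:] * q) v =
      (\<Sum>i\<le>Suc (degree q). scale (coeff (pCons 0 q) i) ((A ^^ i) v)) -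
      (\<Sum>i\<le>Suc (degree q). scale (a * coeff q i) ((A ^^ i) v))"
    unfolding op_poly_alt[OF d] sum_subtractf[symmetric]
    by (intro sum.cong) (simp_all add: algebra_simps)
  also have "(\<Sum>i\<le>Suc (degree q). scale (coeff (pCons 0 q) i) ((A ^^ i) v)) =
      (\<Sum>i\<le>degree q. scale (coeff q i) ((A ^^ i) (A v)))"
    by (subst sum.atMost_Suc_shift) (simp add: funpow_swap1)
  also have "(\<Sum>i\<le>Suc (degree q). scale (a * coeff q i) ((A ^^ i) v)) =
      (\<Sum>i\<le>degree q. scale (coeff q i) ((A ^^ i) (scale a v)))"
    using module_hom.scale[OF hom_power[OF assms]] by (simp add: coeff_eq_0 mult.commute)
  finally show ?thesis
    using module_hom.diff[OF hom_power[OF assms]]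
    by (simp add: op_poly_def scale_right_diff_distrib flip: sum_subtractf)
qed

text \<open>Any \<open>card S + 1\<close> distinct iterates of \<open>v\<close> are dependent.
  Dependence is a property of a set and forgets repetitions, so a coincidence of two iterates is
  treated separately, with \<open>X^i - X^j\<close> as the polynomial.\<close>

lemma ex_op_poly_zero:
  assumes "finite S" "\<And>k. (A ^^ k) v \<in> span S"
  shows "\<exists>p. p \<noteq> 0 \<and> op_poly A p v = 0"
proof (cases "inj_on (\<lambda>k. (A ^^ k) v) {..card S}")
  case True
  let ?g = "\<lambda>k. (A ^^ k) v"
  have "dependent (?g ` {..card S})"
    using independent_span_bound[OF assms(1), of "?g ` {..card S}"] assms(2) card_image[OF True] by auto
  then obtain u w where u: "w \<in> ?g ` {..card S}" "u w \<noteq> 0" "(\<Sum>w\<in>?g ` {..card S}. scale (u w) w) = 0"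
    by (auto simp: dependent_finite)
  define p where "p = (\<Sum>i\<le>card S. monom (u (?g i)) i)"
  have c: "coeff p i = (if i \<le> card S then u (?g i) else 0)" for i
    by (simp add: p_def coeff_sum)
  have "degree p \<le> card S" by (rule degree_le) (simp add: c)
  then have "op_poly A p v = (\<Sum>i\<le>card S. scale (u (?g i)) (?g i))"
    by (simp add: op_poly_alt c)
  also have "\<dots> = 0" using u(3) by (simp add: sum.reindex[OF True])
  finally show ?thesis using u(1,2) c by (metis (no_types, lifting) atMost_iff coeff_0 imageE)
next
  case False
  then obtain i j where ij: "(A ^^ i) v = (A ^^ j) v" "i \<noteq> j" by (auto simp: inj_on_def)
  define p :: "complex poly" where "p = monom 1 i - monom 1 j"
  have c: "coeff p k = (if k = i then 1 else 0) - (if k = j then 1 else 0)" for k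
    by (auto simp: p_def)
  have "degree p \<le> max i j" by (rule degree_le) (simp add: c)
  then have "op_poly A p v = (\<Sum>k\<le>max i j. (if k = i then (A ^^ i) v else 0) - (if k = j then (A ^^ j) v else 0))"
    unfolding op_poly_alt[OF \<open>degree p \<le> max i j\<close>] by (intro sum.cong) (auto simp: c ij(2) scale_left_diff_distrib)
  also have "\<dots> = 0" by (simp add: sum_subtractf ij)
  finally show ?thesis using c[of i] ij(2) by (metis coeff_0 diff_zero zero_neq_one)
qed


text \<open>Among all pairs of a nonzero polynomial and a nonzero vector of \<open>W\<close> that it
  annihilates, one of least degree is taken. For a root \<open>a\<close> of the polynomial, the
  quotient by \<open>X - a\<close> annihilates \<open>A w - a w\<close>, which by minimality is
  zero.\<close>

lemma ex_eigenvector: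
  assumes "module_hom scale scale A"
    and W: "subspace W" "finite S" "W \<subseteq> span S" "v \<in> W" "v \<noteq> 0"
    and stable: "\<And>w. w \<in> W \<Longrightarrow> A w \<in> W"
  shows "\<exists>w a. w \<in> W \<and> w \<noteq> 0 \<and> A w = scale a w"
proof -
  define Q where "Q = (\<lambda>n. \<exists>p w. p \<noteq> 0 \<and> degree p = n \<and> w \<in> W \<and> w \<noteq> 0 \<and> op_poly A p w = 0)"
  have "(A ^^ k) v \<in> W" for k by (induction k) (simp_all add: W(4) stable)
  then have "(A ^^ k) v \<in> span S" for k using W(3) by (rule subsetD[rotated])
  then obtain p0 where "p0 \<noteq> 0" "op_poly A p0 v = 0"
    using ex_op_poly_zero[OF W(2), of A v] by auto
  then have "Q (degree p0)" unfolding Q_def using W(4,5) by (intro exI[of _ p0] exI[of _ v]) simp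
  then have QL: "Q (LEAST n. Q n)" by (rule LeastI)
  then obtain p w where p: "p \<noteq> 0" "degree p = (LEAST n. Q n)" "w \<in> W" "w \<noteq> 0" "op_poly A p w = 0"
    unfolding Q_def by blast
  have "degree p \<noteq> 0"
  proof
    assume "degree p = 0"
    then obtain c where "p = [:c:]" by (auto elim: degree_eq_zeroE)
    then show False using p by (simp add: op_poly_def)
  qed
  then obtain a where "poly p a = 0"
    using fundamental_theorem_of_algebra[of p] by (auto simp: constant_degree)
  then obtain q where q: "p = [:- a, 1:] * q" by (auto simp: poly_eq_0_iff_dvd elim: dvdE)
  then have "q \<noteq> 0" using p(1) by auto
  then have "degree p = Suc (degree q)" unfolding q by (subst degree_mult_eq) auto
  then have nQ: "\<not> Q (degree q)" using not_less_Least[of "degree q" Q] p(2) by simp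
  have "op_poly A q (A w - scale a w) = 0" using p(5) q op_poly_linear_factor[OF assms(1)] by simp
  moreover have "A w - scale a w \<in> W" using W(1) stable p(3) by (simp add: subspace_diff subspace_scale)
  ultimately have "A w - scale a w = 0" using nQ \<open>q \<noteq> 0\<close> unfolding Q_def by blast
  then show ?thesis using p(3,4) by auto
qed

text \<open>The Heisenberg relation \<open>A B - B A = Z\<close> with \<open>Z\<close> central and injective has no finite dimensional
  model: on an eigenvector of \<open>A\<close> the powers of \<open>B\<close> are independent, since \<open>A - a\<close> acts like a
  derivative.\<close>

lemma heisenberg_not_injective:
  assumes "module_hom scale scale A" "module_hom scale scale B"
      "module_hom scale scale Z"
    and W: "subspace W" "finite S" "W \<subseteq> span S" "v \<in> W" "v \<noteq> 0"
    and st: "\<And>w. w \<in> W \<Longrightarrow> A w \<in> W" "\<And>w. w \<in> W \<Longrightarrow> B w \<in> W" "\<And>w. w \<in> W \<Longrightarrow> Z w \<in> W"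
    and comm: "\<And>w. A (B w) = B (A w) + Z w" "\<And>w. B (Z w) = Z (B w)" "\<And>w. A (Z w) = Z (A w)"
  shows "\<exists>w\<in>W. w \<noteq> 0 \<and> Z w = 0"
proof (rule ccontr)
  assume "\<not> ?thesis"
  then have inj: "w \<in> W \<Longrightarrow> Z w = 0 \<Longrightarrow> w = 0" for w by blast
  interpret A: module_hom scale scale A by fact
  interpret B: module_hom scale scale B by fact
  interpret mp: module_pair scale scale by unfold_locales
  interpret Z: module_hom scale scale Z by fact
  obtain w a where w: "w \<in> W" "w \<noteq> 0" "A w = scale a w"
    using ex_eigenvector[OF assms(1) W st(1)] by blast
  define A' where "A' = (\<lambda>v. A v - scale a v)"
  have A'_hom: "module_hom scale scale A'"
    unfolding A'_def by (intro mp.module_hom_sub mp.module_hom_scale hom_ident assms)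
  have A'Z: "(A' ^^ j) (Z x) = Z ((A' ^^ j) x)" for j x
  proof (induction j)
    case (Suc j)
    then show ?case by (simp add: A'_def comm(3) Z.diff Z.scale)
  qed simp
  have BW: "(B ^^ k) w \<in> W" for k by (induction k) (simp_all add: w(1) st)
  have ZB: "Z ((B ^^ k) x) = (B ^^ k) (Z x)" for k x
    by (induction k) (simp_all flip: comm(2))
  have A'B: "A' ((B ^^ k) w) = scale (of_nat k) ((B ^^ (k - 1)) (Z w))" for k
  proof (induction k)
    case 0
    then show ?case using w(3) by (simp add: A'_def)
  next
    case (Suc k)
    have "A' ((B ^^ Suc k) w) = B (A' ((B ^^ k) w)) + Z ((B ^^ k) w)"
      by (simp add: A'_def comm(1) B.diff B.scale)
    also have "\<dots> = scale (of_nat k) (B ((B ^^ (k - 1)) (Z w))) + (B ^^ k) (Z w)"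
      by (simp add: Suc B.scale ZB)
    also have "\<dots> = scale (of_nat k) ((B ^^ k) (Z w)) + (B ^^ k) (Z w)"
      by (cases k) simp_all
    also have "\<dots> = scale (of_nat (Suc k)) ((B ^^ k) (Z w))"
      by (simp add: scale_left_distrib)
    finally show ?case by simp
  qed
  \<comment> \<open>The \<open>j\<close>-th derivative of the \<open>k\<close>-th power: the
    coefficient is the falling factorial \<open>k (k-1) ... (k-j+1)\<close>, written as a quotient
    of factorials.\<close>
  have A'BZ: "(A' ^^ j) ((B ^^ k) w) =
      (if j \<le> k then scale (of_nat (fact k div fact (k - j))) ((Z ^^ j) ((B ^^ (k - j)) w)) else 0)" for j k
  proof (induction j arbitrary: k)
    case (Suc j)
    have "(A' ^^ Suc j) ((B ^^ k) w) = (A' ^^ j) (scale (of_nat k) (Z ((B ^^ (k - 1)) w)))"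
      by (simp add: A'B ZB funpow_swap1)
    also have "\<dots> = scale (of_nat k) (Z ((A' ^^ j) ((B ^^ (k - 1)) w)))"
      using module_hom.scale[OF hom_power[OF A'_hom]] by (simp add: A'Z)
    also have "\<dots> = (if Suc j \<le> k then scale (of_nat (fact k div fact (k - Suc j)))
        ((Z ^^ Suc j) ((B ^^ (k - Suc j)) w)) else 0)"
    proof (cases k)
      case (Suc m)
      have "fact (m - j) dvd (fact m :: nat)" by (simp add: fact_dvd)
      then have "Suc m * (fact m div fact (m - j)) = (fact (Suc m) div fact (m - j) :: nat)"
        by (simp add: div_mult_swap)
      then have "of_nat (Suc m) * of_nat (fact m div fact (m - j)) =
          (of_nat (fact (Suc m) div fact (m - j)) :: complex)"
        by (metis of_nat_mult)
      then show ?thesis using Suc.IH[of m] Suc by (simp add: Z.scale del: of_nat_Suc fact_Suc)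
    qed simp
    finally show ?case .
  qed simp
  obtain p where p: "p \<noteq> 0" "op_poly B p w = 0"
    using ex_op_poly_zero[OF W(2), of B w] subsetD[OF W(3) BW] by auto
  let ?n = "degree p"
  \<comment> \<open>Differentiating the relation \<open>p(B) w = 0\<close> as often as the degree of
    \<open>p\<close> removes all terms but the leading one, which becomes a nonzero multiple of a
    power of \<open>Z\<close> applied to \<open>w\<close>.\<close>
  have "0 = (A' ^^ ?n) (op_poly B p w)"
    using p(2) module_hom.zero[OF hom_power[OF A'_hom]] by simp
  also have "\<dots> = (\<Sum>i\<le>?n. scale (coeff p i) ((A' ^^ ?n) ((B ^^ i) w)))"
    unfolding op_poly_def
    by (simp add: module_hom.sum[OF hom_power[OF A'_hom]] module_hom.scale[OF hom_power[OF A'_hom]])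
  also have "\<dots> = (\<Sum>i\<in>{?n}. scale (coeff p i) ((A' ^^ ?n) ((B ^^ i) w)))"
    by (rule sum.mono_neutral_right) (auto simp: A'BZ)
  also have "\<dots> = scale (lead_coeff p * fact ?n) ((Z ^^ ?n) w)"
    by (simp add: A'BZ)
  finally have "(Z ^^ ?n) w = 0" using p(1) by simp
  moreover have "(Z ^^ k) w \<in> W \<and> (Z ^^ k) w \<noteq> 0" for k
    by (induction k) (use w inj st in auto)
  ultimately show False by blast
qed
end

section \<open>The root space decomposition\<close>

locale simple_lie_algebra_cartan = lie_algebra sc bracket + complex_vector_space sc
  for sc :: "complex \<Rightarrow> 'g::ab_group_add \<Rightarrow> 'g" and bracket :: "'g \<Rightarrow> 'g \<Rightarrow> 'g" +
  fixes form :: "'g \<Rightarrow> 'g \<Rightarrow> complex" and H :: "'g set"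
  assumes simple: "simple_lie_algebra sc bracket"
    and form: "nondegenerate_invariant_symmetric_form sc bracket form"
    and cartan: "cartan_subalgebra sc bracket H"
begin

abbreviation dual_H :: "('g \<Rightarrow> complex) set" where
  "dual_H \<equiv> dual_space (+) sc H"

abbreviation rspace :: "('g \<Rightarrow> complex) \<Rightarrow> 'g set" where
  "rspace \<equiv> root_space sc bracket H"

lemma bracket_zero [simp]: "bracket 0 x = 0" "bracket x 0 = 0"
  using bracket_scale_left[of 0 0 x] bracket_scale_right[of x 0 0] by simp_all

lemma bracket_anticommute: "bracket x y = - bracket y x"
proof -
  have "bracket (x + y) (x + y) = bracket x y + bracket y x"
    unfolding bracket_add_left bracket_add_right by (simp add: bracket_self)
  then show ?thesis by (simp add: bracket_self eq_neg_iff_add_eq_0)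
qed

lemma bracket_minus: "bracket x (- y) = - bracket x y" "bracket (- x) y = - bracket x y"
  using bracket_scale_right[of x "- 1" y] bracket_scale_left[of "- 1" x y] by simp_all

lemma bracket_hom: "module_hom sc sc (bracket x)"
  by (simp add: module_hom_iff module_axioms bracket_add_right bracket_scale_right)

lemma bracket_leibniz: "bracket x (bracket y z) = bracket (bracket x y) z + bracket y (bracket x z)"
proof -
  have "bracket y (bracket z x) = - bracket y (bracket x z)"
    by (subst bracket_anticommute[of z x]) (simp add: bracket_minus)
  moreover have "bracket z (bracket x y) = - bracket (bracket x y) z" by (rule bracket_anticommute)
  ultimately have "bracket x (bracket y z) - bracket y (bracket x z) - bracket (bracket x y) z = 0"
    using jacobi[of x y z] by simp
  then show ?thesis by (simp add: algebra_simps)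
qed

lemma form_commute: "form x y = form y x"
proof -
  have "\<forall>x y. form x y = form y x"
    using form unfolding nondegenerate_invariant_symmetric_form_def by (elim conjE)
  then show ?thesis by blast
qed

lemma form_nondegenerate:
  assumes "x \<noteq> 0"
  shows "\<exists>y. form x y \<noteq> 0"
proof -
  have "\<forall>x. (\<forall>y. form x y = 0) \<longrightarrow> x = 0"
    using form unfolding nondegenerate_invariant_symmetric_form_def by (elim conjE)
  then show ?thesis using assms by blast
qed

lemma form_simps:
  "form (x + y) z = form x z + form y z" "form x (y + z) = form x y + form x z"
  "form (sc c x) y = c * form x y" "form x (sc c y) = c * form x y"
  "form (bracket x y) z = form x (bracket y z)"
proof -
  have f: "\<forall>x y z. form (x + y) z = form x z + form y z"
    using form unfolding nondegenerate_invariant_symmetric_form_def by (elim conjE)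
  have g: "\<forall>c x y. form (sc c x) y = c * form x y"
    using form unfolding nondegenerate_invariant_symmetric_form_def by (elim conjE)
  have h: "\<forall>x y z. form (bracket x y) z = form x (bracket y z)"
    using form unfolding nondegenerate_invariant_symmetric_form_def by (elim conjE)
  show "form (x + y) z = form x z + form y z" "form (sc c x) y = c * form x y"
    "form (bracket x y) z = form x (bracket y z)"
    by (simp_all only: f g h)
  show "form x (y + z) = form x y + form x z" "form x (sc c y) = c * form x y"
    by (simp_all only: form_commute[of x] f g)
qed

lemma form_zero [simp]: "form 0 x = 0" "form x 0 = 0"
  using form_simps(3)[of 0 0 x] form_simps(4)[of x 0 0] by simp_all

lemma form_sum_right: "form x (sum f A) = (\<Sum>a\<in>A. form x (f a))"
  by (induction A rule: infinite_finite_induct) (simp_all add: form_simps)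

lemma H_subspace: "subspace H"
  and H_commute: "h \<in> H \<Longrightarrow> h' \<in> H \<Longrightarrow> bracket h h' = 0"
  and H_self_centralizing: "(\<And>h. h \<in> H \<Longrightarrow> bracket h x = 0) \<Longrightarrow> x \<in> H"
  and H_diagonalizable: "h \<in> H \<Longrightarrow> span {x. \<exists>c. bracket h x = sc c x} = UNIV"
  using cartan unfolding cartan_subalgebra_def by blast+

lemma ideal_trivial: "lie_ideal sc bracket I \<Longrightarrow> x \<in> I \<Longrightarrow> x \<noteq> 0 \<Longrightarrow> I = UNIV"
  using simple unfolding simple_lie_algebra_def by blast

lemma not_abelian: "\<exists>x y. bracket x y \<noteq> 0"
  using simple unfolding simple_lie_algebra_def by blast

lemma subspace_rspace: "subspace (rspace \<alpha>)"
  by (rule subspaceI) (simp_all add: root_space_def bracket_add_right bracket_scale_right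
      scale_right_distrib scale_left_commute)

lemma rspace_bracket_H: "h \<in> H \<Longrightarrow> x \<in> rspace \<alpha> \<Longrightarrow> bracket h x = sc (\<alpha> h) x"
  by (simp add: root_space_def)

lemma rspace_zero: "rspace (\<lambda>_. 0) = H"
  using H_commute H_self_centralizing by (auto simp: root_space_def)

section \<open>Simultaneous diagonalization of the Cartan subalgebra\<close>

lemma H_finite_span: obtains S where "finite S" "S \<subseteq> H" "H \<subseteq> span S"
proof -
  obtain T where T: "finite T" "UNIV \<subseteq> span T"
    using simple unfolding simple_lie_algebra_def fin_dim_def by blast
  obtain S where S: "S \<subseteq> H" "independent S" "H \<subseteq> span S"
    by (rule maximal_independent_subset[of H])
  have "finite S" using independent_span_bound[OF T(1) S(2)] T(2) by blast
  then show thesis using that S by blast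
qed

text \<open>An eigenvector common to \<open>S\<close> splits into eigenvectors of \<open>h\<close>.
  The joint eigenspace of \<open>S\<close> containing it is stable under \<open>h\<close>, because
  \<open>H\<close> is commutative, so it contains the components as well.\<close>

lemma joint_eigenvectors_span:
  assumes "finite S" "S \<subseteq> H"
  shows "x \<in> span {y. \<forall>h\<in>S. \<exists>c. bracket h y = sc c y}"
  using assms
proof (induction S arbitrary: x)
  case empty
  then show ?case by simp
next
  case (insert h S)
  let ?E = "{y. \<forall>h\<in>insert h S. \<exists>c. bracket h y = sc c y}"
  have "y \<in> span ?E" if y: "\<forall>h\<in>S. \<exists>c. bracket h y = sc c y" for y
  proof -
    obtain \<mu> where \<mu>: "\<And>h. h \<in> S \<Longrightarrow> bracket h y = sc (\<mu> h) y" using y by metis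
    have "{x. \<exists>c. bracket h x = sc c x} = (\<Union>c\<in>UNIV. {x. bracket h x = sc c x})" by blast
    then have "y \<in> span (\<Union>c\<in>UNIV. {x. bracket h x = sc c x})"
      using H_diagonalizable[of h] insert.prems by simp
    moreover have "subspace {x. bracket h x = sc c x}" for c
      by (rule subspaceI) (simp_all add: bracket_add_right bracket_scale_right
        scale_right_distrib scale_left_commute)
    ultimately obtain D f where D: "finite D" "\<And>c. c \<in> D \<Longrightarrow> bracket h (f c) = sc c (f c)" "y = sum f D"
      by (elim span_graded) auto
    let ?A = "{z. \<forall>k\<in>S. bracket k z = sc (\<mu> k) z}"
    have "f c \<in> ?A" if "c \<in> D" for c
    proof (rule eigen_components_mem[where I = "{h}" and T = "\<lambda>h. bracket h" and ev = "\<lambda>_ c. c"])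
      show "subspace ?A"
        by (rule subspaceI) (simp_all add: bracket_add_right bracket_scale_right
          scale_right_distrib scale_left_commute)
      fix i a assume "i \<in> {h}" "a \<in> ?A"
      then show "bracket i a \<in> ?A"
        using insert.prems H_commute[of _ h] bracket_leibniz[of _ h a]
        by (auto simp: bracket_scale_right subset_iff)
    qed (use D \<mu> that bracket_hom in auto)
    then show ?thesis unfolding D(3) using D(2)
      by (intro span_sum span_base) auto
  qed
  then have "span {y. \<forall>h\<in>S. \<exists>c. bracket h y = sc c y} \<subseteq> span ?E"
    by (intro span_minimal) auto
  then show ?case using insert.IH insert.prems by blast
qed

text \<open>The elements having \<open>y\<close> as an eigenvector form a subspace, so a finite
  spanning set of \<open>H\<close> suffices. For \<open>y \<noteq> 0\<close> the eigenvalue is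
  unique and hence linear in \<open>h\<close>; extension by zero makes it a member of
  \<open>dual_H\<close>.\<close>

lemma root_space_decomposition: "x \<in> span (\<Union>\<alpha>\<in>dual_H. rspace \<alpha>)"
proof -
  obtain S where S: "finite S" "S \<subseteq> H" "H \<subseteq> span S" by (rule H_finite_span)
  have "y \<in> span (\<Union>\<alpha>\<in>dual_H. rspace \<alpha>)" if y: "\<forall>h\<in>S. \<exists>c. bracket h y = sc c y" for y
  proof (cases "y = 0")
    case True
    then show ?thesis by (simp add: span_zero)
  next
    case False
    have "\<exists>c. bracket h y = sc c y" if "h \<in> span S" for h
      using that
    proof (induction rule: span_induct_alt)
      case base
      show ?case by (intro exI[of _ 0]) simp
    next
      case (step c x z)
      then obtain a b where "bracket x y = sc a y" "bracket z y = sc b y" using y by blast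
      then have "bracket (sc c x + z) y = sc (c * a + b) y"
        by (simp add: bracket_add_left bracket_scale_left scale_left_distrib)
      then show ?case by blast
    qed
    then obtain c where c: "\<And>h. h \<in> H \<Longrightarrow> bracket h y = sc (c h) y" using S(3) by (metis subsetD)
    define \<alpha> where "\<alpha> = (\<lambda>h. if h \<in> H then c h else 0)"
    have "c (h + k) = c h + c k" if "h \<in> H" "k \<in> H" for h k
    proof -
      have "sc (c (h + k)) y = sc (c h + c k) y"
        using that c H_subspace by (metis bracket_add_left scale_left_distrib subspace_add)
      then show ?thesis using False by simp
    qed
    moreover have "c (sc a h) = a * c h" if "h \<in> H" for a h
    proof -
      have "sc (c (sc a h)) y = sc (a * c h) y"
        using that c H_subspace by (metis bracket_scale_left scale_scale subspace_scale)
      then show ?thesis using False by simp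
    qed
    ultimately have "\<alpha> \<in> dual_H"
      using H_subspace by (simp add: dual_space_def \<alpha>_def subspace_add subspace_scale)
    moreover have "y \<in> rspace \<alpha>" using c by (simp add: root_space_def \<alpha>_def)
    ultimately show ?thesis by (intro span_base) blast
  qed
  then have "span {y. \<forall>h\<in>S. \<exists>c. bracket h y = sc c y} \<subseteq> span (\<Union>\<alpha>\<in>dual_H. rspace \<alpha>)"
    by (intro span_minimal) auto
  then show ?thesis using joint_eigenvectors_span[OF S(1,2)] by blast
qed

section \<open>Duality of opposite root spaces under the form\<close>

lemma dual_H_eqI: "\<alpha> \<in> dual_H \<Longrightarrow> \<beta> \<in> dual_H \<Longrightarrow> (\<And>h. h \<in> H \<Longrightarrow> \<alpha> h = \<beta> h) \<Longrightarrow> \<alpha> = \<beta>"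
  by (rule ext) (metis (mono_tags, lifting) dual_space_def mem_Collect_eq)

lemma zero_dual_H: "(\<lambda>_. 0) \<in> dual_H"
  by (simp add: dual_space_def)

lemma dual_H_uminus: "\<alpha> \<in> dual_H \<Longrightarrow> (\<lambda>h. - \<alpha> h) \<in> dual_H"
  by (auto simp: dual_space_def)

lemma form_rspace:
  assumes "x \<in> rspace \<alpha>" "y \<in> rspace \<beta>" "form x y \<noteq> 0" "h \<in> H"
  shows "\<beta> h = - \<alpha> h"
proof -
  have "- \<alpha> h * form x y = form (bracket x h) y"
    using rspace_bracket_H[OF assms(4,1)] bracket_anticommute[of x h]
    by (simp add: form_simps flip: scale_minus_left)
  also have "\<dots> = \<beta> h * form x y"
    using rspace_bracket_H[OF assms(4,2)] by (simp add: form_simps)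
  finally show ?thesis using assms(3) by (metis mult_right_cancel)
qed

text \<open>Nondegeneracy provides some vector pairing with \<open>x\<close>, and only its component
  of weight \<open>-\<alpha>\<close> can contribute. The case \<open>\<alpha> = 0\<close> is
  included and says that the form is nondegenerate on \<open>H\<close>.\<close>

lemma form_pairing:
  assumes "\<alpha> \<in> dual_H" "x \<in> rspace \<alpha>" "x \<noteq> 0"
  obtains y where "y \<in> rspace (\<lambda>h. - \<alpha> h)" "form x y = 1"
proof -
  obtain z where z: "form x z \<noteq> 0" using form_nondegenerate[OF assms(3)] by blast
  obtain D f where D: "finite D" "D \<subseteq> dual_H" "\<And>\<beta>. \<beta> \<in> D \<Longrightarrow> f \<beta> \<in> rspace \<beta>" "z = sum f D"
    using span_graded[OF root_space_decomposition[of z] subspace_rspace] by metis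
  obtain \<beta> where \<beta>: "\<beta> \<in> D" "form x (f \<beta>) \<noteq> 0"
    using z sum.neutral unfolding D(4) form_sum_right by meson
  have "\<beta> = (\<lambda>h. - \<alpha> h)"
    using form_rspace[OF assms(2) D(3)[OF \<beta>(1)] \<beta>(2)] \<beta>(1) D(2) dual_H_uminus[OF assms(1)]
    by (intro dual_H_eqI) auto
  then have "sc (1 / form x (f \<beta>)) (f \<beta>) \<in> rspace (\<lambda>h. - \<alpha> h)"
    using D(3)[OF \<beta>(1)] subspace_rspace by (simp add: subspace_scale)
  then show thesis using \<beta>(2) by (intro that) (auto simp: form_simps)
qed

lemma bracket_rspace:
  assumes "x \<in> rspace \<alpha>" "y \<in> rspace \<beta>"
  shows "bracket x y \<in> rspace (\<lambda>h. \<alpha> h + \<beta> h)"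
  using assms bracket_leibniz[of _ x y]
  by (auto simp: root_space_def bracket_scale_left bracket_scale_right scale_left_distrib)

lemma bracket_opposite:
  assumes "x \<in> rspace \<alpha>" "y \<in> rspace (\<lambda>h. - \<alpha> h)"
  shows "bracket x y \<in> H"
  using bracket_rspace[OF assms] by (simp add: rspace_zero)

text \<open>\<open>[x, y]\<close> is the vector of \<open>H\<close> that represents
  \<open>\<alpha>\<close> through the form; in particular it is nonzero for a root.\<close>

lemma form_bracket_opposite:
  assumes "x \<in> rspace \<alpha>" "y \<in> rspace (\<lambda>h. - \<alpha> h)" "form x y = 1" "h \<in> H"
  shows "form (bracket x y) h = \<alpha> h"
proof -
  have "bracket y h = sc (\<alpha> h) y"
    using bracket_anticommute[of y h] rspace_bracket_H[OF assms(4,2)] by simp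
  then show ?thesis using assms(3) by (simp add: form_simps)
qed

lemma roots_altdef: "\<alpha> \<in> roots sc bracket H \<longleftrightarrow> \<alpha> \<in> dual_H \<and> \<alpha> \<noteq> (\<lambda>_. 0) \<and> (\<exists>x\<in>rspace \<alpha>. x \<noteq> 0)"
  using subspace_0[OF subspace_rspace, of \<alpha>] by (auto simp: roots_def)

lemma roots_uminus: "\<alpha> \<in> roots sc bracket H \<Longrightarrow> (\<lambda>h. - \<alpha> h) \<in> roots sc bracket H"
proof -
  assume \<alpha>: "\<alpha> \<in> roots sc bracket H"
  then obtain x where x: "\<alpha> \<in> dual_H" "x \<in> rspace \<alpha>" "x \<noteq> 0" by (auto simp: roots_altdef)
  obtain y where y: "y \<in> rspace (\<lambda>h. - \<alpha> h)" "form x y = 1" using form_pairing[OF x] .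
  then have "y \<noteq> 0" by auto
  moreover have "(\<lambda>h. - \<alpha> h) \<noteq> (\<lambda>_. 0)" using \<alpha> by (auto simp: roots_altdef fun_eq_iff)
  ultimately show "(\<lambda>h. - \<alpha> h) \<in> roots sc bracket H"
    using y(1) dual_H_uminus[OF x(1)] unfolding roots_altdef by blast
qed

lemma root_nonzero: "\<alpha> \<in> roots sc bracket H \<Longrightarrow> \<exists>h\<in>H. \<alpha> h \<noteq> 0"
  using dual_H_eqI[of \<alpha> "\<lambda>_. 0"] zero_dual_H unfolding roots_altdef by blast

lemma root_vectors_span: "x \<in> span (H \<union> (\<Union>\<alpha>\<in>roots sc bracket H. rspace \<alpha>))"
proof -
  have "rspace \<alpha> \<subseteq> span (H \<union> (\<Union>\<alpha>\<in>roots sc bracket H. rspace \<alpha>))" if "\<alpha> \<in> dual_H" for \<alpha>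
  proof
    fix y assume y: "y \<in> rspace \<alpha>"
    show "y \<in> span (H \<union> (\<Union>\<alpha>\<in>roots sc bracket H. rspace \<alpha>))"
    proof (cases "y = 0 \<or> \<alpha> = (\<lambda>_. 0)")
      case True
      then show ?thesis using y rspace_zero by (auto intro: span_zero span_base)
    next
      case False
      then have "\<alpha> \<in> roots sc bracket H" using that y by (auto simp: roots_altdef)
      then show ?thesis using y by (intro span_base) blast
    qed
  qed
  then have "span (\<Union>\<alpha>\<in>dual_H. rspace \<alpha>) \<subseteq> span (H \<union> (\<Union>\<alpha>\<in>roots sc bracket H. rspace \<alpha>))"
    by (intro span_minimal) auto
  then show ?thesis using root_space_decomposition by blast
qed

lemma ex_root: "\<exists>\<alpha>. \<alpha> \<in> roots sc bracket H"
proof (rule ccontr)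
  assume "\<not> ?thesis"
  then have "roots sc bracket H = {}" by blast
  then have "x \<in> H" for x using root_vectors_span[of x] H_subspace by (simp flip: span_eq_iff)
  then show False using not_abelian H_commute by blast
qed

text \<open>Supplies the two elements of \<open>H\<close> whose loops produce a nonzero multiple of
  a central operator as commutator.\<close>

lemma form_H_nonzero: obtains x y where "x \<in> H" "y \<in> H" "form x y \<noteq> 0"
proof -
  have "H \<noteq> {0}"
  proof
    assume "H = {0}"
    then have "x \<in> H" for x using H_self_centralizing[of x] by simp
    then show False using not_abelian H_commute by blast
  qed
  then obtain h where h: "h \<in> H" "h \<noteq> 0" using subspace_0[OF H_subspace] by blast
  obtain y where "y \<in> rspace (\<lambda>h. - 0)" "form h y = 1"
    using form_pairing[OF zero_dual_H, of h] h rspace_zero by metis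
  then show thesis using that[of h y] h(1) rspace_zero by simp
qed

end

section \<open>Integrable modules in terms of operators\<close>

lemma nat_combination_add:
  assumes "nat_combination S \<gamma>" "nat_combination S \<delta>"
  shows "nat_combination S (\<lambda>x. \<gamma> x + \<delta> x)"
proof -
  obtain k l where "\<gamma> = (\<lambda>x. \<Sum>\<beta>\<in>S. of_nat (k \<beta>) * \<beta> x)" "\<delta> = (\<lambda>x. \<Sum>\<beta>\<in>S. of_nat (l \<beta>) * \<beta> x)"
    using assms unfolding nat_combination_def by blast
  then show ?thesis unfolding nat_combination_def
    by (intro exI[of _ "\<lambda>\<beta>. k \<beta> + l \<beta>"]) (simp add: sum.distrib algebra_simps)
qed

lemma nat_combination_zero: "nat_combination S (\<lambda>_. 0)"
  unfolding nat_combination_def by (intro exI[of _ "\<lambda>_. 0"]) simp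

text \<open>Antisymmetry of the order on weights given by the base: independence kills the sums of
  coefficients, and natural numbers with sum zero vanish.\<close>

lemma nat_combination_sum_eq_zero:
  assumes "finite S" "\<And>c :: ('g \<Rightarrow> complex) \<Rightarrow> complex. \<forall>x. (\<Sum>\<beta>\<in>S. c \<beta> * \<beta> x) = 0 \<Longrightarrow> \<forall>\<beta>\<in>S. c \<beta> = 0"
    and "nat_combination S \<gamma>" "nat_combination S \<delta>" "\<And>x. \<gamma> x + \<delta> x = 0"
  shows "\<gamma> = (\<lambda>_. 0)"
proof -
  obtain k l where kl: "\<gamma> = (\<lambda>x. \<Sum>\<beta>\<in>S. of_nat (k \<beta>) * \<beta> x)" "\<delta> = (\<lambda>x. \<Sum>\<beta>\<in>S. of_nat (l \<beta>) * \<beta> x)"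
    using assms unfolding nat_combination_def by blast
  have "\<forall>x. (\<Sum>\<beta>\<in>S. of_nat (k \<beta> + l \<beta>) * \<beta> x) = 0"
    using assms(5) by (simp add: kl sum.distrib algebra_simps)
  then have "\<forall>\<beta>\<in>S. (of_nat (k \<beta> + l \<beta>) :: complex) = 0" by (rule assms(2))
  then have "\<forall>\<beta>\<in>S. k \<beta> = 0" unfolding of_nat_eq_0_iff by simp
  then show ?thesis unfolding kl by simp
qed

lemma cvec_zero [simp]: "cvec 0 = 0"
  and cvec_uminus: "cvec (- r) = - cvec r"
  by (simp_all add: cvec_def vec_eq_iff)

lemma cdot_axis: "cdot (axis i 1) u = u $ i" "cdot u (axis i 1) = u $ i"
  by (simp_all add: cdot_def axis_def if_distrib[of "\<lambda>c. c * _"] if_distrib[of "\<lambda>c. _ * c"] cong: if_cong)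

lemma (in complex_vector_space) hom_span_mem:
  assumes "module_hom scale scale f" "\<And>a. a \<in> A \<Longrightarrow> f a \<in> span B" "x \<in> span A"
  shows "f x \<in> span B"
  using assms(3)
  by (induction rule: span_induct_alt)
    (simp_all add: module_hom.add[OF assms(1)] module_hom.scale[OF assms(1)]
      module_hom.zero[OF assms(1)] span_zero span_add span_scale assms(2))

text \<open>The operators \<open>E X r\<close>, \<open>D r\<close>, \<open>d u\<close> are the actions of \<open>X(r)\<close>, \<open>D(B r, r)\<close>, \<open>D(u, 0)\<close>. The
  quotient of the degree \<open>r \<noteq> 0\<close> part of the center by \<open>K\<^sub>B\<close> is one dimensional and \<open>K r\<close> is the
  action of its basis vector, normalized such that \<open>K(u, r)\<close> acts as \<open>(u|B r) K r\<close>; moreover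
  \<open>\<omega> r s = (B r|s)\<close>. As the \<open>K\<^sub>i\<close> act by zero, \<open>K 0 = 0\<close>. The brackets of the \<open>D r\<close> with each other
  are never needed.\<close>

locale loop_module =
  simple_lie_algebra_cartan sc bracket form H + V: complex_vector_space scaleV
  for sc :: "complex \<Rightarrow> 'g::ab_group_add \<Rightarrow> 'g" and bracket form H
    and scaleV :: "complex \<Rightarrow> 'v::ab_group_add \<Rightarrow> 'v" +
  fixes S :: "('g \<Rightarrow> complex) set"
    and E :: "'g \<Rightarrow> int ^ 'n::finite \<Rightarrow> 'v \<Rightarrow> 'v"
    and K :: "int ^ 'n \<Rightarrow> 'v \<Rightarrow> 'v"
    and D :: "int ^ 'n \<Rightarrow> 'v \<Rightarrow> 'v"
    and d :: "complex ^ 'n \<Rightarrow> 'v \<Rightarrow> 'v"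
    and \<omega> :: "int ^ 'n \<Rightarrow> int ^ 'n \<Rightarrow> complex"
  assumes root_base: "root_base sc bracket H S"
    and E_hom: "module_hom scaleV scaleV (E X r)"
    and K_hom: "module_hom scaleV scaleV (K r)"
    and D_hom: "module_hom scaleV scaleV (D r)"
    and d_hom: "module_hom scaleV scaleV (d u)"
    and E_add_left: "E (X + Y) r v = E X r v + E Y r v"
    and E_scale_left: "E (sc c X) r v = scaleV c (E X r v)"
    and K_0: "K 0 v = 0"
    and E_E: "E X r (E Y s v) = E Y s (E X r v) + E (bracket X Y) (r + s) v
        - scaleV (\<omega> r s * form X Y) (K (r + s) v)"
    and E_K: "E X r (K s v) = K s (E X r v)"
    and K_K: "K r (K s v) = K s (K r v)"
    and D_E: "D r (E X s v) = E X s (D r v) + scaleV (\<omega> r s) (E X (r + s) v)"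
    and D_K: "D r (K s v) = K s (D r v) + scaleV (\<omega> r s) (K (r + s) v)"
    and d_E: "d u (E X s v) = E X s (d u v) + scaleV (cdot u (cvec s)) (E X s v)"
    and d_K: "d u (K s v) = K s (d u v) + scaleV (cdot u (cvec s)) (K s v)"
    and d_D: "d u (D s v) = D s (d u v) + scaleV (cdot u (cvec s)) (D s v)"
    and \<omega>_add: "\<omega> (r + r') s = \<omega> r s + \<omega> r' s" "\<omega> r (s + s') = \<omega> r s + \<omega> r s'"
    and \<omega>_self: "\<omega> r r = 0"
    and \<omega>_nondegenerate: "r \<noteq> 0 \<Longrightarrow> \<exists>i. \<omega> r (axis i 1) \<noteq> 0"
    and irreducible: "V.subspace W \<Longrightarrow> (\<And>X r v. v \<in> W \<Longrightarrow> E X r v \<in> W) \<Longrightarrow>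
        (\<And>r v. v \<in> W \<Longrightarrow> K r v \<in> W) \<Longrightarrow> (\<And>r v. v \<in> W \<Longrightarrow> D r v \<in> W) \<Longrightarrow>
        (\<And>u v. v \<in> W \<Longrightarrow> d u v \<in> W) \<Longrightarrow> W = {0} \<or> W = UNIV"
    and weight_vectors_span: "v \<in> V.span
        {w. \<exists>\<mu> \<delta>. (\<forall>h\<in>H. E h 0 w = scaleV (\<mu> h) w) \<and> (\<forall>u. d u w = scaleV (cdot u \<delta>) w)}"
    and finite_weight_spaces: "\<exists>T. finite T \<and>
        {w. (\<forall>h\<in>H. E h 0 w = scaleV (\<mu> h) w) \<and> (\<forall>u. d u w = scaleV (cdot u \<delta>) w)} \<subseteq> V.span T"
    and locally_nilpotent: "\<alpha> \<in> roots sc bracket H \<Longrightarrow> X \<in> root_space sc bracket H \<alpha> \<Longrightarrow> \<exists>k. (E X r ^^ k) v = 0"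
    and nontrivial: "\<exists>X r v. E X r v \<noteq> 0"
begin

lemmas E_simps = module_hom.add[OF E_hom] module_hom.scale[OF E_hom] module_hom.zero[OF E_hom]
  module_hom.diff[OF E_hom]
lemmas K_simps = module_hom.add[OF K_hom] module_hom.scale[OF K_hom] module_hom.zero[OF K_hom]
  module_hom.diff[OF K_hom]
lemmas D_simps = module_hom.add[OF D_hom] module_hom.scale[OF D_hom] module_hom.zero[OF D_hom]
  module_hom.diff[OF D_hom]
lemmas d_simps = module_hom.add[OF d_hom] module_hom.scale[OF d_hom] module_hom.zero[OF d_hom]
  module_hom.diff[OF d_hom]

definition P :: "('g \<Rightarrow> complex) set" where
  "P = {\<alpha> \<in> roots sc bracket H. nat_combination S \<alpha>}"

definition wspace :: "('g \<Rightarrow> complex) \<Rightarrow> complex ^ 'n \<Rightarrow> 'v set" where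
  "wspace \<mu> \<delta> = {w. (\<forall>h\<in>H. E h 0 w = scaleV (\<mu> h) w) \<and> (\<forall>u. d u w = scaleV (cdot u \<delta>) w)}"

definition Vplus :: "'v set" where
  "Vplus = {v. \<forall>\<alpha>\<in>P. \<forall>X\<in>rspace \<alpha>. \<forall>r. E X r v = 0}"

lemma \<omega>_zero [simp]: "\<omega> 0 s = 0" "\<omega> r 0 = 0"
  using \<omega>_add(1)[of 0 0 s] \<omega>_add(2)[of r 0 0] by simp_all

lemma \<omega>_anticommute: "\<omega> s r = - \<omega> r s"
  using \<omega>_self[of "r + s"] \<omega>_self[of r] \<omega>_self[of s]
  unfolding \<omega>_add by (simp add: eq_neg_iff_add_eq_0 add.commute)

lemma E_zero_left [simp]: "E 0 r v = 0"
  using E_scale_left[of 0 0 r v] by simp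

lemma E_uminus_left: "E (- X) r v = - E X r v"
  using E_scale_left[of "- 1" X r v] by simp

lemma E_span_induct:
  assumes "X \<in> span A" "\<And>Y. Y \<in> A \<Longrightarrow> E Y r v \<in> W" "V.subspace W"
  shows "E X r v \<in> W"
  using assms(1)
  by (induction rule: span_induct_alt)
    (use assms(2,3) in \<open>auto simp: E_add_left E_scale_left V.subspace_0 intro!: V.subspace_add V.subspace_scale\<close>)

section \<open>Weight spaces and the degree shifts of the operators\<close>

lemma subspace_wspace: "V.subspace (wspace \<mu> \<delta>)"
  by (rule V.subspaceI) (simp_all add: wspace_def E_simps d_simps V.scale_right_distrib V.scale_left_commute)

lemma wspace_finite: obtains T where "finite T" "wspace \<mu> \<delta> \<subseteq> V.span T"
  using finite_weight_spaces[of \<mu> \<delta>] unfolding wspace_def by blast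

lemma E_wspace:
  assumes "X \<in> rspace \<alpha>" "v \<in> wspace \<mu> \<delta>"
  shows "E X r v \<in> wspace (\<lambda>h. \<mu> h + \<alpha> h) (\<delta> + cvec r)"
proof -
  have "E h 0 (E X r v) = scaleV (\<mu> h + \<alpha> h) (E X r v)" if "h \<in> H" for h
    using that assms
    by (simp add: E_E[of h 0] wspace_def E_simps rspace_bracket_H E_scale_left V.scale_left_distrib)
  moreover have "d u (E X r v) = scaleV (cdot u (\<delta> + cvec r)) (E X r v)" for u
    using assms(2) by (simp add: d_E wspace_def E_simps V.scale_left_distrib)
  ultimately show ?thesis by (simp add: wspace_def)
qed

lemma E_wspace_H: "h \<in> H \<Longrightarrow> v \<in> wspace \<mu> \<delta> \<Longrightarrow> E h r v \<in> wspace \<mu> (\<delta> + cvec r)"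
  using E_wspace[of h "\<lambda>_. 0" v \<mu> \<delta> r] by (simp add: rspace_zero)

lemma K_wspace:
  assumes "v \<in> wspace \<mu> \<delta>"
  shows "K r v \<in> wspace \<mu> (\<delta> + cvec r)"
  using assms by (simp add: wspace_def E_K d_K K_simps V.scale_left_distrib)

lemma D_wspace:
  assumes "v \<in> wspace \<mu> \<delta>"
  shows "D r v \<in> wspace \<mu> (\<delta> + cvec r)"
proof -
  have "E h 0 (D r v) = D r (E h 0 v)" for h using D_E[of r h 0 v] by simp
  then show ?thesis
    using assms by (simp add: wspace_def d_D D_simps V.scale_left_distrib)
qed

text \<open>\<open>wspace\<close> sees \<open>\<mu>\<close> only on \<open>H\<close>; requiring zero
  elsewhere makes the label of a nonzero weight vector unique.\<close>

definition weights :: "(('g \<Rightarrow> complex) \<times> (complex ^ 'n)) set" where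
  "weights = {\<theta>. \<forall>h. h \<notin> H \<longrightarrow> fst \<theta> h = 0}"

lemma span_wspaces: "v \<in> V.span (\<Union>\<theta>\<in>weights. case_prod wspace \<theta>)"
proof -
  have "w \<in> (\<Union>\<theta>\<in>weights. case_prod wspace \<theta>)"
    if "\<forall>h\<in>H. E h 0 w = scaleV (\<mu> h) w" "\<forall>u. d u w = scaleV (cdot u \<delta>) w" for w \<mu> \<delta>
    using that
    by (intro UN_I[of "(\<lambda>h. if h \<in> H then \<mu> h else 0, \<delta>)"]) (auto simp: weights_def wspace_def)
  then show ?thesis using weight_vectors_span[of v] by (elim V.span_mono[THEN subsetD, rotated]) blast
qed

lemma weight_components_mem:
  assumes "finite C" "C \<subseteq> weights" "\<And>\<theta>. \<theta> \<in> C \<Longrightarrow> f \<theta> \<in> case_prod wspace \<theta>"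
    and "V.subspace A" "\<And>h a. h \<in> H \<Longrightarrow> a \<in> A \<Longrightarrow> E h 0 a \<in> A" "\<And>u a. a \<in> A \<Longrightarrow> d u a \<in> A"
    and "sum f C \<in> A" "\<theta> \<in> C"
  shows "f \<theta> \<in> A"
proof (rule V.eigen_components_mem[where I = "Inl ` H \<union> range Inr" and T = "case_sum (\<lambda>h. E h 0) d"
      and ev = "\<lambda>i \<theta>. case i of Inl h \<Rightarrow> fst \<theta> h | Inr u \<Rightarrow> cdot u (snd \<theta>)"])
  fix \<theta> \<eta> assume *: "\<theta> \<in> C" "\<eta> \<in> C" "\<theta> \<noteq> \<eta>"
  show "\<exists>i\<in>Inl ` H \<union> range Inr. (case i of Inl h \<Rightarrow> fst \<theta> h | Inr u \<Rightarrow> cdot u (snd \<theta>)) \<noteq>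
      (case i of Inl h \<Rightarrow> fst \<eta> h | Inr u \<Rightarrow> cdot u (snd \<eta>))"
  proof (cases "snd \<theta> = snd \<eta>")
    case True
    then obtain h where "fst \<theta> h \<noteq> fst \<eta> h" using *(3) by (auto simp: prod_eq_iff fun_eq_iff)
    moreover from this have "h \<in> H" using *(1,2) assms(2) unfolding weights_def by (metis (mono_tags, lifting) mem_Collect_eq subsetD)
    ultimately show ?thesis by (intro bexI[of _ "Inl h"]) auto
  next
    case False
    then obtain i where "snd \<theta> $ i \<noteq> snd \<eta> $ i" by (auto simp: vec_eq_iff)
    then have "cdot (axis i 1) (snd \<theta>) \<noteq> cdot (axis i 1) (snd \<eta>)" by (simp add: cdot_axis)
    then show ?thesis by (intro bexI[of _ "Inr (axis i 1)"]) auto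
  qed
next
  fix i :: "'g + complex ^ 'n" and \<theta> assume "i \<in> Inl ` H \<union> range Inr" "\<theta> \<in> C"
  then show "case_sum (\<lambda>h. E h 0) d i (f \<theta>) =
      scaleV (case i of Inl h \<Rightarrow> fst \<theta> h | Inr u \<Rightarrow> cdot u (snd \<theta>)) (f \<theta>)"
    using assms(3)[of \<theta>] by (auto simp: wspace_def split_beta)
qed (use assms E_hom d_hom in auto)

lemma stable_subspace_weight_vector:
  assumes "V.subspace A" "\<And>h a. h \<in> H \<Longrightarrow> a \<in> A \<Longrightarrow> E h 0 a \<in> A" "\<And>u a. a \<in> A \<Longrightarrow> d u a \<in> A"
    and "v \<in> A" "v \<noteq> 0"
  obtains \<mu> \<delta> w where "(\<mu>, \<delta>) \<in> weights" "w \<in> A \<inter> wspace \<mu> \<delta>" "w \<noteq> 0"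
proof -
  obtain C f where C: "finite C" "C \<subseteq> weights" "\<And>\<theta>. \<theta> \<in> C \<Longrightarrow> f \<theta> \<in> case_prod wspace \<theta>" "v = sum f C"
    using V.span_graded[OF span_wspaces[of v]] subspace_wspace by (metis (mono_tags, lifting) case_prod_beta)
  obtain \<theta> where \<theta>: "\<theta> \<in> C" "f \<theta> \<noteq> 0" using assms(5) sum.neutral unfolding C(4) by metis
  have "f \<theta> \<in> A" using weight_components_mem[OF C(1-3) assms(1-3)] assms(4) C(4) \<theta>(1) by blast
  then show thesis using that[of "fst \<theta>" "snd \<theta>" "f \<theta>"] \<theta> C(2,3) by (auto simp: split_beta)
qed

text \<open>The component argument is applied with \<open>wspace \<mu> \<delta>\<close> itself as
  the stable subspace: a nonzero component of \<open>w\<close> then lies in two weight spaces at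
  once, so the labels agree.\<close>

lemma weight_mem_of_span:
  assumes "C \<subseteq> weights" "w \<in> V.span (\<Union>\<theta>\<in>C. case_prod wspace \<theta>)" "w \<in> wspace \<mu> \<delta>" "w \<noteq> 0"
    and "(\<mu>, \<delta>) \<in> weights"
  shows "(\<mu>, \<delta>) \<in> C"
proof -
  obtain C' f where C: "finite C'" "C' \<subseteq> C" "\<And>\<theta>. \<theta> \<in> C' \<Longrightarrow> f \<theta> \<in> case_prod wspace \<theta>" "w = sum f C'"
    using V.span_graded[OF assms(2)] subspace_wspace by (metis (mono_tags, lifting) case_prod_beta)
  obtain \<theta> where \<theta>: "\<theta> \<in> C'" "f \<theta> \<noteq> 0" using assms(4) sum.neutral unfolding C(4) by metis
  have f1: "f \<theta> \<in> wspace \<mu> \<delta>"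
  proof (rule weight_components_mem[of C'])
    fix h a assume *: "h \<in> H" "a \<in> wspace \<mu> \<delta>"
    then show "E h 0 a \<in> wspace \<mu> \<delta>" using E_wspace_H[OF *, of 0] by simp
  next
    fix u a assume a: "a \<in> wspace \<mu> \<delta>"
    then have "d u a = scaleV (cdot u \<delta>) a" by (simp add: wspace_def)
    then show "d u a \<in> wspace \<mu> \<delta>" using a subspace_wspace by (simp add: V.subspace_scale)
  qed (use C \<theta> assms subspace_wspace in auto)
  obtain \<mu>' \<delta>' where \<theta>_eq: "\<theta> = (\<mu>', \<delta>')" by (cases \<theta>)
  then have f2: "f \<theta> \<in> wspace \<mu>' \<delta>'" using C(3)[OF \<theta>(1)] by simp
  have *: "\<mu> h = \<mu>' h" if "h \<in> H" for h
  proof -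
    have "E h 0 (f \<theta>) = scaleV (\<mu> h) (f \<theta>)" using f1 that by (simp add: wspace_def)
    moreover have "E h 0 (f \<theta>) = scaleV (\<mu>' h) (f \<theta>)" using f2 that by (simp add: wspace_def)
    ultimately show ?thesis using \<theta>(2) by simp
  qed
  have **: "cdot u \<delta> = cdot u \<delta>'" for u
  proof -
    have "d u (f \<theta>) = scaleV (cdot u \<delta>) (f \<theta>)" using f1 by (simp add: wspace_def)
    moreover have "d u (f \<theta>) = scaleV (cdot u \<delta>') (f \<theta>)" using f2 by (simp add: wspace_def)
    ultimately show ?thesis using \<theta>(2) by simp
  qed
  have "\<mu>' = \<mu>"
  proof
    fix h show "\<mu>' h = \<mu> h"
      using * subsetD[OF assms(1) subsetD[OF C(2) \<theta>(1)]] assms(5)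
      by (cases "h \<in> H") (auto simp: weights_def \<theta>_eq)
  qed
  moreover have "\<delta>' $ i = \<delta> $ i" for i
    using **[of "axis i 1"] by (simp add: cdot_axis)
  moreover from this have "\<delta>' = \<delta>" by (simp add: vec_eq_iff)
  ultimately show ?thesis using \<theta>(1) C(2) by (auto simp: \<theta>_eq)
qed

lemma irreducible_eq_UNIV:
  assumes "V.subspace W" "v \<in> W" "v \<noteq> 0" "\<And>X r v. v \<in> W \<Longrightarrow> E X r v \<in> W"
    "\<And>r v. v \<in> W \<Longrightarrow> K r v \<in> W" "\<And>r v. v \<in> W \<Longrightarrow> D r v \<in> W" "\<And>u v. v \<in> W \<Longrightarrow> d u v \<in> W"
  shows "W = UNIV"
  using irreducible[of W] assms by blast

subsection \<open>The weights of the highest weight space\<close>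

lemma subspace_Vplus: "V.subspace Vplus"
  by (rule V.subspaceI) (simp_all add: Vplus_def E_simps)

lemma form_root_H:
  assumes "\<alpha> \<in> roots sc bracket H" "X \<in> rspace \<alpha>" "h \<in> H"
  shows "form X h = 0"
proof (rule ccontr)
  assume "form X h \<noteq> 0"
  then have "0 = - \<alpha> k" if "k \<in> H" for k
    using form_rspace[OF assms(2), of h "\<lambda>_. 0" k] assms(3) that by (simp add: rspace_zero)
  then show False using root_nonzero[OF assms(1)] by fastforce
qed

lemma E_root_E_H:
  assumes "\<alpha> \<in> roots sc bracket H" "X \<in> rspace \<alpha>" "h \<in> H"
  shows "E X r (E h s v) = E h s (E X r v) - scaleV (\<alpha> h) (E X (r + s) v)"
proof -
  have "bracket X h = - sc (\<alpha> h) X"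
    using bracket_anticommute[of X h] rspace_bracket_H[OF assms(3,2)] by simp
  then show ?thesis using form_root_H[OF assms] by (simp add: E_E[of X r h] E_uminus_left E_scale_left)
qed

lemma Vplus_E_H: "h \<in> H \<Longrightarrow> v \<in> Vplus \<Longrightarrow> E h s v \<in> Vplus"
  by (auto simp: Vplus_def P_def E_root_E_H E_simps)

lemma Vplus_K: "v \<in> Vplus \<Longrightarrow> K s v \<in> Vplus"
  by (auto simp: Vplus_def E_K K_simps)

lemma Vplus_D: "v \<in> Vplus \<Longrightarrow> D s v \<in> Vplus"
proof -
  have "E X r (D s v) = D s (E X r v) - scaleV (\<omega> s r) (E X (s + r) v)" for X r
    using D_E[of s X r v] by simp
  then show "v \<in> Vplus \<Longrightarrow> D s v \<in> Vplus" by (auto simp: Vplus_def D_simps)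
qed

lemma Vplus_d: "v \<in> Vplus \<Longrightarrow> d u v \<in> Vplus"
proof -
  have "E X r (d u v) = d u (E X r v) - scaleV (cdot u (cvec r)) (E X r v)" for X r
    using d_E[of u X r v] by simp
  then show "v \<in> Vplus \<Longrightarrow> d u v \<in> Vplus" by (auto simp: Vplus_def d_simps)
qed

lemma Vplus_weight_vector:
  assumes "v \<in> Vplus" "v \<noteq> 0"
  obtains \<mu> \<delta> w where "(\<mu>, \<delta>) \<in> weights" "w \<in> Vplus \<inter> wspace \<mu> \<delta>" "w \<noteq> 0"
  using stable_subspace_weight_vector[OF subspace_Vplus _ _ assms] Vplus_E_H Vplus_d by metis

text \<open>Words in negative root vectors applied to highest weight vectors. The base admits every
  degree in a coset of the lattice, since loops over \<open>H\<close>, the \<open>K\<close> and the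
  \<open>D\<close> preserve \<open>Vplus\<close> but shift the degree; this makes the span a
  submodule.\<close>

inductive_set lowered :: "('g \<Rightarrow> complex) \<Rightarrow> complex ^ 'n \<Rightarrow> 'v set" for \<mu> \<delta> where
  base: "v \<in> Vplus \<inter> wspace \<mu> (\<delta> + cvec r) \<Longrightarrow> v \<in> lowered \<mu> \<delta>"
| step: "v \<in> lowered \<mu> \<delta> \<Longrightarrow> \<alpha> \<in> P \<Longrightarrow> Y \<in> rspace (\<lambda>h. - \<alpha> h) \<Longrightarrow> E Y s v \<in> lowered \<mu> \<delta>"

lemma lowered_wspace:
  "v \<in> lowered \<mu> \<delta> \<Longrightarrow> \<exists>\<gamma> r. nat_combination S \<gamma> \<and> v \<in> wspace (\<lambda>h. \<mu> h - \<gamma> h) (\<delta> + cvec r)"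
proof (induction rule: lowered.induct)
  case (base v r)
  then show ?case using nat_combination_zero by (intro exI[of _ "\<lambda>_. 0"] exI[of _ r]) simp
next
  case (step v \<alpha> Y s)
  then obtain \<gamma> r where "nat_combination S \<gamma>" "v \<in> wspace (\<lambda>h. \<mu> h - \<gamma> h) (\<delta> + cvec r)" by blast
  then have "nat_combination S (\<lambda>h. \<gamma> h + \<alpha> h)"
    and "E Y s v \<in> wspace (\<lambda>h. \<mu> h - (\<gamma> h + \<alpha> h)) (\<delta> + cvec (r + s))"
    using nat_combination_add[of S \<gamma> \<alpha>] step(2) E_wspace[OF step(3), of v _ _ s]
    by (fastforce simp: cvec_add algebra_simps P_def)+
  then show ?case by blast
qed

lemma lowered_K: "v \<in> lowered \<mu> \<delta> \<Longrightarrow> K r v \<in> lowered \<mu> \<delta>"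
proof (induction rule: lowered.induct)
  case (base v s)
  then have "K r v \<in> Vplus \<inter> wspace \<mu> (\<delta> + cvec (s + r))"
    using Vplus_K K_wspace by (simp add: cvec_add flip: add.assoc)
  then show ?case by (rule lowered.base)
next
  case (step v \<alpha> Y s)
  then show ?case unfolding E_K[symmetric] by (intro lowered.step)
qed

lemma lowered_E_negative:
  assumes "\<alpha> \<in> P" "Y \<in> rspace (\<lambda>h. - \<alpha> h)" "v \<in> V.span (lowered \<mu> \<delta>)"
  shows "E Y s v \<in> V.span (lowered \<mu> \<delta>)"
  using V.hom_span_mem[OF E_hom _ assms(3)] lowered.step[OF _ assms(1,2)] V.span_base by blast

lemma lowered_D: "v \<in> lowered \<mu> \<delta> \<Longrightarrow> D r v \<in> V.span (lowered \<mu> \<delta>)"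
proof (induction rule: lowered.induct)
  case (base v s)
  then have "D r v \<in> Vplus \<inter> wspace \<mu> (\<delta> + cvec (s + r))"
    using Vplus_D D_wspace by (simp add: cvec_add flip: add.assoc)
  then show ?case by (intro V.span_base lowered.base)
next
  case (step v \<alpha> Y s)
  have "E Y (r + s) v \<in> V.span (lowered \<mu> \<delta>)" using step by (intro V.span_base lowered.step)
  moreover have "E Y s (D r v) \<in> V.span (lowered \<mu> \<delta>)"
    using step by (intro lowered_E_negative)
  ultimately show ?case unfolding D_E by (intro V.span_add V.span_scale)
qed

text \<open>Commuting \<open>X(r)\<close> past a letter \<open>Y(s)\<close> produces
  \<open>[X, Y](r + s)\<close>, so the induction runs over all \<open>X\<close> and \<open>r\<close>
  together. On a highest weight vector positive root vectors vanish, \<open>H\<close> only shifts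
  the degree, and negative root vectors lengthen the word.\<close>

lemma lowered_E: "v \<in> lowered \<mu> \<delta> \<Longrightarrow> E X r v \<in> V.span (lowered \<mu> \<delta>)"
proof (induction arbitrary: X r rule: lowered.induct)
  case (base v r')
  show ?case
  proof (rule E_span_induct[OF root_vectors_span])
    fix Y assume "Y \<in> H \<union> (\<Union>\<alpha>\<in>roots sc bracket H. rspace \<alpha>)"
    then consider "Y \<in> H" | \<alpha> where "\<alpha> \<in> P" "Y \<in> rspace \<alpha>"
      | \<alpha> where "\<alpha> \<in> roots sc bracket H" "nat_combination S (\<lambda>h. - \<alpha> h)" "Y \<in> rspace \<alpha>"
      using root_base unfolding root_base_def P_def by blast
    then show "E Y r v \<in> V.span (lowered \<mu> \<delta>)"
    proof cases
      case 1
      then have "E Y r v \<in> Vplus \<inter> wspace \<mu> (\<delta> + cvec (r' + r))"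
        using base Vplus_E_H E_wspace_H by (simp add: cvec_add flip: add.assoc)
      then show ?thesis by (intro V.span_base lowered.base)
    next
      case 2
      then show ?thesis using base by (auto simp: Vplus_def V.span_zero)
    next
      case 3
      then have "(\<lambda>h. - \<alpha> h) \<in> P" using roots_uminus by (simp add: P_def)
      then have "E Y r v \<in> lowered \<mu> \<delta>"
        using 3(3) base by (intro lowered.step[of v \<mu> \<delta> "\<lambda>h. - \<alpha> h"] lowered.base) auto
      then show ?thesis by (rule V.span_base)
    qed
  qed simp
next
  case (step v \<alpha> Y s)
  have "K (r + s) v \<in> V.span (lowered \<mu> \<delta>)" using lowered_K[OF step(1)] by (rule V.span_base)
  moreover have "E Y s (E X r v) \<in> V.span (lowered \<mu> \<delta>)"
    by (rule lowered_E_negative[OF step.hyps(2,3) step.IH])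
  ultimately show ?case
    unfolding E_E[of X r] using step.IH by (intro V.span_add V.span_diff V.span_scale)
qed

lemma span_lowered:
  assumes "v \<in> Vplus \<inter> wspace \<mu> \<delta>" "v \<noteq> 0"
  shows "V.span (lowered \<mu> \<delta>) = UNIV"
proof (rule irreducible_eq_UNIV)
  show "v \<in> V.span (lowered \<mu> \<delta>)"
    using assms(1) by (intro V.span_base lowered.base[of _ _ _ 0]) simp
  show "E X r w \<in> V.span (lowered \<mu> \<delta>)" if "w \<in> V.span (lowered \<mu> \<delta>)" for X r w
    using V.hom_span_mem[OF E_hom _ that] lowered_E by blast
  show "K r w \<in> V.span (lowered \<mu> \<delta>)" if "w \<in> V.span (lowered \<mu> \<delta>)" for r w
    using V.hom_span_mem[OF K_hom _ that] lowered_K V.span_base by blast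
  show "D r w \<in> V.span (lowered \<mu> \<delta>)" if "w \<in> V.span (lowered \<mu> \<delta>)" for r w
    using V.hom_span_mem[OF D_hom _ that] lowered_D by blast
  have "d u w \<in> V.span (lowered \<mu> \<delta>)" if "w \<in> lowered \<mu> \<delta>" for u w
    using lowered_wspace[OF that] V.span_scale[OF V.span_base[OF that]] by (auto simp: wspace_def)
  then show "d u w \<in> V.span (lowered \<mu> \<delta>)" if "w \<in> V.span (lowered \<mu> \<delta>)" for u w
    using V.hom_span_mem[OF d_hom _ that] by blast
qed (use assms in simp_all)

lemma nat_combination_outside_H: "nat_combination S \<gamma> \<Longrightarrow> h \<notin> H \<Longrightarrow> \<gamma> h = 0"
  using root_base
  by (auto simp: nat_combination_def root_base_def roots_def dual_space_def intro!: sum.neutral)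

lemma weights_below:
  assumes "v \<in> Vplus \<inter> wspace \<mu> \<delta>" "v \<noteq> 0" "(\<mu>, \<delta>) \<in> weights"
    and "w \<in> wspace \<mu>' \<delta>'" "w \<noteq> 0" "(\<mu>', \<delta>') \<in> weights"
  shows "\<exists>\<gamma> r. nat_combination S \<gamma> \<and> \<mu>' = (\<lambda>h. \<mu> h - \<gamma> h) \<and> \<delta>' = \<delta> + cvec r"
proof -
  define C where "C = {(\<lambda>h. \<mu> h - \<gamma> h, \<delta> + cvec r) |\<gamma> r. nat_combination S \<gamma>}"
  have "C \<subseteq> weights"
    using assms(3) by (auto simp: C_def weights_def nat_combination_outside_H)
  moreover have "lowered \<mu> \<delta> \<subseteq> (\<Union>\<theta>\<in>C. case_prod wspace \<theta>)"
    using lowered_wspace by (fastforce simp: C_def)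
  then have "w \<in> V.span (\<Union>\<theta>\<in>C. case_prod wspace \<theta>)"
    using span_lowered[OF assms(1,2)] V.span_mono by blast
  ultimately have "(\<mu>', \<delta>') \<in> C" using weight_mem_of_span assms(4-6) by blast
  then show ?thesis by (auto simp: C_def)
qed

text \<open>Each of the two weights lies below the other by a natural combination of the base; the
  two combinations cancel and therefore vanish.\<close>

lemma Vplus_weight_unique:
  assumes "v \<in> Vplus \<inter> wspace \<mu> \<delta>" "v \<noteq> 0" "(\<mu>, \<delta>) \<in> weights"
    and "w \<in> Vplus \<inter> wspace \<mu>' \<delta>'" "w \<noteq> 0" "(\<mu>', \<delta>') \<in> weights"
  shows "\<mu>' = \<mu> \<and> (\<exists>r. \<delta>' = \<delta> + cvec r)"
proof -
  obtain \<gamma> r where \<gamma>: "nat_combination S \<gamma>" "\<mu>' = (\<lambda>h. \<mu> h - \<gamma> h)" "\<delta>' = \<delta> + cvec r"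
    using weights_below[OF assms(1-3) _ assms(5,6)] assms(4) by blast
  obtain \<gamma>' r' where \<gamma>': "nat_combination S \<gamma>'" "\<mu> = (\<lambda>h. \<mu>' h - \<gamma>' h)"
    using weights_below[OF assms(4-6) _ assms(2,3)] assms(1) by blast
  have "\<gamma> x + \<gamma>' x = 0" for x
    using fun_cong[OF \<gamma>(2), of x] fun_cong[OF \<gamma>'(2), of x] by (simp add: algebra_simps)
  moreover have "finite S"
    "\<And>c :: ('g \<Rightarrow> complex) \<Rightarrow> complex. \<forall>x. (\<Sum>\<beta>\<in>S. c \<beta> * \<beta> x) = 0 \<Longrightarrow> \<forall>\<beta>\<in>S. c \<beta> = 0"
    using root_base unfolding root_base_def by blast+
  ultimately have "\<gamma> = (\<lambda>_. 0)"
    using nat_combination_sum_eq_zero[of S \<gamma> \<gamma>'] \<gamma>(1) \<gamma>'(1) by blast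
  then show ?thesis using \<gamma>(2,3) by auto
qed

subsection \<open>Strings of root vectors\<close>

text \<open>The sl2 computation for \<open>x(-r), t, y(r)\<close> with \<open>t = [x, y]\<close> not
  normalized, so \<open>\<alpha> t\<close> stands where the usual formula has 2. The central term of
  \<open>[x(-r), y(r)]\<close> has degree 0, and \<open>K 0 = 0\<close>.\<close>

lemma lowering_string:
  fixes r :: "int ^ 'n"
  assumes "x \<in> rspace \<alpha>" "y \<in> rspace (\<lambda>h. - \<alpha> h)" "E x (- r) u = 0" "E (bracket x y) 0 u = scaleV c u"
  shows "E (bracket x y) 0 ((E y r ^^ k) u) =
        scaleV (c - of_nat k * \<alpha> (bracket x y)) ((E y r ^^ k) u)" (is ?A)
    and "E x (- r) ((E y r ^^ Suc k) u) =
        scaleV (of_nat (Suc k) * c - of_nat (k * Suc k) / 2 * \<alpha> (bracket x y)) ((E y r ^^ k) u)" (is ?B)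
proof -
  let ?t = "bracket x y"
  have t: "?t \<in> H" using assms(1,2) by (rule bracket_opposite)
  have ty: "E ?t 0 (E y r v) = E y r (E ?t 0 v) - scaleV (\<alpha> ?t) (E y r v)" for v
    using rspace_bracket_H[OF t assms(2)] by (simp add: E_E[of ?t 0 y] E_scale_left E_uminus_left)
  have xy: "E x (- r) (E y r v) = E y r (E x (- r) v) + E ?t 0 v" for v
    by (simp add: E_E[of x "- r" y] K_0)
  show A: "E ?t 0 ((E y r ^^ k) u) = scaleV (c - of_nat k * \<alpha> ?t) ((E y r ^^ k) u)" for k
  proof (induction k)
    case 0
    then show ?case by (simp add: assms(4))
  next
    case (Suc k)
    then show ?case by (simp add: ty E_simps algebra_simps flip: V.scale_left_diff_distrib)
  qed
  show ?B
  proof (induction k)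
    case 0
    then show ?case by (simp add: xy assms(3,4) E_simps)
  next
    case (Suc k)
    have "E x (- r) ((E y r ^^ Suc (Suc k)) u) =
        E y r (E x (- r) ((E y r ^^ Suc k) u)) + E ?t 0 ((E y r ^^ Suc k) u)"
      using xy[of "(E y r ^^ Suc k) u"] by simp
    also have "\<dots> = scaleV (of_nat (Suc k) * c - of_nat (k * Suc k) / 2 * \<alpha> ?t + (c - of_nat (Suc k) * \<alpha> ?t))
        ((E y r ^^ Suc k) u)"
      unfolding Suc.IH A by (simp add: E_simps V.scale_left_distrib)
    also have "of_nat (Suc k) * c - of_nat (k * Suc k) / 2 * \<alpha> ?t + (c - of_nat (Suc k) * \<alpha> ?t) =
        of_nat (Suc (Suc k)) * c - of_nat (Suc k * Suc (Suc k)) / 2 * \<alpha> ?t"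
      by (simp add: field_simps)
    finally show ?case .
  qed
qed

text \<open>Local nilpotency ends the string, and applying \<open>x(-r)\<close> to its first
  vanishing term leaves a multiple of the last nonzero one, so the coefficient is zero. The result
  avoids division by \<open>\<alpha> t\<close>: for \<open>\<alpha> t = 0\<close> it gives
  \<open>c = 0\<close>, which is how \<open>\<alpha> t \<noteq> 0\<close> gets proved.\<close>

lemma string_length:
  fixes r :: "int ^ 'n"
  assumes "\<alpha> \<in> roots sc bracket H" "x \<in> rspace \<alpha>" "y \<in> rspace (\<lambda>h. - \<alpha> h)"
    and "E x (- r) u = 0" "E (bracket x y) 0 u = scaleV c u" "u \<noteq> 0"
  shows "\<exists>n. 2 * c = of_nat n * \<alpha> (bracket x y) \<and> (E y r ^^ n) u \<noteq> 0 \<and> (E y r ^^ Suc n) u = 0"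
proof -
  define n where "n = (LEAST k. (E y r ^^ k) u = 0)"
  obtain k where "(E y r ^^ k) u = 0"
    using locally_nilpotent[OF roots_uminus[OF assms(1)] assms(3)] by blast
  then have n: "(E y r ^^ n) u = 0" unfolding n_def by (rule LeastI)
  then obtain m where m: "n = Suc m" using assms(6) by (cases n) auto
  then have nz: "(E y r ^^ m) u \<noteq> 0" using not_less_Least[of m "\<lambda>k. (E y r ^^ k) u = 0"] n_def by simp
  have "scaleV (of_nat (Suc m) * c - of_nat (m * Suc m) / 2 * \<alpha> (bracket x y)) ((E y r ^^ m) u) = 0"
    using lowering_string(2)[OF assms(2-5), of m] n module_hom.zero[OF E_hom] unfolding m by simp
  then have "of_nat (Suc m) * (2 * c - of_nat m * \<alpha> (bracket x y)) = 0"
    using nz by (simp add: field_simps)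
  then have "2 * c = of_nat m * \<alpha> (bracket x y)" unfolding mult_eq_0_iff of_nat_eq_0_iff by simp
  then show ?thesis using nz n m by blast
qed

text \<open>The elements acting by zero in every degree form an ideal, because a bracket with a
  degree 0 element has no central term. By simplicity a nonzero member would make all loops act
  trivially.\<close>

lemma E_zero_ideal:
  assumes "X \<noteq> 0" "\<And>r v. E X r v = 0"
  shows False
proof -
  define I where "I = {X. \<forall>r v. E X r v = 0}"
  have "E (bracket Z Y) r v = 0" if "Y \<in> I" for Z Y r v
    using that E_E[of Z 0 Y r v] by (simp add: I_def E_simps)
  then have "lie_ideal sc bracket I"
    unfolding lie_ideal_def I_def by (auto intro!: subspaceI simp: E_add_left E_scale_left)
  then have "I = UNIV" using ideal_trivial assms I_def by blast
  then show False using nontrivial I_def by blast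
qed

text \<open>If \<open>\<alpha>\<close> vanished on \<open>t = [x, y]\<close>, then \<open>x\<close>, \<open>y\<close>, \<open>t\<close> would span a Heisenberg algebra, and local
  nilpotency of \<open>x\<close> and \<open>y\<close> on the module would force \<open>t\<close> to act by zero.\<close>

lemma root_bracket_nonzero:
  assumes "\<alpha> \<in> roots sc bracket H" "x \<in> rspace \<alpha>" "y \<in> rspace (\<lambda>h. - \<alpha> h)" "form x y = 1"
  shows "\<alpha> (bracket x y) \<noteq> 0"
proof
  let ?t = "bracket x y"
  assume a: "\<alpha> ?t = 0"
  have t: "?t \<in> H" using assms(2,3) by (rule bracket_opposite)
  have "E ?t 0 w = 0" if w: "w \<in> wspace \<mu> \<delta>" for w \<mu> \<delta>
  proof (cases "w = 0")
    case False
    \<comment> \<open>Moving up with \<open>x\<close> reaches a nonzero vector killed by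
      \<open>x\<close>. As \<open>\<alpha> t = 0\<close>, its \<open>t\<close>-eigenvalue is still
      \<open>\<mu> t\<close>, and the string formula makes this zero.\<close>
    define n where "n = (LEAST k. (E x 0 ^^ k) w = 0)"
    obtain k where "(E x 0 ^^ k) w = 0" using locally_nilpotent[OF assms(1,2)] by blast
    then have n: "(E x 0 ^^ n) w = 0" unfolding n_def by (rule LeastI)
    then obtain m where m: "n = Suc m" using False by (cases n) auto
    then have nz: "(E x 0 ^^ m) w \<noteq> 0" using not_less_Least[of m "\<lambda>k. (E x 0 ^^ k) w = 0"] n_def by simp
    have "E ?t 0 ((E x 0 ^^ k) w) = scaleV (\<mu> ?t) ((E x 0 ^^ k) w)" for k
    proof (induction k)
      case 0
      then show ?case using w t by (simp add: wspace_def)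
    next
      case (Suc k)
      then show ?case
        using rspace_bracket_H[OF t assms(2)] a by (simp add: E_E[of ?t 0 x] E_simps)
    qed
    moreover have "E x (- 0) ((E x 0 ^^ m) w) = 0" using n m by simp
    ultimately have "\<mu> ?t = 0"
      using string_length[OF assms(1-3), of 0 "(E x 0 ^^ m) w" "\<mu> ?t"] nz a by auto
    then show ?thesis using w t by (simp add: wspace_def)
  qed (simp add: E_simps)
  then have "E ?t 0 w \<in> V.span {}" if "w \<in> (\<Union>\<theta>\<in>weights. case_prod wspace \<theta>)" for w
    using that by (auto simp: V.span_zero)
  then have t0: "E ?t 0 v = 0" for v
    using V.hom_span_mem[OF E_hom _ span_wspaces[of v], of ?t 0 "{}"] by simp
  \<comment> \<open>The elements acting by zero in degree 0 form an ideal containing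
    \<open>t \<noteq> 0\<close>, hence all of g. Then \<open>[X, Y](r) = [X(0), Y(r)]\<close> acts
    by zero in every degree.\<close>
  define I where "I = {X. \<forall>v. E X 0 v = 0}"
  have "E (bracket Z Y) 0 v = 0" if "Y \<in> I" for Z Y v
    using that E_E[of Z 0 Y 0 v] by (simp add: I_def E_simps)
  then have "lie_ideal sc bracket I"
    unfolding lie_ideal_def I_def by (auto intro!: subspaceI simp: E_add_left E_scale_left)
  moreover obtain h where "h \<in> H" "\<alpha> h \<noteq> 0" using root_nonzero[OF assms(1)] by blast
  then have "?t \<noteq> 0" using form_bracket_opposite[OF assms(2-4)] by fastforce
  ultimately have "X \<in> I" for X using ideal_trivial[of I ?t] t0 I_def by blast
  then have "E (bracket X Y) r v = 0" for X Y r v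
    using E_E[of X 0 Y r v] by (simp add: I_def E_simps)
  then show False using not_abelian E_zero_ideal by blast
qed

text \<open>If all these values vanished, every string from \<open>v\<close> would have length 0, so
  negative root vectors would kill \<open>v\<close> as well. The vectors killed by all root vectors
  in all degrees form a submodule, so root vectors would act by zero on the whole module.\<close>

lemma ex_nonzero_string:
  assumes "v \<in> Vplus \<inter> wspace \<mu> \<delta>" "v \<noteq> 0"
  shows "\<exists>\<alpha>\<in>P. \<exists>x\<in>rspace \<alpha>. \<exists>y\<in>rspace (\<lambda>h. - \<alpha> h). form x y = 1 \<and> \<mu> (bracket x y) \<noteq> 0"
proof (rule ccontr)
  assume *: "\<not> ?thesis"
  define A where "A = {v. \<forall>\<alpha>\<in>roots sc bracket H. \<forall>X\<in>rspace \<alpha>. \<forall>r. E X r v = 0}"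
  have "E Y r v = 0" if Y: "\<beta> \<in> roots sc bracket H" "Y \<in> rspace \<beta>" for \<beta> Y r
  proof (cases "\<beta> \<in> P \<or> Y = 0")
    case True
    then show ?thesis using Y assms(1) by (auto simp: Vplus_def)
  next
    case False
    define \<alpha> where "\<alpha> = (\<lambda>h. - \<beta> h)"
    have \<alpha>: "\<alpha> \<in> roots sc bracket H" unfolding \<alpha>_def by (rule roots_uminus) fact
    have Pa: "\<alpha> \<in> P"
      using False Y(1) \<alpha> root_base unfolding root_base_def P_def \<alpha>_def by blast
    obtain x where x: "x \<in> rspace \<alpha>" "form Y x = 1"
      using form_pairing[of \<beta> Y] Y False unfolding \<alpha>_def by (auto simp: roots_altdef)
    have Y': "Y \<in> rspace (\<lambda>h. - \<alpha> h)" using Y(2) by (simp add: \<alpha>_def)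
    have f: "form x Y = 1" using x(2) form_commute by simp
    have "\<mu> (bracket x Y) = 0" using * Pa x(1) Y' f by blast
    then have "E (bracket x Y) 0 v = scaleV 0 v"
      using assms(1) bracket_opposite[OF x(1) Y'] by (simp add: wspace_def)
    moreover have "E x (- r) v = 0" using assms(1) Pa x(1) by (auto simp: Vplus_def)
    ultimately obtain n where "2 * 0 = of_nat n * \<alpha> (bracket x Y)" "(E Y r ^^ Suc n) v = 0"
      using string_length[OF \<alpha> x(1) Y' _ _ assms(2)] by blast
    then show ?thesis using root_bracket_nonzero[OF \<alpha> x(1) Y' f] by simp
  qed
  then have "v \<in> A" by (simp add: A_def)
  have "A = UNIV"
  proof (rule irreducible_eq_UNIV[OF _ \<open>v \<in> A\<close> assms(2)])
    show "V.subspace A" by (rule V.subspaceI) (simp_all add: A_def E_simps)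
    show "E X r w \<in> A" if "w \<in> A" for X r w
    proof (rule E_span_induct[OF root_vectors_span _ \<open>V.subspace A\<close>])
      fix Y assume "Y \<in> H \<union> (\<Union>\<alpha>\<in>roots sc bracket H. rspace \<alpha>)"
      then show "E Y r w \<in> A"
      proof
        assume "Y \<in> H"
        then show ?thesis using that by (auto simp: A_def E_root_E_H E_simps)
      next
        assume "Y \<in> (\<Union>\<alpha>\<in>roots sc bracket H. rspace \<alpha>)"
        then have "E Y r w = 0" using that by (auto simp: A_def)
        then show ?thesis by (simp add: A_def E_simps)
      qed
    qed
    show "K r w \<in> A" if "w \<in> A" for r w using that by (auto simp: A_def E_K K_simps)
    show "D r w \<in> A" if "w \<in> A" for r w
    proof -
      have "E X s (D r w) = D r (E X s w) - scaleV (\<omega> r s) (E X (r + s) w)" for X s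
        using D_E[of r X s w] by simp
      then show ?thesis using that by (auto simp: A_def D_simps)
    qed
    show "d u w \<in> A" if "w \<in> A" for u w
    proof -
      have "E X s (d u w) = d u (E X s w) - scaleV (cdot u (cvec s)) (E X s w)" for X s
        using d_E[of u X s w] by simp
      then show ?thesis using that by (auto simp: A_def d_simps)
    qed
  qed
  moreover obtain \<alpha> X where "\<alpha> \<in> roots sc bracket H" "X \<in> rspace \<alpha>" "X \<noteq> 0"
    using ex_root by (auto simp: roots_altdef)
  ultimately show False using E_zero_ideal[of X] unfolding A_def by blast
qed

lemma E_power_wspace:
  assumes "Y \<in> rspace (\<lambda>h. - \<alpha> h)" "v \<in> wspace \<mu> \<delta>"
  shows "(E Y r ^^ k) v \<in> wspace (\<lambda>h. \<mu> h - of_nat k * \<alpha> h) (\<delta> + of_nat k *s cvec r)"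
proof (induction k)
  case 0
  then show ?case using assms(2) by simp
next
  case (Suc k)
  have eqs: "(\<lambda>h. \<mu> h - of_nat k * \<alpha> h + - \<alpha> h) = (\<lambda>h. \<mu> h - of_nat (Suc k) * \<alpha> h)"
    "\<delta> + of_nat k *s cvec r + cvec r = \<delta> + of_nat (Suc k) *s cvec r"
    by (simp_all add: algebra_simps)
  show ?case using E_wspace[OF assms(1) Suc, of r] unfolding eqs by simp
qed

text \<open>The lowering operators of the \<open>sl\<^sub>2\<close>-triples in degrees \<open>m\<close>, \<open>0\<close>, \<open>-m\<close> embed every weight
  space of \<open>Vplus\<close> into one out of finitely many weight spaces, compatibly with the center.\<close>

lemma Vplus_embedding:
  assumes "v \<in> Vplus \<inter> wspace \<mu> \<delta>" "v \<noteq> 0"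
  obtains R :: "(int ^ 'n) set" and \<nu> and F :: "int ^ 'n \<Rightarrow> 'v \<Rightarrow> 'v"
  where "finite R" "\<And>r. module_hom scaleV scaleV (F r)" "\<And>r s v. F r (K s v) = K s (F r v)"
    "\<And>r v \<delta>'. v \<in> Vplus \<inter> wspace \<mu> \<delta>' \<Longrightarrow> F r v = 0 \<Longrightarrow> v = 0"
    "\<And>r. \<exists>r'\<in>R. \<forall>v\<in>wspace \<mu> (\<delta> + cvec r). F r v \<in> wspace \<nu> (\<delta> + cvec r')"
proof -
  obtain \<alpha> x y where *: "\<alpha> \<in> P" "x \<in> rspace \<alpha>" "y \<in> rspace (\<lambda>h. - \<alpha> h)" "form x y = 1"
      "\<mu> (bracket x y) \<noteq> 0"
    using ex_nonzero_string[OF assms] by blast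
  let ?t = "bracket x y"
  have \<alpha>: "\<alpha> \<in> roots sc bracket H" using *(1) by (simp add: P_def)
  have \<alpha>t: "\<alpha> ?t \<noteq> 0" by (rule root_bracket_nonzero) fact+
  have string: "\<exists>n. 2 * \<mu> ?t = of_nat n * \<alpha> ?t \<and> (E y r ^^ n) w \<noteq> 0"
    if "w \<in> Vplus \<inter> wspace \<mu> \<delta>'" "w \<noteq> 0" for w \<delta>' r
  proof -
    have "E x (- r) w = 0" using that(1) *(1,2) by (auto simp: Vplus_def)
    moreover have "E ?t 0 w = scaleV (\<mu> ?t) w"
      using that(1) bracket_opposite[OF *(2,3)] by (simp add: wspace_def)
    ultimately show ?thesis using string_length[OF \<alpha> *(2,3) _ _ that(2)] by blast
  qed
  obtain n where n: "2 * \<mu> ?t = of_nat n * \<alpha> ?t" using string[OF assms] by blast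
  have "n > 0" using n *(5) by (cases n) auto
  \<comment> \<open>\<open>F r\<close> applies \<open>y\<close> in degree \<open>-(r div n)\<close>
    exactly \<open>n\<close> times, which turns the degree \<open>r\<close> into its coordinatewise
    residue modulo \<open>n\<close>; the residues form the finite set \<open>R\<close>.\<close>
  define q where "q = (\<lambda>r :: int ^ 'n. (\<chi> i. r $ i div int n) :: int ^ 'n)"
  define F where "F = (\<lambda>r. E y (- q r) ^^ n)"
  define R where "R = {r :: int ^ 'n. \<forall>i. r $ i \<in> {0..<int n}}"
  have "R \<subseteq> vec_lambda ` (UNIV \<rightarrow>\<^sub>E {0..<int n})"
  proof
    fix r assume "r \<in> R"
    then show "r \<in> vec_lambda ` (UNIV \<rightarrow>\<^sub>E {0..<int n})"
      by (intro image_eqI[of _ _ "\<lambda>i. r $ i"]) (auto simp: R_def)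
  qed
  then have "finite R" by (rule finite_subset) (auto intro!: finite_PiE)
  moreover have "module_hom scaleV scaleV (F r)" for r
    unfolding F_def by (rule V.hom_power[OF E_hom])
  moreover have "(E y s ^^ k) (K r w) = K r ((E y s ^^ k) w)" for k s r w
    by (induction k) (simp_all add: E_K)
  then have "F r (K s w) = K s (F r w)" for r s w unfolding F_def .
  moreover have "w = 0" if w: "w \<in> Vplus \<inter> wspace \<mu> \<delta>'" "F r w = 0" for r w \<delta>'
  proof (rule ccontr)
    assume "w \<noteq> 0"
    \<comment> \<open>The equation for the string length involves only \<open>\<mu>\<close>, so the
      exponent is the same in all degrees.\<close>
    then obtain n' where "2 * \<mu> ?t = of_nat n' * \<alpha> ?t" "(E y (- q r) ^^ n') w \<noteq> 0"
      using string[OF w(1)] by blast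
    moreover from this n \<alpha>t have "n' = n" by simp
    ultimately show False using w(2) by (simp add: F_def)
  qed
  moreover have "\<exists>r'\<in>R. \<forall>w\<in>wspace \<mu> (\<delta> + cvec r).
      F r w \<in> wspace (\<lambda>h. \<mu> h - of_nat n * \<alpha> h) (\<delta> + cvec r')" for r
  proof (intro bexI ballI)
    let ?r' = "(\<chi> i. r $ i mod int n) :: int ^ 'n"
    show "?r' \<in> R" using \<open>n > 0\<close> by (simp add: R_def)
    have shift: "\<delta> + cvec r + of_nat n *s cvec (- q r) = \<delta> + cvec ?r'"
    proof (rule vec_eq_iff[THEN iffD2, rule_format])
      fix i
      have "r $ i mod int n = r $ i - int n * (r $ i div int n)"
        by (simp add: minus_mult_div_eq_mod)
      then have "(of_int (r $ i mod int n) :: complex) = of_int (r $ i) - of_nat n * of_int (r $ i div int n)"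
        by (simp only: of_int_diff of_int_mult of_int_of_nat_eq)
      then show "(\<delta> + cvec r + of_nat n *s cvec (- q r)) $ i = (\<delta> + cvec ?r') $ i"
        by (simp add: cvec_def q_def)
    qed
    show "F r w \<in> wspace (\<lambda>h. \<mu> h - of_nat n * \<alpha> h) (\<delta> + cvec ?r')"
      if "w \<in> wspace \<mu> (\<delta> + cvec r)" for w
      using E_power_wspace[OF *(3) that, of n "- q r"] unfolding shift F_def .
  qed
  ultimately show thesis
    by (rule that[where R = R and F = F and \<nu> = "\<lambda>h. \<mu> h - of_nat n * \<alpha> h"])
qed

theorem Vplus_bounded:
  "\<exists>M. \<forall>\<mu> \<delta> J. (\<mu>, \<delta>) \<in> weights \<longrightarrow> V.independent J \<longrightarrow> J \<subseteq> Vplus \<inter> wspace \<mu> \<delta> \<longrightarrow>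
     finite J \<and> card J \<le> M"
proof (cases "\<exists>\<mu> \<delta> v. (\<mu>, \<delta>) \<in> weights \<and> v \<in> Vplus \<inter> wspace \<mu> \<delta> \<and> v \<noteq> 0")
  case False
  have "J = {}" if "(\<mu>, \<delta>) \<in> weights" "V.independent J" "J \<subseteq> Vplus \<inter> wspace \<mu> \<delta>" for \<mu> \<delta> J
    using False that V.dependent_zero by blast
  then show ?thesis by (metis card.empty finite.emptyI le0)
next
  case True
  then obtain \<mu>0 \<delta>0 v where v: "(\<mu>0, \<delta>0) \<in> weights" "v \<in> Vplus \<inter> wspace \<mu>0 \<delta>0" "v \<noteq> 0" by blast
  obtain R \<nu> F where F: "finite R" "\<And>r. module_hom scaleV scaleV (F r)"
    "\<And>r v \<delta>'. v \<in> Vplus \<inter> wspace \<mu>0 \<delta>' \<Longrightarrow> F r v = 0 \<Longrightarrow> v = 0"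
    "\<And>r. \<exists>r'\<in>R. \<forall>v\<in>wspace \<mu>0 (\<delta>0 + cvec r). F r v \<in> wspace \<nu> (\<delta>0 + cvec r')"
    by (rule Vplus_embedding[OF v(2,3)]) blast
  have "\<exists>T. finite T \<and> wspace \<nu> (\<delta>0 + cvec r) \<subseteq> V.span T" for r
    by (rule wspace_finite) blast
  then obtain T where T: "\<And>r. finite (T r)" "\<And>r. wspace \<nu> (\<delta>0 + cvec r) \<subseteq> V.span (T r)"
    by metis
  \<comment> \<open>The bound is the largest size of a spanning set among the finitely many target
    weight spaces. A nonempty \<open>J\<close> has weight \<open>\<mu>0\<close> and a degree in the
    coset of \<open>\<delta>0\<close>, where an embedding is available.\<close>
  have "finite J \<and> card J \<le> Max ((card \<circ> T) ` R)"
    if J: "(\<mu>, \<delta>) \<in> weights" "V.independent J" "J \<subseteq> Vplus \<inter> wspace \<mu> \<delta>" for \<mu> \<delta> J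
  proof (cases "J = {}")
    case True
    then show ?thesis by simp
  next
    case False
    then obtain w where "w \<in> J" by blast
    then have w: "w \<in> Vplus \<inter> wspace \<mu> \<delta>" "w \<noteq> 0" using J V.dependent_zero by blast+
    obtain r where r: "\<mu> = \<mu>0" "\<delta> = \<delta>0 + cvec r"
      using Vplus_weight_unique[OF v(2,3,1) w J(1)] by blast
    obtain r' where r': "r' \<in> R" "\<And>v. v \<in> wspace \<mu> \<delta> \<Longrightarrow> F r v \<in> wspace \<nu> (\<delta>0 + cvec r')"
      using F(4)[of r] r by blast
    have "finite J \<and> card J \<le> card (T r')"
    proof (rule V.card_le_of_inj_hom[OF F(2)[of r]])
      show "V.subspace (Vplus \<inter> wspace \<mu> \<delta>)"
        by (intro V.subspace_inter subspace_Vplus subspace_wspace)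
      show "F r a = 0 \<Longrightarrow> a = 0" if "a \<in> Vplus \<inter> wspace \<mu> \<delta>" for a
        using F(3) that unfolding r(1) by blast
      show "F r a \<in> V.span (T r')" if "a \<in> Vplus \<inter> wspace \<mu> \<delta>" for a
        using T(2)[of r'] r'(2)[of a] that by blast
    qed (rule T J)+
    moreover have "card (T r') \<le> Max ((card \<circ> T) ` R)" using F(1) r'(1) by (intro Max_ge) auto
    ultimately show ?thesis by linarith
  qed
  then show ?thesis by blast
qed

subsection \<open>The center\<close>

lemma K_power_K: "(K r ^^ n) (K s v) = K s ((K r ^^ n) v)"
  by (induction n) (simp_all add: K_K)

lemma K_power_E: "(K r ^^ n) (E X s v) = E X s ((K r ^^ n) v)"
  by (induction n) (simp_all add: E_K)

lemma d_K_power: "d u ((K r ^^ n) v) = (K r ^^ n) (d u v) + scaleV (of_nat n * cdot u (cvec r)) ((K r ^^ n) v)"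
proof (induction n)
  case (Suc n)
  have "d u ((K r ^^ Suc n) v) = K r (d u ((K r ^^ n) v)) + scaleV (cdot u (cvec r)) ((K r ^^ Suc n) v)"
    by (simp add: d_K)
  also have "\<dots> = (K r ^^ Suc n) (d u v) +
      (scaleV (of_nat n * cdot u (cvec r)) ((K r ^^ Suc n) v) + scaleV (cdot u (cvec r)) ((K r ^^ Suc n) v))"
    by (simp add: Suc K_simps)
  also have "\<dots> = (K r ^^ Suc n) (d u v) + scaleV (of_nat (Suc n) * cdot u (cvec r)) ((K r ^^ Suc n) v)"
    by (simp add: distrib_right flip: V.scale_left_distrib)
  finally show ?case .
qed simp

lemma D_K_power:
  "D s ((K r ^^ Suc n) v) = (K r ^^ Suc n) (D s v) + scaleV (of_nat (Suc n) * \<omega> s r) (K (s + r) ((K r ^^ n) v))"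
proof (induction n)
  case 0
  then show ?case by (simp add: D_K)
next
  case (Suc n)
  have "D s ((K r ^^ Suc (Suc n)) v) =
      K r (D s ((K r ^^ Suc n) v)) + scaleV (\<omega> s r) (K (s + r) ((K r ^^ Suc n) v))"
    by (simp add: D_K)
  also have "\<dots> = (K r ^^ Suc (Suc n)) (D s v) +
      (scaleV (of_nat (Suc n) * \<omega> s r) (K (s + r) ((K r ^^ Suc n) v)) + scaleV (\<omega> s r) (K (s + r) ((K r ^^ Suc n) v)))"
    unfolding Suc.IH by (simp add: K_simps K_K[of r "s + r"])
  also have "\<dots> = (K r ^^ Suc (Suc n)) (D s v) +
      scaleV (of_nat (Suc (Suc n)) * \<omega> s r) (K (s + r) ((K r ^^ Suc n) v))"
    by (simp only: of_nat_Suc[of "Suc n"] distrib_right mult_1 V.scale_left_distrib add.commute)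
  finally show ?case .
qed

text \<open>The vectors annihilated by a power of \<open>K r\<close> form a submodule.\<close>

lemma K_locally_nilpotent:
  assumes "K r v = 0" "v \<noteq> 0"
  shows "\<exists>n. (K r ^^ n) w = 0"
proof -
  define W where "W = {w. \<exists>n. (K r ^^ n) w = 0}"
  have K0: "(K r ^^ n) 0 = 0" for n by (induction n) (simp_all add: K_simps)
  have Kadd: "(K r ^^ n) (a + b) = (K r ^^ n) a + (K r ^^ n) b" for n a b
    by (induction n) (simp_all add: K_simps)
  have Kscale: "(K r ^^ n) (scaleV c a) = scaleV c ((K r ^^ n) a)" for n a c
    by (induction n) (simp_all add: K_simps)
  have mono: "(K r ^^ (m + n)) w = 0" if "(K r ^^ n) w = 0" for m n w
    using that by (simp add: funpow_add K0)
  have "W = UNIV"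
  proof (rule irreducible_eq_UNIV[OF _ _ assms(2)])
    show "V.subspace W"
    proof (rule V.subspaceI)
      show "0 \<in> W" unfolding W_def by (intro CollectI exI[of _ 0]) simp
      fix a b assume "a \<in> W" "b \<in> W"
      then obtain m n where "(K r ^^ m) a = 0" "(K r ^^ n) b = 0" by (auto simp: W_def)
      then have "(K r ^^ (m + n)) (a + b) = 0"
        using mono[of m a n] mono[of n b m] by (simp add: Kadd add.commute)
      then show "a + b \<in> W" by (auto simp: W_def)
    next
      fix c a assume "a \<in> W"
      then show "scaleV c a \<in> W" by (auto simp: W_def Kscale intro: exI)
    qed
    show "v \<in> W" unfolding W_def using assms(1) by (intro CollectI exI[of _ 1]) simp
    fix a assume "a \<in> W"
    then obtain n where n: "(K r ^^ n) a = 0" by (auto simp: W_def)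
    show "E X s a \<in> W" for X s using n by (auto simp: W_def K_power_E E_simps intro!: exI[of _ n])
    show "K s a \<in> W" for s using n by (auto simp: W_def K_power_K K_simps intro!: exI[of _ n])
    \<comment> \<open>One extra power is taken because the commutator with \<open>D s\<close> turns
      one factor \<open>K r\<close> into \<open>K (s + r)\<close> and leaves only \<open>n\<close>
      others.\<close>
    have "(K r ^^ Suc n) (D s a) = 0" for s
      using D_K_power[of s n r a] n by (simp add: K_simps D_simps)
    then show "D s a \<in> W" for s unfolding W_def by blast
    have "(K r ^^ n) (d u a) = 0" for u
      using d_K_power[of u n r a] n by (simp add: d_simps)
    then show "d u a \<in> W" for u unfolding W_def by blast
  qed
  then show ?thesis unfolding W_def by blast
qed

text \<open>\<open>K (-r)\<close> and \<open>K (-s)\<close> bring the loops back to degree 0, so the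
  Heisenberg pair preserves \<open>wspace\<close>. A nonzero vector killed by the triple product
  makes one of its factors non-injective. The indices \<open>-r\<close>, \<open>-s\<close>,
  \<open>r + s\<close> are nonzero: \<open>r\<close> is a unit vector, and
  \<open>\<omega> r s \<noteq> 0\<close> with \<open>\<omega> r r = 0\<close> settles the
  others.\<close>

lemma ex_K_locally_nilpotent:
  assumes "v \<in> wspace \<mu> \<delta>" "v \<noteq> 0"
  shows "\<exists>r. r \<noteq> 0 \<and> (\<forall>w. \<exists>n. (K r ^^ n) w = 0)"
proof -
  define r :: "int ^ 'n" where "r = axis undefined 1"
  have "r \<noteq> 0" by (simp add: r_def axis_eq_0_iff)
  then obtain s where rs: "\<omega> r s \<noteq> 0" using \<omega>_nondegenerate by blast
  then have nz: "r + s \<noteq> 0" "s \<noteq> 0" using \<omega>_add(2)[of r r s] \<omega>_self[of r] by auto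
  obtain X Y where XY: "X \<in> H" "Y \<in> H" "form X Y \<noteq> 0" by (rule form_H_nonzero)
  define A where "A = (\<lambda>w. K (- r) (E X r w))"
  define B where "B = (\<lambda>w. K (- s) (E Y s w))"
  define Z where "Z = (\<lambda>w. scaleV (- \<omega> r s * form X Y) (K (- r) (K (- s) (K (r + s) w))))"
  obtain T where T: "finite T" "wspace \<mu> \<delta> \<subseteq> V.span T" by (rule wspace_finite)
  have hom: "module_hom scaleV scaleV A" "module_hom scaleV scaleV B" "module_hom scaleV scaleV Z"
    by (auto simp: module_hom_iff V.module_axioms A_def B_def Z_def E_simps K_simps V.scale_right_distrib
        V.scale_left_commute)
  have st: "K (- q) (E h q w) \<in> wspace \<mu> \<delta>" if "h \<in> H" "w \<in> wspace \<mu> \<delta>" for h q w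
    using K_wspace[OF E_wspace_H[OF that, of q], of "- q"] by (simp add: cvec_uminus)
  have "\<exists>w\<in>wspace \<mu> \<delta>. w \<noteq> 0 \<and> Z w = 0"
  proof (rule V.heisenberg_not_injective[OF hom subspace_wspace T assms])
    fix w assume w: "w \<in> wspace \<mu> \<delta>"
    show "A w \<in> wspace \<mu> \<delta>" "B w \<in> wspace \<mu> \<delta>" using st w XY by (simp_all add: A_def B_def)
    have "K (- r) (K (- s) (K (r + s) w)) \<in> wspace \<mu> (\<delta> + cvec (r + s) + cvec (- s) + cvec (- r))"
      by (intro K_wspace w)
    then show "Z w \<in> wspace \<mu> \<delta>"
      unfolding Z_def by (intro V.subspace_scale[OF subspace_wspace]) (simp add: cvec_add cvec_uminus)
  next
    fix w
    have "A (B w) = K (- r) (K (- s) (E X r (E Y s w)))" by (simp add: A_def B_def E_K)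
    moreover have "B (A w) = K (- r) (K (- s) (E Y s (E X r w)))"
      by (simp add: A_def B_def E_K K_K[of "- s" "- r"])
    moreover have "E X r (E Y s w) = E Y s (E X r w) + scaleV (- \<omega> r s * form X Y) (K (r + s) w)"
      using H_commute[OF XY(1,2)] by (simp add: E_E[of X r])
    ultimately show "A (B w) = B (A w) + Z w" by (simp add: K_simps Z_def)
    have "K q (K (- r) (K (- s) (K (r + s) w))) = K (- r) (K (- s) (K (r + s) (K q w)))" for q w
      by (simp only: K_K[of q])
    then show "B (Z w) = Z (B w)" "A (Z w) = Z (A w)"
      by (simp_all add: A_def B_def Z_def E_K E_simps K_simps module_hom.neg[OF E_hom] module_hom.neg[OF K_hom])
  qed
  then obtain w where w: "w \<noteq> 0" "K (- r) (K (- s) (K (r + s) w)) = 0" using rs XY(3) by (auto simp: Z_def)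
  then have "\<exists>q\<in>{- r, - s, r + s}. \<exists>w. w \<noteq> 0 \<and> K q w = 0" by blast
  then show ?thesis using K_locally_nilpotent nz \<open>r \<noteq> 0\<close> by (metis insertE neg_equal_0_iff_equal singletonD)
qed

text \<open>On one target weight space a finite spanning set bounds the exponent, and there are
  finitely many targets. The embeddings commute with \<open>K s\<close> and reflect zero, which
  transports the common exponent back to all degrees.\<close>

lemma K_uniformly_nilpotent:
  assumes "v \<in> Vplus \<inter> wspace \<mu> \<delta>" "v \<noteq> 0" and nil: "\<And>w. \<exists>n. (K s ^^ n) w = 0"
  shows "\<exists>n. \<forall>r. \<forall>w \<in> Vplus \<inter> wspace \<mu> (\<delta> + cvec r). (K s ^^ n) w = 0"
proof -
  obtain R \<nu> F where F: "finite R" "\<And>r. module_hom scaleV scaleV (F r)" "\<And>r s v. F r (K s v) = K s (F r v)"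
    "\<And>r v \<delta>'. v \<in> Vplus \<inter> wspace \<mu> \<delta>' \<Longrightarrow> F r v = 0 \<Longrightarrow> v = 0"
    "\<And>r. \<exists>r'\<in>R. \<forall>v\<in>wspace \<mu> (\<delta> + cvec r). F r v \<in> wspace \<nu> (\<delta> + cvec r')"
    by (rule Vplus_embedding[OF assms(1,2)]) blast
  have hom: "module_hom scaleV scaleV (K s ^^ n)" for n by (rule V.hom_power[OF K_hom])
  have mono: "(K s ^^ n) w = 0" if "(K s ^^ m) w = 0" "m \<le> n" for m n w
  proof -
    have "(K s ^^ n) w = (K s ^^ (n - m)) ((K s ^^ m) w)"
      using that(2) by (simp flip: funpow_add o_apply[of "K s ^^ _" "K s ^^ _"])
    then show ?thesis using that(1) module_hom.zero[OF hom] by simp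
  qed
  have "\<exists>n. \<forall>w\<in>wspace \<nu> (\<delta> + cvec r). (K s ^^ n) w = 0" for r
  proof -
    obtain T where T: "finite T" "wspace \<nu> (\<delta> + cvec r) \<subseteq> V.span T" by (rule wspace_finite)
    obtain N where N: "\<And>w. (K s ^^ N w) w = 0" using nil by metis
    have "(K s ^^ Max (N ` T)) t = 0" if "t \<in> T" for t
      using that T(1) by (intro mono[OF N[of t]]) simp
    then have "(K s ^^ Max (N ` T)) w = 0" if "w \<in> V.span T" for w
      using module_hom.eq_0_on_span[OF hom _ that] by blast
    then show ?thesis using T(2) by blast
  qed
  then obtain N where N: "\<And>r w. w \<in> wspace \<nu> (\<delta> + cvec r) \<Longrightarrow> (K s ^^ N r) w = 0" by metis
  have "(K s ^^ Max (N ` R)) w = 0" if w: "w \<in> Vplus \<inter> wspace \<mu> (\<delta> + cvec r)" for r w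
  proof -
    obtain r' where r': "r' \<in> R" "F r w \<in> wspace \<nu> (\<delta> + cvec r')" using F(5)[of r] w by blast
    have "F r ((K s ^^ n) w) = (K s ^^ n) (F r w)" for n by (induction n) (simp_all add: F(3))
    moreover have "(K s ^^ Max (N ` R)) (F r w) = 0"
      using F(1) r'(1) by (intro mono[OF N[OF r'(2)]]) simp
    \<comment> \<open>The vector \<open>(K s ^^ n) w\<close> may have left the degree of
      \<open>w\<close>, but \<open>F r\<close> is injective on \<open>Vplus\<close> in every
      degree.\<close>
    moreover have "\<exists>r. (K s ^^ n) w \<in> Vplus \<inter> wspace \<mu> (\<delta> + cvec r)" for n
    proof (induction n)
      case 0
      then show ?case using w by auto
    next
      case (Suc n)
      then obtain q where "(K s ^^ n) w \<in> Vplus \<inter> wspace \<mu> (\<delta> + cvec q)" by blast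
      then have "(K s ^^ Suc n) w \<in> Vplus \<inter> wspace \<mu> (\<delta> + cvec (q + s))"
        using Vplus_K K_wspace by (simp add: cvec_add flip: add.assoc)
      then show ?case by blast
    qed
    ultimately show ?thesis using F(4) by metis
  qed
  then show ?thesis by blast
qed

section \<open>Products of central operators with indices in a half space\<close>

abbreviation K_prod :: "(int ^ 'n) list \<Rightarrow> 'v \<Rightarrow> 'v" where
  "K_prod cs v \<equiv> foldr K cs v"

lemma K_prod_K: "K_prod cs (K r v) = K r (K_prod cs v)"
  by (induction cs) (simp_all add: K_K)

text \<open>By the Leibniz rule every term of the commutator has one index \<open>c\<close> replaced
  by \<open>c + p\<close>; as \<open>C\<close> is stable under this shift, length and index set are
  kept.\<close>

lemma D_K_prod:
  assumes "\<And>c. c \<in> C \<Longrightarrow> c + p \<in> C" "set cs \<subseteq> C"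
  shows "D p (K_prod cs v) - K_prod cs (D p v) \<in> V.span {K_prod cs' v |cs'. length cs' = length cs \<and> set cs' \<subseteq> C}"
  using assms(2)
proof (induction cs)
  case Nil
  then show ?case by (simp add: V.span_zero)
next
  case (Cons c cs)
  let ?L = "\<lambda>n. {K_prod cs' v |cs'. length cs' = n \<and> set cs' \<subseteq> C}"
  have "D p (K_prod (c # cs) v) - K_prod (c # cs) (D p v) =
      K c (D p (K_prod cs v) - K_prod cs (D p v)) + scaleV (\<omega> p c) (K_prod ((c + p) # cs) v)"
    by (simp add: D_K K_simps add.commute)
  also have "\<dots> \<in> V.span (?L (length (c # cs)))"
  proof (intro V.span_add V.span_scale)
    have Kc: "K c a \<in> ?L (length (c # cs))" if "a \<in> ?L (length cs)" for a
    proof -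
      from that obtain cs' where cs': "a = K_prod cs' v" "length cs' = length cs" "set cs' \<subseteq> C" by blast
      then show ?thesis using Cons.prems by (intro CollectI exI[of _ "c # cs'"]) simp
    qed
    have "D p (K_prod cs v) - K_prod cs (D p v) \<in> V.span (?L (length cs))"
      using Cons.IH Cons.prems by simp
    then show "K c (D p (K_prod cs v) - K_prod cs (D p v)) \<in> V.span (?L (length (c # cs)))"
      by (rule V.hom_span_mem[OF K_hom, rotated]) (rule V.span_base[OF Kc])
    show "K_prod ((c + p) # cs) v \<in> V.span (?L (length (c # cs)))"
      using Cons.prems assms(1) by (intro V.span_base CollectI exI[of _ "(c + p) # cs"]) simp
  qed
  finally show ?case .
qed

text \<open>Starting from \<open>K s ^ n = 0\<close>, commuting with \<open>D (c - s)\<close> trades a factor \<open>K s\<close> for a factor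
  \<open>K c\<close>.\<close>

lemma K_prod_eq_zero:
  assumes M: "\<And>r v. v \<in> M \<Longrightarrow> D r v \<in> M"
    and nil: "\<And>v. v \<in> M \<Longrightarrow> (K s ^^ n) v = 0"
    and C: "\<And>c c'. c \<in> C \<Longrightarrow> c' \<in> C \<Longrightarrow> c + (c' - s) \<in> C" "\<And>c. c \<in> C \<Longrightarrow> \<omega> c s \<noteq> 0"
    and "j \<le> n" "length cs = j" "set cs \<subseteq> C" "v \<in> M"
  shows "(K s ^^ (n - j)) (K_prod cs v) = 0"
  using assms(5-8)
proof (induction j arbitrary: cs v)
  case 0
  then show ?case using nil by simp
next
  case (Suc j)
  obtain c cs' where cs: "cs = c # cs'" using Suc.prems(2) by (cases cs) auto
  define m where "m = n - Suc j"
  have m: "n - j = Suc m" using Suc.prems(1) by (simp add: m_def)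
  have IH: "(K s ^^ Suc m) (K_prod ds w) = 0" if "length ds = j" "set ds \<subseteq> C" "w \<in> M" for ds w
    using Suc.IH[OF _ that] Suc.prems(1) m by simp
  have cs': "length cs' = j" "set cs' \<subseteq> C" "c \<in> C" using Suc.prems cs by auto
  let ?p = "c - s"
  have hom: "module_hom scaleV scaleV (K s ^^ k)" for k by (rule V.hom_power[OF K_hom])
  \<comment> \<open>The commutator is a combination of products of \<open>j\<close> factors from
    \<open>C\<close>, the shift by \<open>c - s\<close> staying inside \<open>C\<close>, so the
    induction hypothesis covers it.\<close>
  have "(K s ^^ Suc m) (D ?p (K_prod cs' v) - K_prod cs' (D ?p v)) = 0"
    by (rule module_hom.eq_0_on_span[OF hom _ D_K_prod[of C ?p cs' v]])
      (use IH Suc.prems(4) cs' C in auto)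
  then have "(K s ^^ Suc m) (D ?p (K_prod cs' v)) = 0"
    using IH[of cs' "D ?p v"] cs' M Suc.prems(4) by (simp only: module_hom.diff[OF hom]) simp
  moreover have "D ?p ((K s ^^ Suc m) (K_prod cs' v)) = 0"
    using IH[of cs' v] cs' Suc.prems(4) by (simp only: D_simps)
  moreover have "\<omega> ?p s \<noteq> 0" using C(2)[OF cs'(3)] \<omega>_add(1)[of ?p s s] by (simp add: \<omega>_self)
  \<comment> \<open>What remains of the power rule is this vector with coefficient
    \<open>Suc m\<close> times \<open>\<omega> (c - s) s\<close>, and
    \<open>\<omega> (c - s) s = \<omega> c s\<close> is nonzero.\<close>
  ultimately have "K c ((K s ^^ m) (K_prod cs' v)) = 0"
    using D_K_power[of ?p m s "K_prod cs' v"] by (simp del: of_nat_Suc)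
  then show ?case by (simp add: cs K_power_K m_def)
qed

definition half_space :: "int ^ 'n \<Rightarrow> complex \<Rightarrow> (int ^ 'n) set" where
  "half_space s z = {r. Re (z * \<omega> r s) > 0}"

text \<open>Since \<open>\<omega> s s = 0\<close>, subtracting \<open>s\<close> does not change the
  value of \<omega> against \<open>s\<close>, so \<open>c + (c' - s)\<close> behaves like
  \<open>c + c'\<close>.\<close>

lemma half_space_closed:
  assumes "c \<in> half_space s z" "c' \<in> half_space s z"
  shows "c + (c' - s) \<in> half_space s z" "\<omega> c s \<noteq> 0"
proof -
  have "\<omega> (c + (c' - s)) s = \<omega> c s + \<omega> c' s"
    using \<omega>_add(1)[of c "c' - s" s] \<omega>_add(1)[of "c' - s" s s] by (simp add: \<omega>_self)
  then show "c + (c' - s) \<in> half_space s z" using assms by (simp add: half_space_def algebra_simps)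
  show "\<omega> c s \<noteq> 0" using assms(1) by (auto simp: half_space_def)
qed

lemma K_prod_half_space:
  assumes "\<And>r v. v \<in> M \<Longrightarrow> D r v \<in> M" "\<And>v. v \<in> M \<Longrightarrow> (K s ^^ n) v = 0"
    and "length cs = n" "set cs \<subseteq> half_space s z" "v \<in> M"
  shows "K_prod cs v = 0"
  using K_prod_eq_zero[of M n s "half_space s z" n cs v] half_space_closed assms by auto

lemma K_nilpotent_spread:
  assumes "\<And>r v. v \<in> M \<Longrightarrow> D r v \<in> M" "\<And>v. v \<in> M \<Longrightarrow> (K s ^^ n) v = 0" "\<omega> c s \<noteq> 0" "v \<in> M"
  shows "(K c ^^ n) v = 0"
proof -
  \<comment> \<open>Multiplication by the conjugate turns the value into the squared modulus of
    \<open>\<omega> c s\<close>, which is positive.\<close>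
  have "c \<in> half_space s (cnj (\<omega> c s))"
    using assms(3) by (simp add: half_space_def complex_neq_0 power2_eq_square)
  then have "K_prod (replicate n c) v = 0"
    by (intro K_prod_half_space[of M n s _ "cnj (\<omega> c s)"]) (use assms in auto)
  then show ?thesis by (simp add: foldr_replicate)
qed

text \<open>Nilpotency spreads from \<open>s\<close> to \<open>q\<close> and from \<open>q\<close>
  to \<open>r\<close>. Some \<open>q\<close> pairs nontrivially with both, as two proper subgroups
  do not cover the lattice: \<open>a\<close>, \<open>b\<close> or \<open>a + b\<close>
  works.\<close>

lemma K_nilpotent_all:
  assumes "\<And>r v. v \<in> M \<Longrightarrow> D r v \<in> M" "\<And>v. v \<in> M \<Longrightarrow> (K s ^^ n) v = 0" "s \<noteq> 0" "r \<noteq> 0" "v \<in> M"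
  shows "(K r ^^ n) v = 0"
proof -
  obtain a b where ab: "\<omega> s a \<noteq> 0" "\<omega> r b \<noteq> 0" using \<omega>_nondegenerate assms(3,4) by metis
  have "\<exists>q. \<omega> s q \<noteq> 0 \<and> \<omega> r q \<noteq> 0"
  proof (cases "\<omega> r a = 0 \<and> \<omega> s b = 0")
    case True
    then show ?thesis using ab by (intro exI[of _ "a + b"]) (simp add: \<omega>_add)
  next
    case False
    then show ?thesis using ab by blast
  qed
  then obtain q where q: "\<omega> q s \<noteq> 0" "\<omega> r q \<noteq> 0" by (metis \<omega>_anticommute neg_equal_0_iff_equal)
  have "(K q ^^ n) v = 0" if "v \<in> M" for v
    by (rule K_nilpotent_spread[OF _ _ q(1) that]) (use assms in auto)
  then show ?thesis
    by (intro K_nilpotent_spread[OF _ _ q(2) assms(5)]) (use assms in auto)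
qed

text \<open>Factors from \<open>C\<close> are applied as long as the result can be kept nonzero;
  this stops before \<open>n\<close> steps.\<close>

lemma K_prod_maximal:
  assumes "\<And>cs. length cs = n \<Longrightarrow> set cs \<subseteq> C \<Longrightarrow> K_prod cs v = 0" "v \<noteq> 0"
  obtains cs where "K_prod cs v \<noteq> 0" "\<And>c. c \<in> C \<Longrightarrow> K c (K_prod cs v) = 0"
  using assms
proof (induction n arbitrary: v thesis)
  case 0
  then show ?case using "0.prems"(2)[of "[]"] by simp
next
  case (Suc n)
  show ?case
  proof (cases "\<forall>c\<in>C. K c v = 0")
    case True
    then show ?thesis using Suc.prems(1)[of "[]"] Suc.prems(3) by simp
  next
    case False
    then obtain c where c: "c \<in> C" "K c v \<noteq> 0" by blast
    have "K_prod cs (K c v) = 0" if "length cs = n" "set cs \<subseteq> C" for cs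
      using Suc.prems(2)[of "cs @ [c]"] that c(1) by simp
    then obtain cs where "K_prod cs (K c v) \<noteq> 0" "\<And>c'. c' \<in> C \<Longrightarrow> K c' (K_prod cs (K c v)) = 0"
      using Suc.IH[of "K c v"] c(2) by blast
    then show ?thesis using Suc.prems(1)[of "cs @ [c]"] by simp
  qed
qed

text \<open>The four factors test both signs of the real and the imaginary part of
  \<open>\<omega> r (axis i 1)\<close>, which is nonzero for some \<open>i\<close>.\<close>

lemma half_spaces_cover:
  assumes "r \<noteq> 0"
  shows "\<exists>i. \<exists>z\<in>{1, -1, \<i>, -\<i>}. r \<in> half_space (axis i 1) z"
proof -
  obtain i where i: "\<omega> r (axis i 1) \<noteq> 0" using \<omega>_nondegenerate[OF assms] by blast
  let ?w = "\<omega> r (axis i 1)"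
  have "Re ?w > 0 \<or> Re ?w < 0 \<or> Im ?w > 0 \<or> Im ?w < 0" using i by (auto simp: complex_eq_iff)
  then show ?thesis by (intro exI[of _ i]) (auto simp: half_space_def)
qed

theorem K_eq_zero:
  assumes "v \<in> Vplus" "v \<noteq> 0"
  shows "K r w = 0"
proof -
  obtain \<mu> \<delta> v0 where v0: "v0 \<in> Vplus \<inter> wspace \<mu> \<delta>" "v0 \<noteq> 0"
    by (rule Vplus_weight_vector[OF assms])
  \<comment> \<open>A union of weight spaces rather than their sum: it is stable under
    \<open>D\<close> and \<open>K\<close>, and the uniform exponent is available on homogeneous
    vectors.\<close>
  define M where "M = (\<Union>r. Vplus \<inter> wspace \<mu> (\<delta> + cvec r))"
  have M_D: "D r v \<in> M" if v: "v \<in> M" for r v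
  proof -
    obtain q where "v \<in> Vplus \<inter> wspace \<mu> (\<delta> + cvec q)" using v by (auto simp: M_def)
    then have "D r v \<in> Vplus \<inter> wspace \<mu> (\<delta> + cvec (q + r))"
      using Vplus_D D_wspace by (simp add: cvec_add flip: add.assoc)
    then show ?thesis unfolding M_def by blast
  qed
  have M_K: "K r v \<in> M" if v: "v \<in> M" for r v
  proof -
    obtain q where "v \<in> Vplus \<inter> wspace \<mu> (\<delta> + cvec q)" using v by (auto simp: M_def)
    then have "K r v \<in> Vplus \<inter> wspace \<mu> (\<delta> + cvec (q + r))"
      using Vplus_K K_wspace by (simp add: cvec_add flip: add.assoc)
    then show ?thesis unfolding M_def by blast
  qed
  obtain s where s: "s \<noteq> 0" "\<And>w. \<exists>n. (K s ^^ n) w = 0"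
    using ex_K_locally_nilpotent[of v0 \<mu> \<delta>] v0 by blast
  obtain n where n: "\<And>v. v \<in> M \<Longrightarrow> (K s ^^ n) v = 0"
    using K_uniformly_nilpotent[OF v0 s(2)] unfolding M_def by blast
  have nil: "(K (axis i 1) ^^ n) v = 0" if "v \<in> M" for i v
    using K_nilpotent_all[of M n s "axis i 1" v] M_D n s(1) that by (simp add: axis_eq_0_iff)
  \<comment> \<open>One half space is treated at a time. A product not killing \<open>u\<close> that
    cannot be prolonged gives the next vector, which is still killed by the earlier operators
    because all \<open>K\<close> commute.\<close>
  have ex: "\<exists>u\<in>M. u \<noteq> 0 \<and> (\<forall>(i, z)\<in>\<Phi>. \<forall>c\<in>half_space (axis i 1) z. K c u = 0)"
    if "finite \<Phi>" for \<Phi> :: "('n \<times> complex) set"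
    using that
  proof induction
    case empty
    have "v0 \<in> M" unfolding M_def using v0(1) by (intro UN_I[of 0]) simp_all
    then show ?case using v0(2) by auto
  next
    case (insert iz \<Phi>)
    then obtain u where u: "u \<in> M" "u \<noteq> 0"
      "\<And>i z c. (i, z) \<in> \<Phi> \<Longrightarrow> c \<in> half_space (axis i 1) z \<Longrightarrow> K c u = 0" by blast
    obtain i z where iz: "iz = (i, z)" by (cases iz)
    have "K_prod cs u = 0" if "length cs = n" "set cs \<subseteq> half_space (axis i 1) z" for cs
      by (rule K_prod_half_space[of M n "axis i 1" cs z u]) (use M_D nil that u(1) in auto)
    then obtain cs where cs: "K_prod cs u \<noteq> 0" "\<And>c. c \<in> half_space (axis i 1) z \<Longrightarrow> K c (K_prod cs u) = 0"
      by (rule K_prod_maximal[of n "half_space (axis i 1) z" u]) (use u(2) in auto)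
    have "K_prod ds u \<in> M" for ds by (induction ds) (simp_all add: u(1) M_K)
    moreover have "K c (K_prod cs u) = 0" if "K c u = 0" for c
    proof -
      have "K_prod ds 0 = 0" for ds by (induction ds) (simp_all add: K_simps)
      then show ?thesis using that by (simp flip: K_prod_K)
    qed
    ultimately show ?case using cs u(3) iz by (intro bexI[of _ "K_prod cs u"]) auto
  qed
  obtain u where u: "u \<noteq> 0" "\<And>i z c. z \<in> {1, -1, \<i>, -\<i>} \<Longrightarrow> c \<in> half_space (axis i 1) z \<Longrightarrow> K c u = 0"
  proof -
    have "finite ((UNIV :: 'n set) \<times> {1, -1, \<i>, -\<i>})" by simp
    then show thesis using ex that by fast
  qed
  have Ku: "K r u = 0" for r
    using half_spaces_cover[of r] u(2) K_0 by (cases "r = 0") blast+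
  \<comment> \<open>All \<open>K r\<close> are required to vanish at once, since commuting
    \<open>K r\<close> with \<open>D s\<close> yields \<open>K (s + r)\<close>.\<close>
  define W where "W = {v. \<forall>r. K r v = 0}"
  have "W = UNIV"
  proof (rule irreducible_eq_UNIV[OF _ _ u(1)])
    show "V.subspace W" by (rule V.subspaceI) (simp_all add: W_def K_simps)
    show "u \<in> W" using Ku by (simp add: W_def)
    fix a assume "a \<in> W"
    then have a: "K r a = 0" for r by (simp add: W_def)
    show "E X s a \<in> W" for X s using a by (simp add: W_def E_simps flip: E_K)
    show "K s a \<in> W" for s using a by (simp add: W_def K_simps)
    have "K r (D s a) = D s (K r a) - scaleV (\<omega> s r) (K (s + r) a)" for r s
      using D_K[of s r a] by simp
    then show "D s a \<in> W" for s using a by (simp add: W_def D_simps)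
    have "K r (d u a) = d u (K r a) - scaleV (cdot u (cvec r)) (K r a)" for r u
      using d_K[of u r a] by simp
    then show "d u a \<in> W" for u using a by (simp add: W_def d_simps)
  qed
  then show ?thesis unfolding W_def by blast
qed

end

section \<open>The action of \<open>\<tau>\<^sub>B\<close>\<close>

interpretation center: vector_space "center_scale :: complex \<Rightarrow> 'n::finite center \<Rightarrow> _"
  by (rule vector_space_center_scale)

lemma pm_single_induct [case_names zero single]:
  assumes "Q 0" "\<And>a b f. Q f \<Longrightarrow> Q (Poly_Mapping.single a b + f)"
  shows "Q f"
proof (induction f rule: update_induct)
  case const
  show ?case by fact
next
  case (update f a b)
  have "Poly_Mapping.update a b f = Poly_Mapping.single a b + f"
    using update(1) by (intro poly_mapping_eqI) (auto simp: lookup_update lookup_add lookup_single in_keys_iff)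
  then show ?case using assms(2)[OF update(3)] by simp
qed

lemma vec_axis_induct:
  fixes u :: "complex ^ 'n::finite"
  assumes "Q 0" "\<And>u v. Q u \<Longrightarrow> Q v \<Longrightarrow> Q (u + v)" "\<And>c i. Q (c *s axis i 1)"
  shows "Q u"
proof -
  have "Q (\<Sum>i\<in>A. (u $ i) *s axis i 1)" if "finite A" for A
    using that by induction (simp_all add: assms)
  from this[of UNIV] show ?thesis by (simp add: basis_expansion)
qed

lemma pm_scale_single:
  assumes "sc c 0 = 0"
  shows "pm_scale sc c (Poly_Mapping.single r x) = Poly_Mapping.single r (sc c x)"
  using assms by (intro poly_mapping_eqI) (simp add: lookup_pm_scale lookup_single when_def)

lemma center_K_add: "center_K (u + v) r = center_K u r + center_K v r"
  by (simp add: center_K.abs_eq plus_center.abs_eq single_add)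

lemma center_K_induct [case_names zero K]:
  assumes "Q 0" "\<And>u r z. Q z \<Longrightarrow> Q (center_K u r + z)"
  shows "Q z"
proof -
  obtain x where "z = abs_center x" by (rule center_cases)
  moreover have "Q (abs_center x)"
  proof (induction x rule: pm_single_induct)
    case zero
    then show ?case using assms(1) by (simp add: zero_center.abs_eq)
  next
    case (single r u f)
    then show ?case using assms(2)[OF single, of u r] by (simp add: plus_center.abs_eq center_K.abs_eq)
  qed
  ultimately show ?thesis by simp
qed

section \<open>The derivation algebra \<open>H_tilde B\<close> and the ideal
  \<open>K_sub B\<close>\<close>

lemma der_span_d_eq: "der_span_d = range (Poly_Mapping.single (0 :: int ^ 'n::finite) :: complex ^ 'n \<Rightarrow> _)"
proof
  show "der_span_d \<subseteq> range (Poly_Mapping.single (0 :: int ^ 'n) :: complex ^ 'n \<Rightarrow> _)"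
    unfolding der_span_d_def
  proof (rule omega.span_minimal)
    show "omega.subspace (range (Poly_Mapping.single (0 :: int ^ 'n) :: complex ^ 'n \<Rightarrow> _))"
      by (rule omega.subspaceI)
        (auto simp: pm_scale_single image_iff simp flip: single_add intro: exI[of _ 0])
  qed auto
  have "Poly_Mapping.single (0 :: int ^ 'n) u \<in> der_span_d" for u :: "complex ^ 'n"
  proof (induction u rule: vec_axis_induct)
    case 1
    then show ?case by (simp add: der_span_d_def omega.span_zero)
  next
    case (2 u v)
    then show ?case by (simp add: der_span_d_def single_add omega.span_add)
  next
    case (3 c i)
    have "pm_scale (*s) c (Poly_Mapping.single 0 (axis i 1)) \<in> (der_span_d :: (int ^ 'n \<Rightarrow>\<^sub>0 complex ^ 'n) set)"
      unfolding der_span_d_def by (intro omega.span_scale omega.span_base) auto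
    then show ?case by (simp add: pm_scale_single)
  qed
  then show "range (Poly_Mapping.single (0 :: int ^ 'n) :: complex ^ 'n \<Rightarrow> _) \<subseteq> der_span_d" by blast
qed

lemma H_tilde_eq_span:
  "H_tilde B = omega.span ({Poly_Mapping.single r (B *v cvec r) |r. r \<noteq> 0} \<union>
      range (\<lambda>i. Poly_Mapping.single 0 (axis i 1)))"
  by (auto simp: H_tilde_def der_span_d_def omega.span_Un set_plus_def)

lemma subspace_H_tilde: "omega.subspace (H_tilde B)"
  by (simp add: H_tilde_eq_span)

lemma single_zero_H_tilde: "Poly_Mapping.single 0 u \<in> H_tilde B"
proof -
  have "Poly_Mapping.single 0 u \<in> der_span_d" by (auto simp: der_span_d_eq)
  then show ?thesis unfolding der_span_d_def H_tilde_eq_span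
    by (rule subsetD[OF omega.span_mono, rotated]) auto
qed

lemma single_H_tilde: "Poly_Mapping.single r (B *v cvec r) \<in> H_tilde B"
proof (cases "r = 0")
  case True
  then show ?thesis using single_zero_H_tilde[of 0 B] by simp
next
  case False
  then show ?thesis unfolding H_tilde_eq_span by (intro omega.span_base) auto
qed

lemma H_tilde_induct [consumes 1, case_names add D d]:
  assumes "p \<in> H_tilde B" "\<And>p q. p \<in> H_tilde B \<Longrightarrow> q \<in> H_tilde B \<Longrightarrow> Q p \<Longrightarrow> Q q \<Longrightarrow> Q (p + q)"
    and "\<And>c r. Q (Poly_Mapping.single r (c *s (B *v cvec r)))" "\<And>u. Q (Poly_Mapping.single 0 u)"
  shows "Q p"
proof -
  have "Q p \<and> p \<in> H_tilde B" using assms(1) unfolding H_tilde_eq_span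
  proof (induction rule: omega.span_induct_alt)
    case base
    then show ?case using assms(4)[of 0] by (simp add: omega.span_zero)
  next
    case (step c x y)
    then have x: "pm_scale (*s) c x \<in> H_tilde B"
      unfolding H_tilde_eq_span by (intro omega.span_scale omega.span_base)
    have "Q (pm_scale (*s) c x)" using step(1) assms(3,4) by (auto simp: pm_scale_single)
    then have "Q (pm_scale (*s) c x + y)"
      using step(2) x by (intro assms(2)) (simp_all add: H_tilde_eq_span)
    moreover have "pm_scale (*s) c x + y \<in> H_tilde B"
      using step(2) by (intro omega.subspace_add[OF subspace_H_tilde] x) (simp add: H_tilde_eq_span)
    ultimately show ?case by (simp add: H_tilde_eq_span)
  qed
  then show ?thesis ..
qed

lemma cdot_commute: "cdot u v = cdot v u"
  by (simp add: cdot_def mult.commute)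

lemma cdot_transpose: "cdot (B *v u) v = cdot u (transpose B *v v)"
  unfolding cdot_def matrix_vector_mult_def transpose_def
  by (simp add: sum_distrib_left sum_distrib_right) (subst sum.swap, simp add: mult_ac)

lemma cdot_skew:
  assumes "transpose B = - B"
  shows "cdot (B *v u) v = - cdot (B *v v) u"
proof -
  have "cdot u (- B *v v) = - cdot u (B *v v)"
    by (simp add: cdot_def matrix_vector_mult_def sum_negf)
  then show ?thesis by (simp add: cdot_transpose[of B u v] assms cdot_commute[of u])
qed

lemma cdot_skew_self:
  assumes "transpose B = - B"
  shows "cdot (B *v u) u = 0"
  using cdot_skew[OF assms, of u u] by simp

lemma cdot_uminus: "cdot u (- v) = - cdot u v"
  by (simp add: cdot_def sum_negf)

text \<open>The computation behind the ideal property of \<open>K_sub B\<close>. For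
  \<open>r + s \<noteq> 0\<close> the two terms combine to a vector \<open>w\<close> with
  \<open>(B w|r + s) = (B r|s) ((B v|r) + (B r|v))\<close>, zero by skew-symmetry. For
  \<open>r + s = 0\<close>, a degree in which \<open>K_sub B\<close> has no generators, both
  coefficients vanish.\<close>

lemma der_on_center_K_sub:
  assumes skew: "transpose B = - B" and z: "z \<in> K_sub B"
    and p: "p = Poly_Mapping.single 0 u \<or> p = Poly_Mapping.single r (B *v cvec r)"
  shows "der_on_center p z \<in> K_sub B"
proof -
  have K: "center_K v s \<in> K_sub B" if "cdot (B *v v) (cvec s) = 0" "s \<noteq> 0" for v s
    unfolding K_sub_def using that by (intro center.span_base) auto
  have *: "der_on_center p (center_K v s) \<in> K_sub B" if v: "cdot (B *v v) (cvec s) = 0" "s \<noteq> 0" for v s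
    using p
  proof
    assume "p = Poly_Mapping.single 0 u"
    then show ?thesis using K[OF v] center.span_scale
      by (simp add: der_on_center_K K_sub_def)
  next
    assume p: "p = Poly_Mapping.single r (B *v cvec r)"
    let ?b = "B *v cvec r"
    have skew': "cdot ?b v = - cdot (B *v v) (cvec r)" by (rule cdot_skew[OF skew])
    show ?thesis
    proof (cases "r + s = 0")
      case True
      then have s: "cvec s = - cvec r" by (simp add: add_eq_0_iff2 cvec_uminus)
      have "cdot ?b (cvec s) = 0" by (simp add: s cdot_uminus cdot_skew_self[OF skew])
      moreover have "cdot ?b v = 0" using v(1) by (simp add: skew' s cdot_uminus)
      ultimately show ?thesis by (simp add: p der_on_center_K K_sub_def center.span_zero)
    next
      case False
      let ?w = "cdot ?b (cvec s) *s v + cdot ?b v *s cvec r"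
      have "der_on_center p (center_K v s) = center_K ?w (r + s)"
        by (simp add: p der_on_center_K center_scale_K center_K_add)
      moreover have "cdot (B *v ?w) (cvec (r + s)) = 0"
      proof -
        have "cdot (B *v ?w) (cvec (r + s)) =
            cdot ?b (cvec s) * cdot (B *v v) (cvec r) + cdot ?b v * cdot ?b (cvec s)"
          using v(1) by (simp add: matrix_vector_right_distrib vector_scalar_commute cvec_add
            cdot_skew_self[OF skew] algebra_simps)
        then show ?thesis by (simp add: skew')
      qed
      ultimately show ?thesis using K False by simp
    qed
  qed
  show ?thesis using z unfolding K_sub_def
  proof (induction rule: center.span_induct_alt)
    case base
    then show ?case by (simp add: center.span_zero)
  next
    case (step c x y)
    then obtain v s where v: "x = center_K v s" "cdot (B *v v) (cvec s) = 0" "s \<noteq> 0" by blast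
    have "cdot (B *v (c *s v)) (cvec s) = 0" using v(2) by (simp add: vector_scalar_commute)
    then have "der_on_center p (center_scale c x) \<in> K_sub B"
      using *[of "c *s v" s] v(1,3) by (simp add: center_scale_K)
    then show ?case using step by (simp add: der_on_center_add K_sub_def center.span_add)
  qed
qed

section \<open>The action of \<open>tau\<close> computed on representatives of cosets\<close>

locale tau_module =
  fixes sc :: "complex \<Rightarrow> 'g::ab_group_add \<Rightarrow> 'g"
    and bracket :: "'g \<Rightarrow> 'g \<Rightarrow> 'g"
    and form :: "'g \<Rightarrow> 'g \<Rightarrow> complex"
    and H :: "'g set"
    and S :: "('g \<Rightarrow> complex) set"
    and B :: "complex ^ 'n::finite ^ 'n"
    and scaleV :: "complex \<Rightarrow> 'v::ab_group_add \<Rightarrow> 'v"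
    and act :: "('g, 'n) toroidal set \<Rightarrow> 'v \<Rightarrow> 'v"
  assumes g_simple: "simple_lie_algebra sc bracket"
    and g_form: "nondegenerate_invariant_symmetric_form sc bracket form"
    and g_cartan: "cartan_subalgebra sc bracket H"
    and S_base: "root_base sc bracket H S"
    and skew: "transpose B = - B" and invertible: "invertible B"
    and act_irreducible: "irreducible_module (tau sc bracket form B) scaleV act"
    and act_integrable: "integrable_module sc bracket form B H scaleV act"
    and act_finite: "\<forall>\<mu>\<in>tau_weights sc bracket form B H.
           fin_dim scaleV (weight_space scaleV act (h_tilde B H) \<mu>)"
    and act_K: "\<forall>i v. act (tau_class B (tor_K (axis i 1) 0)) v = 0"
    and act_nontrivial: "\<exists>x\<in>tau_loop B. \<exists>v. act x v \<noteq> 0"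
begin

abbreviation L :: "('g, 'n) toroidal set lie_structure" where
  "L \<equiv> tau sc bracket form B"

abbreviation cl :: "('g, 'n) toroidal \<Rightarrow> ('g, 'n) toroidal set" where
  "cl \<equiv> tau_class B"

abbreviation br :: "('g, 'n) toroidal \<Rightarrow> ('g, 'n) toroidal \<Rightarrow> ('g, 'n) toroidal" where
  "br \<equiv> tor_bracket sc bracket form"

definition T :: "('g, 'n) toroidal set" where
  "T = UNIV \<times> UNIV \<times> H_tilde B"

lemma g_lie: "lie_algebra sc bracket"
  using g_simple by (simp add: simple_lie_algebra_def)

sublocale g: vector_space sc
  using g_lie by (simp add: lie_algebra_def)

sublocale g_lie: lie_algebra sc bracket
  by (rule g_lie)

lemma act_module: "lie_module L scaleV act"
  using act_irreducible by (simp add: irreducible_module_def)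

sublocale V0: complex_vector_space scaleV
  using act_module by (simp add: lie_module_def complex_vector_space_def)

sublocale loop: vector_space "pm_scale sc :: complex \<Rightarrow> (int ^ 'n \<Rightarrow>\<^sub>0 'g) \<Rightarrow> _"
  by (rule vector_space_pm_scale) (rule g.vector_space_axioms)

lemma vector_space_tor_scale: "vector_space (tor_scale sc :: complex \<Rightarrow> ('g, 'n) toroidal \<Rightarrow> _)"
  by unfold_locales
    (simp_all add: tor_scale_def split_beta prod_eq_iff loop.scale_left_distrib loop.scale_right_distrib
      omega.scale_left_distrib omega.scale_right_distrib center.scale_left_distrib center.scale_right_distrib)

sublocale tor: vector_space "tor_scale sc :: complex \<Rightarrow> ('g, 'n) toroidal \<Rightarrow> _"
  by (rule vector_space_tor_scale)

lemma cl_eqI: "x - y \<in> {0} \<times> K_sub B \<times> {0} \<Longrightarrow> cl x = cl y"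
proof -
  let ?J = "{0} \<times> K_sub B \<times> {0} :: ('g, 'n) toroidal set"
  have J: "tor.subspace ?J"
    by (rule tor.subspaceI) (auto simp: tor_scale_def zero_prod_def K_sub_def center.span_zero
        center.span_add center.span_scale)
  have sub: "cl a \<subseteq> cl b" if "a - b \<in> ?J" for a b
  proof
    fix c assume "c \<in> cl a"
    then obtain j where j: "j \<in> ?J" "c = a + j" unfolding tau_class_def elt_set_plus_def by blast
    then have "c = b + (a - b + j)" by simp
    moreover have "a - b + j \<in> ?J" by (rule tor.subspace_add[OF J that j(1)])
    ultimately show "c \<in> cl b"
      unfolding tau_class_def elt_set_plus_def by (intro CollectI bexI[of _ "a - b + j"])
  qed
  assume *: "x - y \<in> ?J"
  then have "y - x \<in> ?J" using tor.subspace_neg[OF J *] by simp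
  with * show ?thesis by (intro subset_antisym sub)
qed

lemma cl_self: "x \<in> cl x"
  by (auto simp: tau_class_def elt_set_plus_def K_sub_def center.span_zero zero_prod_def
      intro!: bexI[of _ "(0, 0, 0)"])

text \<open>The operations of \<open>lie_quotient\<close> are unions over all representatives; they
  collapse to one coset when the terms agree.\<close>

lemma UN_cl: "(\<And>x'. x' \<in> cl x \<Longrightarrow> f x' = C) \<Longrightarrow> (\<Union>x'\<in>cl x. f x') = C"
  by (rule UN_constant_eq[OF cl_self]) simp

lemma mem_clE:
  assumes "x \<in> cl y" obtains k where "k \<in> K_sub B" "x = y + (0, k, 0)"
  using assms by (auto simp: tau_class_def elt_set_plus_def)

lemma carrier_L: "lie_carrier L = cl ` T"
  by (simp add: tau_def lie_quotient_def T_def tau_class_def)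

lemma add_L: "lie_add L (cl x) (cl y) = cl (x + y)"
proof -
  have "cl (x' + y') = cl (x + y)" if x: "x' \<in> cl x" and y: "y' \<in> cl y" for x' y'
  proof -
    obtain k where k: "k \<in> K_sub B" "x' = x + (0, k, 0)" by (rule mem_clE[OF x])
    obtain l where l: "l \<in> K_sub B" "y' = y + (0, l, 0)" by (rule mem_clE[OF y])
    have "x' + y' - (x + y) = (0, k + l, 0)" by (simp add: k(2) l(2) prod_eq_iff)
    then show ?thesis using k(1) l(1) by (intro cl_eqI) (simp add: K_sub_def center.span_add)
  qed
  then have "(\<Union>x'\<in>cl x. \<Union>y'\<in>cl y. cl (x' + y')) = cl (x + y)"
    by (intro UN_cl)
  then show ?thesis by (simp add: tau_def lie_quotient_def tau_class_def)
qed

lemma scale_L: "lie_scale L c (cl x) = cl (tor_scale sc c x)"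
proof -
  have "cl (tor_scale sc c x') = cl (tor_scale sc c x)" if x: "x' \<in> cl x" for x'
  proof -
    obtain k where k: "k \<in> K_sub B" "x' = x + (0, k, 0)" by (rule mem_clE[OF x])
    have "tor_scale sc c x' - tor_scale sc c x = (0, center_scale c k, 0)"
      by (simp add: k(2) tor.scale_right_distrib) (simp add: tor_scale_def)
    then show ?thesis using k(1) by (intro cl_eqI) (simp add: K_sub_def center.span_scale)
  qed
  then have "(\<Union>x'\<in>cl x. cl (tor_scale sc c x')) = cl (tor_scale sc c x)"
    by (rule UN_cl)
  then show ?thesis by (simp add: tau_def lie_quotient_def tau_class_def)
qed

text \<open>The bracket of two cosets is a single coset when both derivation parts map
  \<open>K_sub B\<close> into itself. The condition is recorded for single elements, as only
  brackets of generators are computed.\<close>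

definition preserves_K_sub :: "(int ^ 'n \<Rightarrow>\<^sub>0 complex ^ 'n) \<Rightarrow> bool" where
  "preserves_K_sub p \<longleftrightarrow> (\<forall>z\<in>K_sub B. der_on_center p z \<in> K_sub B)"

lemma bracket_L:
  assumes "preserves_K_sub (snd (snd x))" "preserves_K_sub (snd (snd y))"
  shows "lie_bracket L (cl x) (cl y) = cl (br x y)"
proof -
  have "cl (br x' y') = cl (br x y)" if x': "x' \<in> cl x" and y': "y' \<in> cl y" for x' y'
  proof -
    obtain k where k: "k \<in> K_sub B" "x' = x + (0, k, 0)" by (rule mem_clE[OF x'])
    obtain l where l: "l \<in> K_sub B" "y' = y + (0, l, 0)" by (rule mem_clE[OF y'])
    obtain f z p g w q where xy: "x = (f, z, p)" "y = (g, w, q)" by (cases x, cases y) auto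
    have "br x' y' - br x y = (0, der_on_center p l - der_on_center q k, 0)"
      by (simp add: k(2) l(2) xy tor_bracket_def der_on_center_add)
    moreover have "der_on_center p l - der_on_center q k \<in> K_sub B"
      using assms k(1) l(1) xy by (simp add: preserves_K_sub_def K_sub_def center.span_diff)
    ultimately show ?thesis by (intro cl_eqI) simp
  qed
  then have "(\<Union>x'\<in>cl x. \<Union>y'\<in>cl y. cl (br x' y')) = cl (br x y)"
    by (intro UN_cl)
  then show ?thesis by (simp add: tau_def lie_quotient_def tau_class_def)
qed

definition op :: "('g, 'n) toroidal \<Rightarrow> 'v \<Rightarrow> 'v" where
  "op x = act (cl x)"

lemma op_hom: "x \<in> T \<Longrightarrow> module_hom scaleV scaleV (op x)"
  using act_module by (auto simp: lie_module_def carrier_L op_def module_hom_iff_linear)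

lemma op_add: "x \<in> T \<Longrightarrow> y \<in> T \<Longrightarrow> op (x + y) v = op x v + op y v"
  using act_module by (auto simp: lie_module_def carrier_L op_def simp flip: add_L)

lemma op_scale: "x \<in> T \<Longrightarrow> op (tor_scale sc c x) v = scaleV c (op x v)"
  using act_module by (auto simp: lie_module_def carrier_L op_def simp flip: scale_L)

lemma op_br:
  assumes "x \<in> T" "y \<in> T" "preserves_K_sub (snd (snd x))" "preserves_K_sub (snd (snd y))"
  shows "op x (op y v) = op y (op x v) + op (br x y) v"
proof -
  have "act (lie_bracket L (cl x) (cl y)) v = op x (op y v) - op y (op x v)"
    using act_module assms(1,2) by (auto simp: lie_module_def carrier_L op_def)
  then show ?thesis by (simp add: bracket_L[OF assms(3,4)] op_def)
qed

lemma zero_T: "0 \<in> T"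
  by (simp add: T_def zero_prod_def omega.subspace_0[OF subspace_H_tilde])

lemma op_zero [simp]: "op 0 v = 0"
  using op_add[OF zero_T zero_T, of v] by simp

lemma op_cong_K_sub: "x - y \<in> {0} \<times> K_sub B \<times> {0} \<Longrightarrow> op x = op y"
  using cl_eqI unfolding op_def by metis

lemma T_generators [simp]: "tor_X X r \<in> T" "tor_K u r \<in> T" "tor_D u 0 \<in> T" "tor_D (B *v cvec r) r \<in> T"
  using omega.subspace_0[OF subspace_H_tilde] single_zero_H_tilde single_H_tilde
  by (simp_all add: T_def tor_X_def tor_K_def tor_D_def)

lemma T_add: "x \<in> T \<Longrightarrow> y \<in> T \<Longrightarrow> x + y \<in> T"
  using omega.subspace_add[OF subspace_H_tilde] by (auto simp: T_def)

lemma T_scale: "x \<in> T \<Longrightarrow> tor_scale sc c x \<in> T"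
  using omega.subspace_scale[OF subspace_H_tilde] by (auto simp: T_def tor_scale_def)

lemma preserves_K_sub_generators [simp]:
  "preserves_K_sub (snd (snd (tor_X X r)))" "preserves_K_sub (snd (snd (tor_K u r)))"
  "preserves_K_sub (snd (snd (tor_D u 0)))" "preserves_K_sub (snd (snd (tor_D (B *v cvec r) r)))"
  using der_on_center_K_sub[OF skew]
  by (auto simp: preserves_K_sub_def tor_X_def tor_K_def tor_D_def K_sub_def center.span_zero)

definition \<omega> :: "int ^ 'n \<Rightarrow> int ^ 'n \<Rightarrow> complex" where
  "\<omega> r s = cdot (B *v cvec r) (cvec s)"

text \<open>Modulo \<open>K_sub B\<close> the class of \<open>K(u, r)\<close> with
  \<open>r \<noteq> 0\<close> depends only on \<open>(u|B r)\<close>, so the choice is immaterial.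
  For \<open>r = 0\<close> no vector has this pairing and the value is arbitrary.\<close>

definition kvec :: "int ^ 'n \<Rightarrow> complex ^ 'n" where
  "kvec r = (SOME u. cdot u (B *v cvec r) = 1)"

definition opK :: "int ^ 'n \<Rightarrow> 'v \<Rightarrow> 'v" where
  "opK r v = (if r = 0 then 0 else op (tor_K (kvec r) r) v)"

lemma B_cvec_nonzero: "r \<noteq> 0 \<Longrightarrow> B *v cvec r \<noteq> 0"
proof
  assume r: "r \<noteq> 0" and 0: "B *v cvec r = 0"
  obtain C where "C ** B = mat 1" using invertible unfolding invertible_def by blast
  then have "cvec r = C *v (B *v cvec r)" by (simp add: matrix_vector_mul_assoc)
  then have "cvec r = 0" by (simp add: 0)
  then show False using r by (simp add: cvec_def vec_eq_iff)
qed

lemma kvec: "r \<noteq> 0 \<Longrightarrow> cdot (kvec r) (B *v cvec r) = 1"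
proof -
  assume "r \<noteq> 0"
  then obtain i where i: "(B *v cvec r) $ i \<noteq> 0" using B_cvec_nonzero by (metis vec_eq_iff zero_index)
  then have "cdot ((1 / (B *v cvec r) $ i) *s axis i 1) (B *v cvec r) = 1" by (simp add: cdot_axis)
  then show ?thesis unfolding kvec_def by (rule someI)
qed

lemma tor_K_add: "tor_K (u + v) r = tor_K u r + tor_K v r"
  by (simp add: tor_K_def center_K_add)

lemma tor_K_scale: "tor_K (c *s u) (r :: int ^ 'n) = tor_scale sc c (tor_K u r)"
  by (simp add: tor_K_def tor_scale_def center_scale_K)

lemma tor_D_add: "tor_D (u + v) r = tor_D u r + tor_D v r"
  by (simp add: tor_D_def single_add)

lemma tor_D_scale: "tor_D (c *s u) (r :: int ^ 'n) = tor_scale sc c (tor_D u r)"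
  by (simp add: tor_D_def tor_scale_def pm_scale_single)

text \<open>For \<open>r \<noteq> 0\<close> the difference of \<open>u\<close> and
  \<open>(u|B r) kvec r\<close> is orthogonal to \<open>B r\<close>, so its class lies in
  \<open>K_sub B\<close>. In degree 0 both sides vanish because the \<open>K_i\<close> act by
  zero.\<close>

lemma op_K: "op (tor_K u r) v = scaleV (cdot u (B *v cvec r)) (opK r v)"
proof (cases "r = 0")
  case True
  have "op (tor_K u 0) v = 0"
  proof (induction u rule: vec_axis_induct)
    case 1
    then show ?case by (simp add: tor_K_def flip: zero_prod_def)
  next
    case (2 u w)
    then show ?case by (simp add: tor_K_add op_add)
  next
    case (3 c i)
    have "op (tor_K (axis i 1) 0) v = 0" using act_K by (simp add: op_def)
    then show ?case by (simp only: tor_K_scale op_scale T_generators V0.scale_zero_right)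
  qed
  then show ?thesis by (simp add: True)
next
  case False
  let ?c = "cdot u (B *v cvec r)"
  have "cdot (B *v (u - ?c *s kvec r)) (cvec r) = - cdot (B *v cvec r) (u - ?c *s kvec r)"
    by (rule cdot_skew[OF skew])
  also have "cdot (B *v cvec r) (u - ?c *s kvec r) = 0"
    using kvec[OF False] by (simp add: cdot_uminus cdot_commute[of "B *v cvec r"] flip: add_uminus_conv_diff)
  finally have "center_K (u - ?c *s kvec r) r \<in> K_sub B"
    unfolding K_sub_def using False by (intro center.span_base) auto
  moreover have "tor_K u r - tor_scale sc ?c (tor_K (kvec r) r) = (0, center_K (u - ?c *s kvec r) r, 0)"
    using center_K_add[of "u - ?c *s kvec r" "?c *s kvec r" r]
    by (simp add: tor_K_def tor_scale_def center_scale_K)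
  ultimately have "op (tor_K u r) = op (tor_scale sc ?c (tor_K (kvec r) r))"
    by (intro op_cong_K_sub) simp
  then show ?thesis using False by (simp add: op_scale opK_def)
qed

lemma opK_eq: "opK r v = op (tor_K (kvec r) r) v"
  by (simp add: op_K[of _ 0] opK_def)

lemma opK_hom: "module_hom scaleV scaleV (opK r)"
proof -
  have "opK r = op (tor_K (kvec r) r)" by (rule ext) (rule opK_eq)
  then show ?thesis using op_hom by simp
qed

lemma tor_X_add: "tor_X (X + Y) r = tor_X X r + tor_X Y r"
  by (simp add: tor_X_def single_add)

lemma tor_X_scale: "tor_X (sc c X) (r :: int ^ 'n) = tor_scale sc c (tor_X X r)"
  by (simp add: tor_X_def tor_scale_def pm_scale_single)

lemmas br_generators = tor_bracket_generators[OF g_lie g_form]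

text \<open>The source of the minus sign in the central term of \<open>opE_opE\<close>, where
  \<open>K(r, r + s)\<close> has to be expressed by \<open>opK (r + s)\<close>.\<close>

lemma cdot_cvec_B: "cdot (cvec r) (B *v cvec (r + s)) = - \<omega> r s"
  by (simp add: cdot_commute[of "cvec r"] cvec_add matrix_vector_right_distrib \<omega>_def
      cdot_skew[OF skew, of "cvec s" "cvec r"] cdot_skew_self[OF skew])

lemma opE_opE: "op (tor_X X r) (op (tor_X Y s) v) = op (tor_X Y s) (op (tor_X X r) v) +
    op (tor_X (bracket X Y) (r + s)) v - scaleV (\<omega> r s * form X Y) (opK (r + s) v)"
proof -
  have "op (br (tor_X X r) (tor_X Y s)) v =
      op (tor_X (bracket X Y) (r + s)) v + scaleV (form X Y * - \<omega> r s) (opK (r + s) v)"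
    by (simp only: br_generators op_add op_scale T_generators T_scale op_K cdot_cvec_B V0.scale_scale)
  then show ?thesis
    using op_br[of "tor_X X r" "tor_X Y s" v] by (simp add: mult.commute)
qed

lemma opE_opK: "op (tor_X X r) (opK s v) = opK s (op (tor_X X r) v)"
  using op_br[of "tor_K (kvec s) s" "tor_X X r" v] by (simp add: opK_eq br_generators)

lemma opK_opK: "opK r (opK s v) = opK s (opK r v)"
  using op_br[of "tor_K (kvec r) r" "tor_K (kvec s) s" v] by (simp add: opK_eq br_generators)

lemma opD_opE: "op (tor_D (B *v cvec r) r) (op (tor_X X s) v) =
    op (tor_X X s) (op (tor_D (B *v cvec r) r) v) + scaleV (\<omega> r s) (op (tor_X X (r + s)) v)"
  using op_br[of "tor_D (B *v cvec r) r" "tor_X X s" v] by (simp add: br_generators op_scale \<omega>_def)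

text \<open>With \<open>u = kvec s\<close> the bracket contains \<open>K(u, r + s)\<close> and
  \<open>K(r, r + s)\<close>. Their coefficients combine so that \<open>r\<close> drops out of
  \<open>(u|B (r + s))\<close>, leaving \<open>(u|B s) = 1\<close>; for \<open>s = 0\<close> the
  factor \<open>\<omega> r s\<close> vanishes.\<close>

lemma opD_opK: "op (tor_D (B *v cvec r) r) (opK s v) =
    opK s (op (tor_D (B *v cvec r) r) v) + scaleV (\<omega> r s) (opK (r + s) v)"
proof -
  let ?u = "kvec s" and ?b = "B *v cvec r"
  have "op (br (tor_D ?b r) (tor_K ?u s)) v =
      scaleV (\<omega> r s * cdot ?u (B *v cvec (r + s)) + cdot ?b ?u * - \<omega> r s) (opK (r + s) v)"
    by (simp only: br_generators op_add op_scale T_generators T_scale op_K cdot_cvec_B V0.scale_scale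
        V0.scale_left_distrib flip: \<omega>_def)
  also have "\<omega> r s * cdot ?u (B *v cvec (r + s)) + cdot ?b ?u * - \<omega> r s = \<omega> r s * cdot ?u (B *v cvec s)"
    by (simp add: cvec_add matrix_vector_right_distrib cdot_commute[of ?b] algebra_simps)
  also have "\<dots> = \<omega> r s"
    using kvec[of s] by (cases "s = 0") (simp_all add: \<omega>_def)
  finally show ?thesis using op_br[of "tor_D ?b r" "tor_K ?u s" v] by (simp add: opK_eq)
qed

lemma opd_opE: "op (tor_D u 0) (op (tor_X X s) v) =
    op (tor_X X s) (op (tor_D u 0) v) + scaleV (cdot u (cvec s)) (op (tor_X X s) v)"
  using op_br[of "tor_D u 0" "tor_X X s" v] by (simp add: br_generators op_scale)

lemma opd_opK: "op (tor_D u 0) (opK s v) =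
    opK s (op (tor_D u 0) v) + scaleV (cdot u (cvec s)) (opK s v)"
proof -
  have "op (br (tor_D u 0) (tor_K (kvec s) s)) v = scaleV (cdot u (cvec s)) (op (tor_K (kvec s) s) v)"
    by (simp add: br_generators op_add op_scale T_scale op_K[of 0])
  then show ?thesis using op_br[of "tor_D u 0" "tor_K (kvec s) s" v] by (simp add: opK_eq)
qed

lemma opd_opD: "op (tor_D u 0) (op (tor_D (B *v cvec s) s) v) =
    op (tor_D (B *v cvec s) s) (op (tor_D u 0) v) +
    scaleV (cdot u (cvec s)) (op (tor_D (B *v cvec s) s) v)"
proof -
  have "br (tor_D u 0) (tor_D (B *v cvec s) s) = tor_scale sc (cdot u (cvec s)) (tor_D (B *v cvec s) s)"
    by (simp add: br_generators tor_D_scale)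
  then show ?thesis
    using op_br[of "tor_D u 0" "tor_D (B *v cvec s) s" v] by (simp add: op_scale)
qed

text \<open>Reduces invariance under all of \<open>tau\<close> to the operators in terms of which
  \<open>loop_module\<close> states irreducibility.\<close>

lemma op_mem:
  assumes W: "V0.subspace W" and w: "w \<in> W"
    and E: "\<And>X r. op (tor_X X r) w \<in> W" and K: "\<And>r. opK r w \<in> W"
    and D: "\<And>r. op (tor_D (B *v cvec r) r) w \<in> W" and d: "\<And>u. op (tor_D u 0) w \<in> W"
    and x: "x \<in> T"
  shows "op x w \<in> W"
proof -
  obtain f z p where fzp: "x = (f, z, p)" "p \<in> H_tilde B" using x by (auto simp: T_def)
  note mem = T_def omega.subspace_0[OF subspace_H_tilde]
  have "op (f, 0, 0) w \<in> W"
  proof (induction f rule: pm_single_induct)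
    case zero
    then show ?case using V0.subspace_0[OF W] by (simp flip: zero_prod_def)
  next
    case (single r X f)
    have "(Poly_Mapping.single r X + f, 0, 0) = tor_X X r + (f, 0, 0)" by (simp add: tor_X_def)
    moreover have "op (tor_X X r + (f, 0, 0)) w = op (tor_X X r) w + op (f, 0, 0) w"
      by (rule op_add) (simp, simp add: mem)
    ultimately show ?case using V0.subspace_add[OF W E single] by simp
  qed
  moreover have "op (0, z, 0) w \<in> W"
  proof (induction z rule: center_K_induct)
    case zero
    then show ?case using V0.subspace_0[OF W] by (simp flip: zero_prod_def)
  next
    case (K u r z)
    have "op (0, center_K u r + z, 0) w = op (tor_K u r + (0, z, 0)) w" by (simp add: tor_K_def)
    moreover have "op (tor_K u r + (0, z, 0)) w = op (tor_K u r) w + op (0, z, 0) w"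
      by (rule op_add) (simp, simp add: mem)
    moreover have "op (tor_K u r) w \<in> W" unfolding op_K by (rule V0.subspace_scale[OF W assms(4)])
    ultimately show ?case using K by (simp add: V0.subspace_add[OF W])
  qed
  moreover have "op (0, 0, p) w \<in> W" using fzp(2)
  proof (induction rule: H_tilde_induct)
    case (add p q)
    have "op (0, 0, p + q) w = op ((0, 0, p) + (0, 0, q)) w" by simp
    moreover have "op ((0, 0, p) + (0, 0, q)) w = op (0, 0, p) w + op (0, 0, q) w"
      by (rule op_add) (simp_all add: T_def add)
    ultimately show ?case using V0.subspace_add[OF W add(3,4)] by simp
  next
    case (D c r)
    have "op (tor_D (c *s (B *v cvec r)) r) w \<in> W"
      unfolding tor_D_scale op_scale[OF T_generators(4)] by (rule V0.subspace_scale[OF W assms(5)])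
    then show ?case by (simp add: tor_D_def)
  next
    case (d u)
    then show ?case using assms(6)[of u] by (simp add: tor_D_def)
  qed
  moreover have "op x w = op (f, 0, 0) w + op (0, z, 0) w + op (0, 0, p) w"
  proof -
    have "x = ((f, 0, 0) + (0, z, 0)) + (0, 0, p)" by (simp add: fzp(1))
    also have "op \<dots> w = op ((f, 0, 0) + (0, z, 0)) w + op (0, 0, p) w"
      by (rule op_add) (use fzp(2) in \<open>simp_all add: mem\<close>)
    also have "op ((f, 0, 0) + (0, z, 0)) w = op (f, 0, 0) w + op (0, z, 0) w"
      by (rule op_add) (simp_all add: mem)
    finally show ?thesis .
  qed
  ultimately show ?thesis by (simp add: V0.subspace_add[OF W])
qed

lemma opd_expand: "op (tor_D u 0) v = (\<Sum>i\<in>UNIV. scaleV (u $ i) (op (tor_D (axis i 1) 0) v))"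
proof -
  have "op (tor_D (\<Sum>i\<in>A. (u $ i) *s axis i 1) 0) v = (\<Sum>i\<in>A. scaleV (u $ i) (op (tor_D (axis i 1) 0) v))"
    if "finite A" for A
    using that
  proof induction
    case empty
    then show ?case by (simp add: tor_D_def flip: zero_prod_def)
  next
    case (insert i A)
    then show ?case by (simp add: tor_D_add op_add tor_D_scale op_scale T_scale)
  qed
  from this[of UNIV] show ?thesis by (simp add: basis_expansion)
qed

section \<open>Weights of \<open>h_tilde\<close> compared with joint eigenvalues of the
  operators\<close>

lemma h_tilde_E: "h \<in> H \<Longrightarrow> cl (tor_X h 0) \<in> h_tilde B H"
  and h_tilde_d: "cl (tor_D u 0) \<in> h_tilde B H"
proof -
  have 0: "0 \<in> center_span_K" "0 \<in> der_span_d"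
    by (simp_all add: center_span_K_def der_span_d_def center.span_zero omega.span_zero)
  show "cl (tor_X h 0) \<in> h_tilde B H" if "h \<in> H"
    using that 0 unfolding h_tilde_def tor_X_def by (intro imageI) auto
  have "(0 :: 'g) \<in> H" using g_cartan g.subspace_0 unfolding cartan_subalgebra_def by blast
  then have "0 \<in> Poly_Mapping.single (0 :: int ^ 'n) ` H" by (auto simp: image_iff intro!: bexI[of _ 0])
  then show "cl (tor_D u 0) \<in> h_tilde B H"
    unfolding h_tilde_def tor_D_def using 0 by (intro imageI) (auto simp: der_span_d_eq)
qed

text \<open>The central part of \<open>h_tilde\<close> is spanned by the \<open>K_i\<close> and acts
  by zero, so only \<open>H\<close> and the degree derivations contribute.\<close>

lemma h_tilde_act:
  assumes "x \<in> h_tilde B H"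
  shows "\<exists>h\<in>H. \<exists>u. \<forall>v. act x v = op (tor_X h 0) v + op (tor_D u 0) v"
proof -
  obtain h z u where x: "x = cl (Poly_Mapping.single 0 h, z, Poly_Mapping.single 0 u)"
      "h \<in> H" "z \<in> center_span_K"
    using assms by (auto simp: h_tilde_def der_span_d_eq)
  have mem: "(0, b, 0) \<in> T" for b
    by (simp add: T_def omega.subspace_0[OF subspace_H_tilde])
  have z: "op (0, z, 0) v = 0" for v
    using x(3) unfolding center_span_K_def
  proof (induction rule: center.span_induct_alt)
    case base
    then show ?case by (simp flip: zero_prod_def)
  next
    case (step c a b)
    then obtain i where a: "a = center_K (axis i 1) 0" by blast
    have "(0, center_scale c a + b, 0) = tor_scale sc c (tor_K (axis i 1) 0) + (0, b, 0)"
      by (simp add: a tor_scale_def tor_K_def)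
    moreover have "op (tor_scale sc c (tor_K (axis i 1) 0) + (0, b, 0)) v =
        op (tor_scale sc c (tor_K (axis i 1) 0)) v + op (0, b, 0) v"
      by (rule op_add) (simp_all add: T_scale mem)
    moreover have "op (tor_scale sc c (tor_K (axis i 1) 0)) v = 0"
      by (simp add: op_scale op_K)
    ultimately show ?case using step(2) by simp
  qed
  have "act x v = op (tor_X h 0) v + op (tor_D u 0) v" for v
  proof -
    have "act x v = op (tor_X h 0 + (0, z, 0) + tor_D u 0) v"
      by (simp add: op_def x(1) tor_X_def tor_D_def)
    also have "\<dots> = op (tor_X h 0 + (0, z, 0)) v + op (tor_D u 0) v"
      by (rule op_add) (simp_all add: T_add mem)
    also have "op (tor_X h 0 + (0, z, 0)) v = op (tor_X h 0) v + op (0, z, 0) v"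
      by (rule op_add) (simp_all add: mem)
    finally show ?thesis by (simp add: z)
  qed
  then show ?thesis using x(2) by blast
qed

lemma h_tilde_subset: "h_tilde B H \<subseteq> cl ` T"
  using single_zero_H_tilde by (fastforce simp: h_tilde_def T_def der_span_d_eq)

lemma h_tilde_closed:
  assumes "x \<in> h_tilde B H" "y \<in> h_tilde B H"
  shows "lie_add L x y \<in> h_tilde B H" "lie_scale L c x \<in> h_tilde B H"
proof -
  obtain h z u where x: "x = cl (Poly_Mapping.single 0 h, z, Poly_Mapping.single 0 u)"
      "h \<in> H" "z \<in> center_span_K"
    using assms(1) by (auto simp: h_tilde_def der_span_d_eq)
  obtain h' z' u' where y: "y = cl (Poly_Mapping.single 0 h', z', Poly_Mapping.single 0 u')"
      "h' \<in> H" "z' \<in> center_span_K"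
    using assms(2) by (auto simp: h_tilde_def der_span_d_eq)
  have H: "g.subspace H" using g_cartan unfolding cartan_subalgebra_def by blast
  have "lie_add L x y = cl (Poly_Mapping.single 0 (h + h'), z + z', Poly_Mapping.single 0 (u + u'))"
    by (simp add: x(1) y(1) add_L single_add)
  then show "lie_add L x y \<in> h_tilde B H"
    using x y g.subspace_add[OF H] unfolding h_tilde_def
    by (auto simp: der_span_d_eq center_span_K_def center.span_add intro!: imageI)
  have "lie_scale L c x = cl (Poly_Mapping.single 0 (sc c h), center_scale c z, Poly_Mapping.single 0 (c *s u))"
    by (simp add: x(1) scale_L tor_scale_def pm_scale_single)
  then show "lie_scale L c x \<in> h_tilde B H"
    using x g.subspace_scale[OF H] unfolding h_tilde_def
    by (auto simp: der_span_d_eq center_span_K_def center.span_scale intro!: imageI)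
qed

definition op_wspace :: "('g \<Rightarrow> complex) \<Rightarrow> complex ^ 'n \<Rightarrow> 'v set" where
  "op_wspace \<mu> \<delta> = {w. (\<forall>h\<in>H. op (tor_X h 0) w = scaleV (\<mu> h) w) \<and>
     (\<forall>u. op (tor_D u 0) w = scaleV (cdot u \<delta>) w)}"

text \<open>A nonzero joint eigenvector \<open>w0\<close> determines a functional on \<open>h_tilde B H\<close>, which identifies the
  weight spaces of the operators with those of the module.\<close>

lemma op_wspace_subset_weight_space:
  assumes "w0 \<in> op_wspace \<mu> \<delta>" "w0 \<noteq> 0"
  shows "\<exists>\<nu>\<in>tau_weights sc bracket form B H. op_wspace \<mu> \<delta> \<subseteq> weight_space scaleV act (h_tilde B H) \<nu>"
proof -
  have "\<exists>c. \<forall>w\<in>op_wspace \<mu> \<delta>. act x w = scaleV c w" if x: "x \<in> h_tilde B H" for x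
  proof -
    obtain h u where hu: "h \<in> H" "\<And>v. act x v = op (tor_X h 0) v + op (tor_D u 0) v"
      using h_tilde_act[OF x] by blast
    show ?thesis
      using hu by (intro exI[of _ "\<mu> h + cdot u \<delta>"]) (simp add: op_wspace_def V0.scale_left_distrib)
  qed
  then obtain c where c: "\<And>x w. x \<in> h_tilde B H \<Longrightarrow> w \<in> op_wspace \<mu> \<delta> \<Longrightarrow> act x w = scaleV (c x) w"
    by metis
  define \<nu> where "\<nu> = (\<lambda>x. if x \<in> h_tilde B H then c x else 0)"
  have "\<nu> (lie_add L x y) = \<nu> x + \<nu> y" if xy: "x \<in> h_tilde B H" "y \<in> h_tilde B H" for x y
  proof -
    have "x \<in> lie_carrier L" "y \<in> lie_carrier L" using xy h_tilde_subset by (auto simp: carrier_L)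
    then have "act (lie_add L x y) w0 = act x w0 + act y w0"
      using act_module unfolding lie_module_def by blast
    then have "scaleV (c (lie_add L x y)) w0 = scaleV (c x + c y) w0"
      using c[OF _ assms(1)] xy h_tilde_closed(1)[OF xy] by (simp add: V0.scale_left_distrib)
    then show ?thesis using assms(2) xy h_tilde_closed(1)[OF xy] by (simp add: \<nu>_def)
  qed
  moreover have "\<nu> (lie_scale L a x) = a * \<nu> x" if x: "x \<in> h_tilde B H" for a x
  proof -
    have "x \<in> lie_carrier L" using x h_tilde_subset by (auto simp: carrier_L)
    then have "act (lie_scale L a x) w0 = scaleV a (act x w0)"
      using act_module unfolding lie_module_def by blast
    then have "scaleV (c (lie_scale L a x)) w0 = scaleV (a * c x) w0"
      using c[OF _ assms(1)] x h_tilde_closed(2)[OF x x] by simp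
    then show ?thesis using assms(2) x h_tilde_closed(2)[OF x x] by (simp add: \<nu>_def)
  qed
  ultimately have "\<nu> \<in> tau_weights sc bracket form B H"
    unfolding tau_weights_def dual_space_def by (simp add: \<nu>_def)
  moreover have "op_wspace \<mu> \<delta> \<subseteq> weight_space scaleV act (h_tilde B H) \<nu>"
    using c by (auto simp: weight_space_def \<nu>_def)
  ultimately show ?thesis by blast
qed

lemma op_wspace_finite: "\<exists>F. finite F \<and> op_wspace \<mu> \<delta> \<subseteq> V0.span F"
proof (cases "op_wspace \<mu> \<delta> \<subseteq> {0}")
  case True
  then show ?thesis by (intro exI[of _ "{}"]) simp
next
  case False
  then obtain w0 where "w0 \<in> op_wspace \<mu> \<delta>" "w0 \<noteq> 0" by blast
  then obtain \<nu> where "\<nu> \<in> tau_weights sc bracket form B H"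
      "op_wspace \<mu> \<delta> \<subseteq> weight_space scaleV act (h_tilde B H) \<nu>"
    using op_wspace_subset_weight_space by blast
  then show ?thesis using act_finite unfolding fin_dim_def by (meson order_trans)
qed

definition wt :: "(('g, 'n) toroidal set \<Rightarrow> complex) \<Rightarrow> 'g \<Rightarrow> complex" where
  "wt \<nu> h = (if h \<in> H then \<nu> (cl (tor_X h 0)) else 0)"

definition wt_d :: "(('g, 'n) toroidal set \<Rightarrow> complex) \<Rightarrow> complex ^ 'n" where
  "wt_d \<nu> = (\<chi> i. \<nu> (cl (tor_D (axis i 1) 0)))"

lemma weight_space_subset_op_wspace:
  "weight_space scaleV act (h_tilde B H) \<nu> \<subseteq> op_wspace (wt \<nu>) (wt_d \<nu>)"
proof
  fix w assume "w \<in> weight_space scaleV act (h_tilde B H) \<nu>"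
  then have w: "act x w = scaleV (\<nu> x) w" if "x \<in> h_tilde B H" for x
    using that by (simp add: weight_space_def)
  have "op (tor_D u 0) w = scaleV (cdot u (wt_d \<nu>)) w" for u
  proof -
    have "op (tor_D (axis i 1) 0) w = scaleV (wt_d \<nu> $ i) w" for i
      using w[OF h_tilde_d] by (simp add: op_def wt_d_def)
    then show ?thesis by (simp add: opd_expand[of u] cdot_def V0.scale_sum_left)
  qed
  then show "w \<in> op_wspace (wt \<nu>) (wt_d \<nu>)"
    using w[OF h_tilde_E] by (simp add: op_wspace_def op_def wt_def)
qed

lemma span_op_wspaces: "v \<in> V0.span {w. \<exists>\<mu> \<delta>. w \<in> op_wspace \<mu> \<delta>}"
proof -
  obtain f where f: "finite {i. f i \<noteq> 0}" "\<And>i. i \<in> tau_weights sc bracket form B H \<Longrightarrow>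
        f i \<in> weight_space scaleV act (h_tilde B H) i"
      "\<And>i. i \<notin> tau_weights sc bracket form B H \<Longrightarrow> f i = 0" "v = (\<Sum>i | f i \<noteq> 0. f i)"
    using act_integrable unfolding integrable_module_def is_direct_sum_def by blast
  have "f i \<in> V0.span {w. \<exists>\<mu> \<delta>. w \<in> op_wspace \<mu> \<delta>}" if "f i \<noteq> 0" for i
  proof (rule V0.span_base)
    have "f i \<in> op_wspace (wt i) (wt_d i)"
      using that f(2,3) weight_space_subset_op_wspace by blast
    then show "f i \<in> {w. \<exists>\<mu> \<delta>. w \<in> op_wspace \<mu> \<delta>}" by blast
  qed
  then show ?thesis unfolding f(4) by (intro V0.span_sum) simp
qed

lemma ex_op_X_nonzero: "\<exists>X r v. op (tor_X X r) v \<noteq> 0"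
proof (rule ccontr)
  assume "\<not> ?thesis"
  then have X: "op (tor_X X r) v = 0" for X r v by blast
  have "op (f, 0, 0) v = 0" for f v
  proof (induction f rule: pm_single_induct)
    case zero
    then show ?case by (simp flip: zero_prod_def)
  next
    case (single r Y f)
    have "(Poly_Mapping.single r Y + f, 0, 0) = tor_X Y r + (f, 0, 0)" by (simp add: tor_X_def)
    moreover have "op (tor_X Y r + (f, 0, 0)) v = op (tor_X Y r) v + op (f, 0, 0) v"
      by (rule op_add) (simp, simp add: T_def omega.subspace_0[OF subspace_H_tilde])
    ultimately show ?case using X single by simp
  qed
  then show False using act_nontrivial by (auto simp: tau_loop_def op_def)
qed

sublocale loop_module sc bracket form H scaleV S "\<lambda>X r. op (tor_X X r)" opK
  "\<lambda>r. op (tor_D (B *v cvec r) r)" "\<lambda>u. op (tor_D u 0)" \<omega>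
proof (intro loop_module.intro loop_module_axioms.intro simple_lie_algebra_cartan.intro
    simple_lie_algebra_cartan_axioms.intro)
  show "lie_algebra sc bracket" by (rule g_lie)
  show "complex_vector_space sc"
    using g.vector_space_axioms by (simp add: complex_vector_space_def)
  show "complex_vector_space scaleV" by (rule V0.complex_vector_space_axioms)
  show "simple_lie_algebra sc bracket" "nondegenerate_invariant_symmetric_form sc bracket form"
    "cartan_subalgebra sc bracket H" "root_base sc bracket H S"
    by (rule g_simple g_form g_cartan S_base)+
  show "module_hom scaleV scaleV (op (tor_X X r))" for X r by (rule op_hom) simp
  show "module_hom scaleV scaleV (opK r)" for r by (rule opK_hom)
  show "module_hom scaleV scaleV (op (tor_D (B *v cvec r) r))" for r by (rule op_hom) simp
  show "module_hom scaleV scaleV (op (tor_D u 0))" for u by (rule op_hom) simp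
  show "op (tor_X (X + Y) r) v = op (tor_X X r) v + op (tor_X Y r) v" for X Y r v
    by (simp add: tor_X_add op_add)
  show "op (tor_X (sc c X) r) v = scaleV c (op (tor_X X r) v)" for c X r v
    by (simp add: tor_X_scale op_scale)
  show "opK 0 v = 0" for v by (simp add: opK_def)
  show "\<omega> (r + r') s = \<omega> r s + \<omega> r' s" "\<omega> r (s + s') = \<omega> r s + \<omega> r s'" for r r' s s'
    by (simp_all add: \<omega>_def cvec_add matrix_vector_right_distrib)
  show "\<omega> r r = 0" for r by (simp add: \<omega>_def cdot_skew_self[OF skew])
  show "\<exists>i. \<omega> r (axis i 1) \<noteq> 0" if "r \<noteq> 0" for r
  proof -
    have "cvec (axis i 1) = axis i 1" for i :: 'n by (simp add: cvec_def axis_def vec_eq_iff)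
    then have "\<omega> r (axis i 1) = (B *v cvec r) $ i" for i by (simp add: \<omega>_def cdot_axis)
    then show ?thesis using B_cvec_nonzero[OF that] by (simp add: vec_eq_iff)
  qed
  show "v \<in> V0.span {w. \<exists>\<mu> \<delta>. (\<forall>h\<in>H. op (tor_X h 0) w = scaleV (\<mu> h) w) \<and>
      (\<forall>u. op (tor_D u 0) w = scaleV (cdot u \<delta>) w)}" for v
    using span_op_wspaces[of v] by (simp add: op_wspace_def)
  show "\<exists>F. finite F \<and> {w. (\<forall>h\<in>H. op (tor_X h 0) w = scaleV (\<mu> h) w) \<and>
      (\<forall>u. op (tor_D u 0) w = scaleV (cdot u \<delta>) w)} \<subseteq> V0.span F" for \<mu> \<delta>
    using op_wspace_finite[of \<mu> \<delta>] by (simp add: op_wspace_def)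
  show "\<exists>k. (op (tor_X X r) ^^ k) v = 0"
    if "\<alpha> \<in> roots sc bracket H" "X \<in> root_space sc bracket H \<alpha>" for \<alpha> X r v
  proof -
    have "op (tor_X X r) = act (cl (tor_X X r))" by (rule ext) (simp add: op_def)
    then show ?thesis using act_integrable that unfolding integrable_module_def by simp
  qed
  show "W = {0} \<or> W = UNIV"
    if W: "V0.subspace W" "\<And>X r v. v \<in> W \<Longrightarrow> op (tor_X X r) v \<in> W" "\<And>r v. v \<in> W \<Longrightarrow> opK r v \<in> W"
      "\<And>r v. v \<in> W \<Longrightarrow> op (tor_D (B *v cvec r) r) v \<in> W" "\<And>u v. v \<in> W \<Longrightarrow> op (tor_D u 0) v \<in> W" for W
  proof -
    have "op x w \<in> W" if "x \<in> T" "w \<in> W" for x w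
      using W(1) that(2) by (rule op_mem) (intro W(2-5) that)+
    then have "\<forall>x\<in>lie_carrier L. \<forall>w\<in>W. act x w \<in> W" by (auto simp: carrier_L op_def)
    then show ?thesis using act_irreducible W(1) unfolding irreducible_module_def by blast
  qed
qed (rule opE_opE opE_opK opK_opK opD_opE opD_opK opd_opE opd_opK opd_opD ex_op_X_nonzero)+

section \<open>Transfer of the bound and of the vanishing center to \<open>V_plus\<close>\<close>

lemma V_plus_subset: "V_plus sc bracket B H P act \<subseteq> Vplus"
proof
  fix v assume v: "v \<in> V_plus sc bracket B H P act"
  have "op (tor_X X r) v = 0" if "\<alpha> \<in> P" "X \<in> root_space sc bracket H \<alpha>" for \<alpha> X r
  proof -
    have "tor_X X r \<in> tor.span {tor_X X r |\<alpha> X r. \<alpha> \<in> P \<and> X \<in> root_space sc bracket H \<alpha>}"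
      using that by (intro tor.span_base) blast
    then show ?thesis using v by (simp add: V_plus_def tau_plus_def op_def)
  qed
  then show "v \<in> Vplus" by (simp add: Vplus_def)
qed

lemma V_plus_bounded:
  "\<exists>M::nat. \<forall>\<nu>\<in>tau_weights sc bracket form B H.
     fin_dim scaleV (V_plus sc bracket B H P act \<inter> weight_space scaleV act (h_tilde B H) \<nu>) \<and>
     V0.dim (V_plus sc bracket B H P act \<inter> weight_space scaleV act (h_tilde B H) \<nu>) \<le> M"
proof -
  obtain M where M: "\<And>\<mu> \<delta> J. (\<mu>, \<delta>) \<in> weights \<Longrightarrow> V0.independent J \<Longrightarrow> J \<subseteq> Vplus \<inter> wspace \<mu> \<delta> \<Longrightarrow>
      finite J \<and> card J \<le> M"
    using Vplus_bounded by metis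
  have "fin_dim scaleV A \<and> V0.dim A \<le> M"
    if A: "A = V_plus sc bracket B H P act \<inter> weight_space scaleV act (h_tilde B H) \<nu>" for A \<nu>
  proof -
    obtain J where J: "J \<subseteq> A" "V0.independent J" "A \<subseteq> V0.span J"
      by (rule V0.maximal_independent_subset[of A])
    have "weight_space scaleV act (h_tilde B H) \<nu> \<subseteq> wspace (wt \<nu>) (wt_d \<nu>)"
      using weight_space_subset_op_wspace by (simp add: wspace_def op_wspace_def)
    then have "J \<subseteq> Vplus \<inter> wspace (wt \<nu>) (wt_d \<nu>)" using J(1) A V_plus_subset by blast
    moreover have "(wt \<nu>, wt_d \<nu>) \<in> weights" by (simp add: weights_def wt_def)
    ultimately have "finite J" "card J \<le> M" using M J(2) by blast+
    then show ?thesis using J V0.basis_card_eq_dim[OF J(1,3,2)] by (auto simp: fin_dim_def)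
  qed
  then show ?thesis by blast
qed

lemma V_plus_center:
  assumes "z \<in> tau_center B" "v \<in> V_plus sc bracket B H P act"
  shows "act z v = 0"
proof -
  obtain y where z: "z = cl (0, y, 0)" using assms(1) by (auto simp: tau_center_def)
  have mem: "(0, x, 0) \<in> T" for x
    by (simp add: T_def omega.subspace_0[OF subspace_H_tilde])
  show ?thesis
  \<comment> \<open>The vanishing of all \<open>K r\<close> presupposes a nonzero vector of
    \<open>Vplus\<close>; a nonzero \<open>v\<close> serves as this vector.\<close>
  proof (cases "v = 0")
    case True
    then show ?thesis using module_hom.zero[OF op_hom[OF mem]] by (simp add: z op_def)
  next
    case False
    have K: "opK r v = 0" for r by (rule K_eq_zero[of v]) (use False assms(2) V_plus_subset in auto)
    have "op (0, y, 0) v = 0"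
    proof (induction y rule: center_K_induct)
      case zero
      then show ?case by (simp flip: zero_prod_def)
    next
      case (K u r x)
      have "op (0, center_K u r + x, 0) v = op (tor_K u r + (0, x, 0)) v" by (simp add: tor_K_def)
      also have "\<dots> = op (tor_K u r) v + op (0, x, 0) v" by (rule op_add) (simp_all add: mem)
      finally show ?case using K \<open>\<And>r. opK r v = 0\<close> by (simp add: op_K)
    qed
    then show ?thesis by (simp add: z op_def)
  qed
qed

lemma positive_roots_eq: "P = {\<alpha> \<in> roots sc bracket H. nat_combination S \<alpha>}"
  by (rule P_def)

end
theorem proposition5p1:
  fixes sc :: "complex \<Rightarrow> 'g::ab_group_add \<Rightarrow> 'g"
    and bracket :: "'g \<Rightarrow> 'g \<Rightarrow> 'g"
    and form :: "'g \<Rightarrow> 'g \<Rightarrow> complex"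
    and H :: "'g set"
    and P :: "('g \<Rightarrow> complex) set"
    and m :: nat
    and B :: "complex ^ 'n::finite ^ 'n"
    and scaleV :: "complex \<Rightarrow> 'v::ab_group_add \<Rightarrow> 'v"
    and act :: "('g, 'n) toroidal set \<Rightarrow> 'v \<Rightarrow> 'v"
  assumes "simple_lie_algebra sc bracket"
    and "nondegenerate_invariant_symmetric_form sc bracket form"
    and "cartan_subalgebra sc bracket H"
    and "positive_system sc bracket H P"
    and "m \<ge> 1" and "CARD('n) = 2 * m"
    and "transpose B = - B" and "invertible B"
    and "irreducible_module (tau sc bracket form B) scaleV act"
    and "integrable_module sc bracket form B H scaleV act"
    and "\<forall>\<mu>\<in>tau_weights sc bracket form B H.
           fin_dim scaleV (weight_space scaleV act (h_tilde B H) \<mu>)"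
    and "\<forall>i v. act (tau_class B (tor_K (axis i 1) 0)) v = 0"
    and "\<exists>x\<in>tau_loop B. \<exists>v. act x v \<noteq> 0"
  shows "(\<exists>M::nat. \<forall>\<mu>\<in>tau_weights sc bracket form B H.
            fin_dim scaleV (V_plus sc bracket B H P act \<inter> weight_space scaleV act (h_tilde B H) \<mu>) \<and>
            vector_space.dim scaleV (V_plus sc bracket B H P act \<inter> weight_space scaleV act (h_tilde B H) \<mu>) \<le> M)
       \<and> (\<forall>z\<in>tau_center B. \<forall>v\<in>V_plus sc bracket B H P act. act z v = 0)"
proof -
  obtain S where S: "root_base sc bracket H S" "P = {\<alpha> \<in> roots sc bracket H. nat_combination S \<alpha>}"
    using assms(4) unfolding positive_system_def by blast
  interpret tau_module sc bracket form H S B scaleV act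
    by (rule tau_module.intro) (fact assms S)+
  note P = S(2)[folded positive_roots_eq]
  show ?thesis unfolding P using V_plus_bounded V_plus_center by blast
qed

end
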